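(* Let $F:\mathbb{R}^d\to\mathbb{R}$ be the spherical cluster objective function of $x_1,\dots,x_n$ with parameter $\eta$, and assume that the genericity assumptions (G) hold. Let $x^*$ be the point where $F$ reaches its minimum and let $c=\#I^0(x^* )$ be the number of spheres $S_i$ on which $x^*$ lies. Then there exists a neighborhood $U$ of $x^*$ such that, for any starting point in $U$, the exact algorithm described in the context converges (that is, reaches $x^*$) in at most $3^{c}$ steps.
   Context: **Objective function.** Let $x_1,\dots,x_n\in\mathbb{R}^d$, at least two of them distinct, $0<\eta<1-\frac1n$, $\eta'=\frac{n}{n-1}\eta$, $\bar x=\frac1n\sum_j x_j$. Put $f_i(x)=\|x_i-x\|^2-\frac{\eta}{n-1}\sum_{j}\|x_j-x\|^2$ and $F(x)=\sum_{i=1}^n\max(0,f_i(x))$. One has $f_i(x)=(1-\eta')(\|x-c_i\|^2-R_i^2)$ with $c_i=\frac{x_i-\eta'\bar x}{1-\eta'}$ and $R_i^2=\|c_i\|^2-\frac{\|x_i\|^2-\frac{\eta'}{n}\sum_j\|x_j\|^2}{1-\eta'}$. The function $F$ is strongly convex, with a unique minimizer $x^*$. **Cells.** $S_i=\{x:\|x-c_i\|=R_i\}$. For $x\in\mathbb{R}^d$, $I^+(x),I^0(x),I^-(x)$ are the sets of indices $i$ with $f_i(x)>0$, $=0$, $<0$ respectively. Two points are equivalent if they have the same triple $(I^+,I^0,I^-)$; the equivalence classes are the cells, and $\mathcal{C}(x)$ is the cell of $x$. A cell is full dimensional if its $I^0$ is empty. For $J\subset\{1,\dots,n\}$: $f_J=\sum_{i\in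 J}f_i$, $S_J=\bigcap_{i\in J}S_i$, and, for $J\ne\emptyset$, $c_J=\frac1{\#J}\sum_{i\in J}c_i$ (the minimizer of $f_J$). **Genericity assumptions (G).** The centers $c_i$ are in generic position (any at most $d+1$ of them are affinely independent), and the spheres intersect transversely: for every $x\in\mathbb{R}^d$ the vectors $(x-c_i)_{i\in I^0(x)}$ are linearly independent. Computations are in exact real arithmetic. **Clarke data.** The subdifferential of $F$ at $x$ is $\partial_*F(x)=\{\nabla f_{I^+(x)}(x)+\sum_{i\in I^0(x)}\lambda_i\nabla f_i(x):0\le\lambda_i\le1\}$. Its element of least norm is $\nabla_*F(x)=\nabla f_{I^+(x)}(x)+\sum_{i\in I^0(x)}\alpha_i\nabla f_i(x)$, for unique coefficients $\alpha_i\in[0,1]$. Put $I^0_*(x)=\{i\in I^0(x):0<\alpha_i<1\}$, $I^+_*(x)=I^+(x)\cup\{i\in I^0(x):\alpha_i=1\}$, $I^-_*(x)=I^-(x)\cup\{i\in I^0(x):\alpha_i=0\}$, and let $\mathcal{C}^*(x)$ be the cell with index triple $(I^+_*(x),I^0_*(x),I^-_*(x))$. **Exact algorithm.** From the current point $x$ (initially the starting point), one step produces the next point as follows. 1. If $I^0(x)=\emptyset$: if $c_{I^+(x)}\in\mathcal{C}(x)$, the next point is $c_{I^+(x)}$ and the algorithm stops. Otherwise the next point is the first point of the half-line $\{x-t\nabla f_{I^+(x)}(x):t>0\}$ lying in a cell other than $\mathcal{C}(x)$. 2. If $I^0(x)\neq\emptyset$: compute $\nabla_*F(x)$ and $I^+_*(x),I^0_*(x),I^-_*(x)$.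 (a) If $\nabla_*F(x)=0$, stop: $x$ is the minimizer. (b) Otherwise, if $I^0_*(x)=\emptyset$: if $c_{I^+_*(x)}\in\mathcal{C}^*(x)$, the next point is $c_{I^+_*(x)}$ and the algorithm stops; else follow the half-line $x-t\nabla f_{I^+_*(x)}(x)$, $t>0$, inside $\mathcal{C}^*(x)$, and the next point is the first point on it that leaves $\mathcal{C}^*(x)$. (c) Otherwise, let $S=S_{I^0_*(x)}$, a sphere with center $c_S$ and radius $R_S$ inside an affine subspace, and let $y$ be the point where $f_{I^+_*(x)}$ restricted to $S$ reaches its minimum. If $y\in\mathcal{C}^*(x)$, the next point is $y$. Otherwise the next point is the first point leaving $\mathcal{C}^*(x)$ on the geodesic of $S$ from $x$ to $y$ (any such geodesic if $x,y$ are antipodal), parameterized by $\lambda\in[0,1]\mapsto c_S+R_S\frac{(1-\lambda)x+\lambda y-c_S}{\|(1-\lambda)x+\lambda y-c_S\|}$.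
   Formalization: Convergence is claimed except for executions that meet a point where case 2(c) prescribes no next point: y is not in C*(x) and the geodesic from x to y does not enter C*(x) near x; (G) does not exclude such points arbitrarily close to x*. *)

theory Defs
  imports "HOL-Analysis.Analysis"
begin

definition gradient :: "('a::euclidean_space \<Rightarrow> real) \<Rightarrow> 'a \<Rightarrow> 'a" where
  "gradient g z = (THE D. GDERIV g z :> D)"

text \<open>Families rather than sets: repeated members count as dependent.\<close>

definition aff_independent_family :: "(nat \<Rightarrow> 'a::euclidean_space) \<Rightarrow> nat set \<Rightarrow> bool" where
  "aff_independent_family v J \<longleftrightarrow> inj_on v J \<and> \<not> affine_dependent (v ` J)"

definition lin_independent_family :: "(nat \<Rightarrow> 'a::euclidean_space) \<Rightarrow> nat set \<Rightarrow> bool" where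
  "lin_independent_family v J \<longleftrightarrow> inj_on v J \<and> independent (v ` J)"

text \<open>A curve starts at parameter 0, and its initial point need not belong to \<open>C\<close>.
  In \<open>first_exit \<gamma> T C y\<close>, the curve runs inside \<open>C\<close> for positive
  parameters below some \<open>t \<in> T\<close>, and \<open>y = \<gamma> t\<close> is its first point outside \<open>C\<close>.\<close>

definition first_exit :: "(real \<Rightarrow> 'a) \<Rightarrow> real set \<Rightarrow> 'a set \<Rightarrow> 'a \<Rightarrow> bool" where
  "first_exit \<gamma> T C y \<longleftrightarrow>
     (\<exists>t\<in>T. 0 < t \<and> y = \<gamma> t \<and> \<gamma> t \<notin> C \<and> (\<forall>s. 0 < s \<and> s < t \<longrightarrow> \<gamma> s \<in> C))"

text \<open>\<open>c\<close> and \<open>r\<close> are determined by a nonempty \<open>S\<close>, since \<open>c\<close> lies in \<open>A\<close> and \<open>r > 0\<close>.\<close>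

definition sphere_with :: "'a::euclidean_space set \<Rightarrow> 'a \<Rightarrow> real \<Rightarrow> bool" where
  "sphere_with S c r \<longleftrightarrow> (\<exists>A. affine A \<and> c \<in> A \<and> 0 < r \<and> S = A \<inter> sphere c r)"

text \<open>In the antipodal case the formula with the normalised chord breaks down at 1/2, and the
  geodesics are the half great circles through any \<open>w \<in> S\<close> at a right angle from \<open>x\<close>.\<close>

definition sphere_geodesic ::
    "'a::euclidean_space set \<Rightarrow> 'a \<Rightarrow> 'a \<Rightarrow> (real \<Rightarrow> 'a) \<Rightarrow> bool" where
  "sphere_geodesic S x y \<gamma> \<longleftrightarrow>
     (\<exists>c r. sphere_with S c r \<and>
        (if y - c = - (x - c)
         then \<exists>w\<in>S. (w - c) \<bullet> (x - c) = 0 \<and>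
                \<gamma> = (\<lambda>t. c + cos (pi * t) *\<^sub>R (x - c) + sin (pi * t) *\<^sub>R (w - c))
         else \<gamma> = (\<lambda>t. c + (r / norm ((1 - t) *\<^sub>R x + t *\<^sub>R y - c)) *\<^sub>R
                          ((1 - t) *\<^sub>R x + t *\<^sub>R y - c))))"

context
  fixes n :: nat and \<eta> :: real and p :: "nat \<Rightarrow> 'a::euclidean_space"
begin

text \<open>The data points are \<open>p 1, ..., p n\<close>; all index sets are subsets of \<open>{1..n}\<close>.\<close>

definition eta' :: real where
  "eta' = real n / (real n - 1) * \<eta>"

definition mean :: 'a where
  "mean = (1 / real n) *\<^sub>R (\<Sum>j\<in>{1..n}. p j)"

definition f :: "nat \<Rightarrow> 'a \<Rightarrow> real" where
  "f i z = (norm (p i - z))\<^sup>2 - \<eta> / (real n - 1) * (\<Sum>j\<in>{1..n}. (norm (p j - z))\<^sup>2)"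

definition F :: "'a \<Rightarrow> real" where
  "F z = (\<Sum>i\<in>{1..n}. max 0 (f i z))"

definition center :: "nat \<Rightarrow> 'a" where
  "center i = (1 / (1 - eta')) *\<^sub>R (p i - eta' *\<^sub>R mean)"

definition radius_sq :: "nat \<Rightarrow> real" where
  "radius_sq i = (norm (center i))\<^sup>2
     - ((norm (p i))\<^sup>2 - eta' / real n * (\<Sum>j\<in>{1..n}. (norm (p j))\<^sup>2)) / (1 - eta')"

text \<open>For a negative argument \<open>sqrt\<close> is negative, so the sphere is then empty, as it should be.\<close>

definition Sph :: "nat \<Rightarrow> 'a set" where
  "Sph i = {z. norm (z - center i) = sqrt (radius_sq i)}"

definition Sph_set :: "nat set \<Rightarrow> 'a set" where
  "Sph_set J = (\<Inter>i\<in>J. Sph i)"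

definition f_set :: "nat set \<Rightarrow> 'a \<Rightarrow> real" where
  "f_set J z = (\<Sum>i\<in>J. f i z)"

definition center_set :: "nat set \<Rightarrow> 'a" where
  "center_set J = (1 / real (card J)) *\<^sub>R (\<Sum>i\<in>J. center i)"

definition Ipos :: "'a \<Rightarrow> nat set" where
  "Ipos z = {i\<in>{1..n}. f i z > 0}"

definition Izero :: "'a \<Rightarrow> nat set" where
  "Izero z = {i\<in>{1..n}. f i z = 0}"

definition Ineg :: "'a \<Rightarrow> nat set" where
  "Ineg z = {i\<in>{1..n}. f i z < 0}"

definition cell_of_triple :: "nat set \<Rightarrow> nat set \<Rightarrow> nat set \<Rightarrow> 'a set" where
  "cell_of_triple P Z N = {z. Ipos z = P \<and> Izero z = Z \<and> Ineg z = N}"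

definition cell :: "'a \<Rightarrow> 'a set" where
  "cell z = cell_of_triple (Ipos z) (Izero z) (Ineg z)"

definition generic_position :: bool where
  "generic_position \<longleftrightarrow>
     (\<forall>J. J \<subseteq> {1..n} \<and> card J \<le> DIM('a) + 1 \<longrightarrow> aff_independent_family center J) \<and>
     (\<forall>z. lin_independent_family (\<lambda>i. z - center i) (Izero z))"

definition clarke_comb :: "'a \<Rightarrow> (nat \<Rightarrow> real) \<Rightarrow> 'a" where
  "clarke_comb z l = gradient (f_set (Ipos z)) z + (\<Sum>i\<in>Izero z. l i *\<^sub>R gradient (f i) z)"

definition subdifferential :: "'a \<Rightarrow> 'a set" where
  "subdifferential z = {clarke_comb z l | l. \<forall>i\<in>Izero z. 0 \<le> l i \<and> l i \<le> 1}"

definition min_subgradient :: "'a \<Rightarrow> 'a" where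
  "min_subgradient z = (THE g. is_arg_min norm (\<lambda>h. h \<in> subdifferential z) g)"

text \<open>The value 0 off \<open>Izero z\<close> is only there to make the coefficient function unique.\<close>

definition alpha :: "'a \<Rightarrow> nat \<Rightarrow> real" where
  "alpha z = (THE l. (\<forall>i\<in>Izero z. 0 \<le> l i \<and> l i \<le> 1) \<and> (\<forall>i. i \<notin> Izero z \<longrightarrow> l i = 0) \<and>
                     clarke_comb z l = min_subgradient z)"

definition Izero_star :: "'a \<Rightarrow> nat set" where
  "Izero_star z = {i\<in>Izero z. 0 < alpha z i \<and> alpha z i < 1}"

definition Ipos_star :: "'a \<Rightarrow> nat set" where
  "Ipos_star z = Ipos z \<union> {i\<in>Izero z. alpha z i = 1}"

definition Ineg_star :: "'a \<Rightarrow> nat set" where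
  "Ineg_star z = Ineg z \<union> {i\<in>Izero z. alpha z i = 0}"

definition cell_star :: "'a \<Rightarrow> 'a set" where
  "cell_star z = cell_of_triple (Ipos_star z) (Izero_star z) (Ineg_star z)"

definition half_line :: "'a \<Rightarrow> nat set \<Rightarrow> real \<Rightarrow> 'a" where
  "half_line x J t = x - t *\<^sub>R gradient (f_set J) x"

text \<open>The point called \<open>y\<close> in case (2c) of the algorithm.\<close>

definition sphere_target :: "'a \<Rightarrow> 'a \<Rightarrow> bool" where
  "sphere_target x y \<longleftrightarrow>
     is_arg_min (f_set (Ipos_star x)) (\<lambda>z. z \<in> Sph_set (Izero_star x)) y"

text \<open>\<open>step x y b\<close>: one step leads from \<open>x\<close> to \<open>y\<close>, and \<open>b\<close> tells whether the algorithm stops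
  there.  It is a relation because of the free choice of a geodesic between antipodal points.
  No rule applies when \<open>Izero x \<noteq> {}\<close> and \<open>min_subgradient x = 0\<close>: the algorithm has
  stopped at \<open>x\<close> (case (2a)).\<close>

inductive step :: "'a \<Rightarrow> 'a \<Rightarrow> bool \<Rightarrow> bool" where
  full_center:
    "Izero x = {} \<Longrightarrow> center_set (Ipos x) \<in> cell x \<Longrightarrow> step x (center_set (Ipos x)) True"
| full_exit:
    "Izero x = {} \<Longrightarrow> center_set (Ipos x) \<notin> cell x \<Longrightarrow>
     first_exit (half_line x (Ipos x)) {0<..} (cell x) y \<Longrightarrow> step x y False"
| star_center:
    "Izero x \<noteq> {} \<Longrightarrow> min_subgradient x \<noteq> 0 \<Longrightarrow> Izero_star x = {} \<Longrightarrow>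
     center_set (Ipos_star x) \<in> cell_star x \<Longrightarrow> step x (center_set (Ipos_star x)) True"
| star_exit:
    "Izero x \<noteq> {} \<Longrightarrow> min_subgradient x \<noteq> 0 \<Longrightarrow> Izero_star x = {} \<Longrightarrow>
     center_set (Ipos_star x) \<notin> cell_star x \<Longrightarrow>
     first_exit (half_line x (Ipos_star x)) {0<..} (cell_star x) y \<Longrightarrow> step x y False"
| sphere_min:
    "Izero x \<noteq> {} \<Longrightarrow> min_subgradient x \<noteq> 0 \<Longrightarrow> Izero_star x \<noteq> {} \<Longrightarrow>
     sphere_target x y \<Longrightarrow> y \<in> cell_star x \<Longrightarrow> step x y False"
| sphere_exit:
    "Izero x \<noteq> {} \<Longrightarrow> min_subgradient x \<noteq> 0 \<Longrightarrow> Izero_star x \<noteq> {} \<Longrightarrow>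
     sphere_target x y \<Longrightarrow> y \<notin> cell_star x \<Longrightarrow>
     sphere_geodesic (Sph_set (Izero_star x)) x y \<gamma> \<Longrightarrow>
     first_exit \<gamma> {0<..1} (cell_star x) z \<Longrightarrow> step x z False"

text \<open>The instruction of case (2c) presupposes that the geodesic starts inside \<open>cell_star x\<close>.
  This may fail if some \<open>i \<in> Izero x\<close> has \<open>alpha x i \<in> {0, 1}\<close> while \<open>gradient (f i) x\<close> is
  orthogonal to \<open>min_subgradient x\<close>: the geodesic is then tangent to \<open>Sph i\<close>, may stay on it,
  and has no first point leaving \<open>cell_star x\<close>.  Genericity does not exclude this, even
  arbitrarily close to the minimizer.  Example: \<open>Izero xs = {1, 2}\<close> in dimension 3 with
  \<open>alpha xs 1 = 0\<close>, \<open>0 < alpha xs 2 < 1\<close> and \<open>center 1 - center 2\<close> orthogonal to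
  \<open>center 2 - xs\<close>; every other point of \<open>Sph 1 \<inter> Sph 2\<close> near \<open>xs\<close> is of this kind.
  At such a point the algorithm prescribes nothing.\<close>

definition undefined_step :: "'a \<Rightarrow> bool" where
  "undefined_step x \<longleftrightarrow> Izero x \<noteq> {} \<and> min_subgradient x \<noteq> 0 \<and> Izero_star x \<noteq> {} \<and>
     (\<exists>y \<gamma>. sphere_target x y \<and> y \<notin> cell_star x \<and>
            sphere_geodesic (Sph_set (Izero_star x)) x y \<gamma> \<and>
            (\<forall>\<^sub>F t in at_right 0. \<gamma> t \<notin> cell_star x))"

text \<open>\<open>reaches_within xs k x\<close>: every execution from \<open>x\<close> is at \<open>xs\<close> after at most \<open>k\<close> steps, and
  before that it never stops or gets stuck, except where the algorithm prescribes nothing.\<close>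

primrec reaches_within :: "'a \<Rightarrow> nat \<Rightarrow> 'a \<Rightarrow> bool" where
  "reaches_within xs 0 x \<longleftrightarrow> x = xs"
| "reaches_within xs (Suc k) x \<longleftrightarrow> x = xs \<or>
     ((undefined_step x \<or> (\<exists>y b. step x y b)) \<and>
      (\<forall>y. step x y True \<longrightarrow> y = xs) \<and>
      (\<forall>y. step x y False \<longrightarrow> reaches_within xs k y))"

end

end

(* Let P be the indices with positive coefficient 1 and Z the indices of the spheres followed in some
   step near the minimizer xs.  All f i are quadratic with the same leading coefficient \<kappa>, so the
   inner product of the gradients of two combinations of them at x differs from the one at xs only
   by a linear expression in their values.  Hence the coefficients of the projected gradient at a
   point x of the stratum (P, Z) solve a linear system in which x enters only through
   \<tau> = 2 * \<kappa> * (F x - F xs): they are affine in \<tau>, the squared norm of the projected gradient is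
   a polynomial energy P Z in \<tau>, and so is (slope P Z j) its inner product with the gradient of
   another f j vanishing at x.  For small \<tau> > 0 each of these finitely many polynomials is
   identically zero or keeps its sign.

   In one step F decreases.  At the point where the step leaves the stratum, the old coefficients
   represent a subgradient.  It is not the minimal one, because slope P Z j has the wrong sign for the
   sphere j that is hit; here slope P Z j cannot be identically zero, since then f j would satisfy a
   homogeneous linear differential equation along the path and could not reach zero.  (For the same
   reason a path that starts on such a sphere stays on it, which is the undefined case.)  So the energy
   of the next stratum is smaller at the current \<tau>, hence at every small \<tau>.  No stratum is used
   twice, and there are at most 3 ^ c of them. *)
theory Submission
  imports Defs "HOL-Computational_Algebra.Polynomial"
begin

text \<open>Half-lines and arcs are treated alike: both are reparametrised integral curves of the
  negative projected gradient, and both end, at a center or at the minimum on the sphere, where this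
  field vanishes. If that end lies in the current cell, its coefficients still lie in [0, 1], so 0
  is a subgradient and the end is \<open>xs\<close>; hence a step near \<open>xs\<close> that does
  not leave its cell is the last one. On \<open>Z\<close> the coefficients stay strictly between 0
  and 1 because they do so at the starting point of the step and no sign changes for small \<tau>.

  The neighbourhood is a sublevel set of F, which no step can leave. Transversality is used at every
  point visited, not only at \<open>xs\<close>: it makes the coefficients of a subgradient unique,
  so that a coefficient function different from the minimal one has strictly larger norm, and it
  keeps the current point away from the center of the sphere that is followed. The target on that
  sphere is never antipodal to the current point, so the geodesic is unique as well.\<close>

section \<open>Linear algebra and gradients\<close>

lemma lin_independent_family_sum_eq_0:
  assumes "lin_independent_family v J" "finite J" "(\<Sum>i\<in>J. l i *\<^sub>R v i) = 0" "i \<in> J"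
  shows "l i = 0"
proof -
  have inj: "inj_on v J" and ind: "independent (v ` J)"
    using assms(1) by (auto simp: lin_independent_family_def)
  have "(\<Sum>w\<in>v ` J. l (the_inv_into J v w) *\<^sub>R w) = (\<Sum>i\<in>J. l i *\<^sub>R v i)"
    by (subst sum.reindex[OF inj]) (auto intro!: sum.cong simp: the_inv_into_f_f[OF inj])
  then have "(\<Sum>w\<in>v ` J. l (the_inv_into J v w) *\<^sub>R w) = 0"
    using assms(3) by simp
  moreover have "\<forall>c. (\<Sum>w\<in>v ` J. c w *\<^sub>R w) = 0 \<longrightarrow> (\<forall>w\<in>v ` J. c w = 0)"
    using ind by (simp add: independent_explicit)
  ultimately have "\<forall>w\<in>v ` J. l (the_inv_into J v w) = 0"
    by (elim allE[of _ "\<lambda>w. l (the_inv_into J v w)"]) simp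
  then show ?thesis
    using assms(4) by (auto simp: the_inv_into_f_f[OF inj])
qed

text \<open>Prescribed values on an independent family extend to a linear functional. The vector
  representing it, projected onto the span, keeps the same inner products with the family and is a
  combination of it.\<close>

lemma lin_independent_family_dual:
  fixes v :: "nat \<Rightarrow> 'a::euclidean_space"
  assumes "lin_independent_family v J" "finite J"
  obtains c where "\<And>i. i \<notin> J \<Longrightarrow> c i = 0"
    "\<And>i. i \<in> J \<Longrightarrow> (\<Sum>l\<in>J. c l *\<^sub>R v l) \<bullet> v i = b i"
proof -
  have inj: "inj_on v J" and ind: "independent (v ` J)"
    using assms(1) by (auto simp: lin_independent_family_def)
  obtain g :: "'a \<Rightarrow> real" where g: "linear g" "\<forall>x\<in>v ` J. g x = b (the_inv_into J v x)"
    using linear_independent_extend[OF ind, of "\<lambda>x. b (the_inv_into J v x)"] by auto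
  define w where "w = adjoint g 1"
  have gw: "g x = x \<bullet> w" for x
    unfolding w_def using adjoint_works[OF g(1), of x 1] by simp
  obtain y z where yz: "y \<in> span (v ` J)" "\<And>u. u \<in> span (v ` J) \<Longrightarrow> orthogonal z u" "w = y + z"
    using orthogonal_subspace_decomp_exists[of "v ` J" w] by metis
  have "y \<in> range (\<lambda>u. \<Sum>x\<in>v ` J. u x *\<^sub>R x)"
    using yz(1) span_finite[of "v ` J"] assms(2) by auto
  then obtain u where "y = (\<Sum>x\<in>v ` J. u x *\<^sub>R x)" by auto
  then have y: "y = (\<Sum>l\<in>J. u (v l) *\<^sub>R v l)"
    using sum.reindex[OF inj] by simp
  show ?thesis
  proof
    show "(if i \<in> J then u (v i) else 0) = 0" if "i \<notin> J" for i using that by simp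
    show "(\<Sum>l\<in>J. (if l \<in> J then u (v l) else 0) *\<^sub>R v l) \<bullet> v i = b i" if "i \<in> J" for i
    proof -
      have "(\<Sum>l\<in>J. (if l \<in> J then u (v l) else 0) *\<^sub>R v l) = y"
        unfolding y by (intro sum.cong) auto
      moreover have "z \<bullet> v i = 0"
        using yz(2)[of "v i"] that by (auto simp: span_base orthogonal_def)
      moreover have "w \<bullet> v i = b i"
        using g(2) gw[of "v i"] that by (simp add: inner_commute the_inv_into_f_f[OF inj])
      ultimately show ?thesis using yz(3) by (simp add: inner_add_left)
    qed
  qed
qed

text \<open>The set is a Minkowski sum of segments, and a sum of two compact sets is
  compact.\<close>

lemma compact_convex_combinations:
  fixes w :: "nat \<Rightarrow> 'a::euclidean_space"
  assumes "finite A"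
  shows "compact {\<Sum>i\<in>A. l i *\<^sub>R w i | l. \<forall>i\<in>A. 0 \<le> l i \<and> l i \<le> 1}"
  using assms
proof (induction A)
  case empty
  then show ?case by simp
next
  case (insert a A)
  have "{\<Sum>i\<in>insert a A. l i *\<^sub>R w i | l. \<forall>i\<in>insert a A. 0 \<le> l i \<and> l i \<le> 1}
     = {x + y | x y. x \<in> (\<lambda>t. t *\<^sub>R w a) ` {0..1::real} \<and>
          y \<in> {\<Sum>i\<in>A. l i *\<^sub>R w i | l. \<forall>i\<in>A. 0 \<le> l i \<and> l i \<le> 1}}" (is "?L = ?R")
  proof
    show "?L \<subseteq> ?R"
    proof
      fix z assume "z \<in> ?L"
      then obtain l where l: "z = (\<Sum>i\<in>insert a A. l i *\<^sub>R w i)"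
        "\<forall>i\<in>insert a A. 0 \<le> l i \<and> l i \<le> 1" by auto
      have "z = l a *\<^sub>R w a + (\<Sum>i\<in>A. l i *\<^sub>R w i)" using l(1) insert.hyps by simp
      then show "z \<in> ?R" using l(2) by fastforce
    qed
    show "?R \<subseteq> ?L"
    proof
      fix z assume "z \<in> ?R"
      then obtain t l where tl: "0 \<le> t" "t \<le> 1" "\<forall>i\<in>A. 0 \<le> l i \<and> l i \<le> 1"
        "z = t *\<^sub>R w a + (\<Sum>i\<in>A. l i *\<^sub>R w i)" by auto
      have "(\<Sum>i\<in>A. l i *\<^sub>R w i) = (\<Sum>i\<in>A. (l(a := t)) i *\<^sub>R w i)"
        using insert.hyps by (intro sum.cong) auto
      then have "z = (\<Sum>i\<in>insert a A. (l(a := t)) i *\<^sub>R w i)"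
        using tl insert.hyps by simp
      moreover have "\<forall>i\<in>insert a A. 0 \<le> (l(a := t)) i \<and> (l(a := t)) i \<le> 1"
        using tl by auto
      ultimately show "z \<in> ?L" by blast
    qed
  qed
  moreover have "compact ((\<lambda>t. t *\<^sub>R w a) ` {0..1::real})"
    by (intro compact_continuous_image continuous_intros) auto
  ultimately show ?case using compact_sums[OF _ insert.IH] by simp
qed

lemma gradient_eqI:
  assumes "GDERIV g z :> D"
  shows "gradient g z = D"
  unfolding gradient_def
proof (rule the_equality)
  show "GDERIV g z :> D" by (fact assms)
  fix D' assume "GDERIV g z :> D'"
  then have "(\<lambda>h. h \<bullet> D') = (\<lambda>h. h \<bullet> D)"
    using assms unfolding gderiv_def by (rule has_derivative_unique)
  then show "D' = D" by (metis inner_commute vector_eq_rdot)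
qed

section \<open>The quadratic functions and their weighted sums\<close>

locale spherical_clusters =
  fixes n :: nat and \<eta> :: real and p :: "nat \<Rightarrow> 'a::euclidean_space"
  assumes distinct_points: "\<exists>i\<in>{1..n}. \<exists>j\<in>{1..n}. p i \<noteq> p j"
    and eta_pos: "0 < \<eta>" and eta_less: "\<eta> < 1 - 1 / real n"
    and generic: "generic_position n \<eta> p"
begin

abbreviation q where "q \<equiv> f n \<eta> p"
abbreviation obj where "obj \<equiv> F n \<eta> p"
abbreviation ctr where "ctr \<equiv> center n \<eta> p"
abbreviation pos where "pos \<equiv> Ipos n \<eta> p"
abbreviation zer where "zer \<equiv> Izero n \<eta> p"
abbreviation neg where "neg \<equiv> Ineg n \<eta> p"

definition \<kappa> :: real where "\<kappa> = 1 - eta' n \<eta>"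

definition gr :: "nat \<Rightarrow> 'a \<Rightarrow> 'a" where "gr i z = (2 * \<kappa>) *\<^sub>R (z - ctr i)"

lemma n_ge_2: "n \<ge> 2"
proof -
  obtain i j where "i \<in> {1..n}" "j \<in> {1..n}" "i \<noteq> j" using distinct_points by metis
  then show ?thesis by auto
qed

lemma kappa_pos: "\<kappa> > 0"
proof -
  have n: "real n \<ge> 2" using n_ge_2 by simp
  have "real n * \<eta> < real n - 1"
    using eta_less n by (simp add: field_simps)
  then show ?thesis using n by (simp add: \<kappa>_def eta'_def field_simps)
qed

text \<open>Completing the square. The sum over the data points is expanded through their mean, and
  the definitions of center and radius are cleared of denominators by multiplying with
  \<open>\<kappa>\<close>.\<close>

lemma q_eq: "q i z = \<kappa> * ((norm (z - ctr i))\<^sup>2 - radius_sq n \<eta> p i)"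
proof -
  have n: "real n \<ge> 2" using n_ge_2 by simp
  have k: "\<kappa> \<noteq> 0" using kappa_pos by simp
  define s where "s = (\<Sum>j\<in>{1..n}. (norm (p j))\<^sup>2)"
  define e where "e = eta' n \<eta>"
  define m where "m = mean n p"
  have e: "\<eta> / (real n - 1) = e / n" using n by (simp add: e_def eta'_def)
  have m: "(\<Sum>j\<in>{1..n}. p j) = real n *\<^sub>R m" using n by (simp add: m_def mean_def)
  have "(\<Sum>j\<in>{1..n}. (norm (p j - z))\<^sup>2) = s - 2 * ((\<Sum>j\<in>{1..n}. p j) \<bullet> z) + n * (z \<bullet> z)"
    unfolding s_def inner_sum_left
    by (simp add: power2_norm_eq_inner inner_diff_left inner_diff_right inner_commute
        sum_subtractf sum.distrib sum_distrib_left algebra_simps)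
  then have sm: "(\<Sum>j\<in>{1..n}. (norm (p j - z))\<^sup>2) = s - 2 * n * (m \<bullet> z) + n * (z \<bullet> z)"
    unfolding m by simp
  have c: "\<kappa> *\<^sub>R ctr i = p i - e *\<^sub>R m"
    using k unfolding center_def \<kappa>_def e_def m_def by simp
  have r: "\<kappa> * radius_sq n \<eta> p i = \<kappa> * (norm (ctr i))\<^sup>2 - ((norm (p i))\<^sup>2 - e / n * s)"
    using k unfolding radius_sq_def \<kappa>_def e_def s_def by (simp add: field_simps)
  have "\<kappa> * (norm (z - ctr i))\<^sup>2 = \<kappa> * (z \<bullet> z) - 2 * ((\<kappa> *\<^sub>R ctr i) \<bullet> z) + \<kappa> * (norm (ctr i))\<^sup>2"
    by (simp add: power2_norm_eq_inner inner_diff_left inner_diff_right inner_commute algebra_simps)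
  then have "\<kappa> * ((norm (z - ctr i))\<^sup>2 - radius_sq n \<eta> p i)
     = \<kappa> * (z \<bullet> z) - 2 * (p i \<bullet> z) + 2 * e * (m \<bullet> z) + (norm (p i))\<^sup>2 - e / n * s"
    unfolding right_diff_distrib r c by (simp add: inner_diff_left)
  also have "\<dots> = q i z"
    unfolding f_def e sm using n
    by (simp add: \<kappa>_def e_def power2_norm_eq_inner inner_diff_left inner_diff_right inner_commute
        field_simps)
  finally show ?thesis by simp
qed

lemma q_expand: "q i x = q i y + gr i y \<bullet> (x - y) + \<kappa> * (norm (x - y))\<^sup>2"
  unfolding q_eq gr_def
  by (simp add: power2_norm_eq_inner inner_diff_left inner_diff_right inner_commute algebra_simps)

lemma gr_shift: "gr i x = gr i y + (2 * \<kappa>) *\<^sub>R (x - y)"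
  unfolding gr_def by (simp add: algebra_simps)

text \<open>The sum of all \<open>q i z\<close> is \<open>\<kappa>\<close> times the sum of the
  squared distances to the data points, which is positive because the points are not all equal. This
  bounds the total weight \<open>M a\<close> below by 1 for every subgradient.\<close>

lemma pos_nonempty: "pos z \<noteq> {}"
proof
  assume "pos z = {}"
  then have "q i z \<le> 0" if "i \<in> {1..n}" for i using that by (force simp: Ipos_def)
  then have le: "(\<Sum>i\<in>{1..n}. q i z) \<le> 0" by (rule sum_nonpos)
  have n: "real n \<ge> 2" using n_ge_2 by simp
  have "(\<Sum>i\<in>{1..n}. q i z) = \<kappa> * (\<Sum>j\<in>{1..n}. (norm (p j - z))\<^sup>2)"
    unfolding f_def \<kappa>_def eta'_def sum_subtractf sum_constant using n by (simp add: algebra_simps)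
  moreover have "(\<Sum>j\<in>{1..n}. (norm (p j - z))\<^sup>2) > 0"
  proof -
    obtain i where "i \<in> {1..n}" "p i \<noteq> z" using distinct_points by metis
    then show ?thesis by (intro sum_pos2[of _ i]) auto
  qed
  ultimately show False using le kappa_pos by (simp add: mult_le_0_iff)
qed

lemma q_GDERIV: "GDERIV (q i) z :> gr i z"
proof -
  have "((\<lambda>z. \<kappa> * ((z - ctr i) \<bullet> (z - ctr i) - radius_sq n \<eta> p i)) has_derivative
     (\<lambda>h. h \<bullet> gr i z)) (at z)"
    unfolding gr_def
    by (auto intro!: derivative_eq_intros simp: inner_commute algebra_simps fun_eq_iff)
  then show ?thesis unfolding gderiv_def q_eq[abs_def] power2_norm_eq_inner .
qed

lemma gradient_q: "gradient (q i) z = gr i z"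
  by (rule gradient_eqI[OF q_GDERIV])

lemma gradient_f_set: "gradient (f_set n \<eta> p J) z = (\<Sum>i\<in>J. gr i z)"
proof (rule gradient_eqI)
  show "GDERIV (f_set n \<eta> p J) z :> (\<Sum>i\<in>J. gr i z)"
    using q_GDERIV unfolding gderiv_def f_set_def[abs_def] inner_sum_right
    by (intro has_derivative_sum) auto
qed

lemma continuous_q: "continuous_on UNIV (q i)"
  unfolding q_eq[abs_def] by (intro continuous_intros)

text \<open>Value, gradient and total weight of one quadratic function given by weights
  \<open>a\<close>; its Hessian is \<open>2 * \<kappa> * M a\<close> times the identity.\<close>

definition \<Phi> :: "(nat \<Rightarrow> real) \<Rightarrow> 'a \<Rightarrow> real" where "\<Phi> a z = (\<Sum>i\<in>{1..n}. a i * q i z)"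
definition G :: "(nat \<Rightarrow> real) \<Rightarrow> 'a \<Rightarrow> 'a" where "G a z = (\<Sum>i\<in>{1..n}. a i *\<^sub>R gr i z)"
definition M :: "(nat \<Rightarrow> real) \<Rightarrow> real" where "M a = (\<Sum>i\<in>{1..n}. a i)"

lemma Phi_expand: "\<Phi> a x = \<Phi> a y + G a y \<bullet> (x - y) + \<kappa> * M a * (norm (x - y))\<^sup>2"
proof -
  have "\<Phi> a x = (\<Sum>i\<in>{1..n}. a i * q i y + (a i *\<^sub>R gr i y) \<bullet> (x - y)
      + a i * (\<kappa> * (norm (x - y))\<^sup>2))"
    unfolding \<Phi>_def by (intro sum.cong refl) (simp add: q_expand[of _ x y] distrib_left)
  also have "\<dots> = \<Phi> a y + G a y \<bullet> (x - y) + M a * (\<kappa> * (norm (x - y))\<^sup>2)"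
    by (simp only: \<Phi>_def G_def M_def inner_sum_left sum.distrib sum_distrib_right)
  finally show ?thesis by simp
qed

lemma G_shift: "G a x = G a y + (2 * \<kappa> * M a) *\<^sub>R (x - y)"
proof -
  have "G a x = (\<Sum>i\<in>{1..n}. a i *\<^sub>R (gr i y + (2 * \<kappa>) *\<^sub>R (x - y)))"
    unfolding G_def by (intro sum.cong refl) (simp add: gr_shift[of _ x y])
  also have "\<dots> = G a y + (\<Sum>i\<in>{1..n}. (a i * (2 * \<kappa>)) *\<^sub>R (x - y))"
    by (simp add: G_def sum.distrib scaleR_add_right)
  also have "(\<Sum>i\<in>{1..n}. (a i * (2 * \<kappa>)) *\<^sub>R (x - y)) = (2 * \<kappa> * M a) *\<^sub>R (x - y)"
    by (simp only: M_def scaleR_sum_left[symmetric] sum_distrib_right[symmetric] mult.commute)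
  finally show ?thesis .
qed

lemma G_add: "G (\<lambda>i. a i + t * b i) z = G a z + t *\<^sub>R G b z"
  by (simp add: G_def sum.distrib scaleR_sum_right algebra_simps)

lemma M_add: "M (\<lambda>i. a i + t * b i) = M a + t * M b"
  by (simp add: M_def sum.distrib sum_distrib_left)

lemma Phi_cong: "(\<And>i. i \<in> {1..n} \<Longrightarrow> a i * q i z = b i * q i z) \<Longrightarrow> \<Phi> a z = \<Phi> b z"
  unfolding \<Phi>_def by (intro sum.cong) auto

lemma G_cong: "(\<And>i. i \<in> {1..n} \<Longrightarrow> a i = b i) \<Longrightarrow> G a z = G b z"
  unfolding G_def by (intro sum.cong) auto

text \<open>Both gradients change by multiples of \<open>h = x - y\<close>. The linear terms in
  \<open>h\<close>, and the term in \<open>h \<bullet> h\<close> with factor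
  \<open>4 * \<kappa>\<^sup>2 * M a * M b\<close>, are exactly those of the differences of values.
  For \<open>a = b\<close> this says that the squared gradient norm of a paraboloid is an affine
  function of its value.\<close>

lemma G_inner_transport:
  "G a x \<bullet> G b x = G a y \<bullet> G b y
     + 2 * \<kappa> * M b * (\<Phi> a x - \<Phi> a y) + 2 * \<kappa> * M a * (\<Phi> b x - \<Phi> b y)"
proof -
  define h where "h = x - y"
  have "G a x \<bullet> G b x = (G a y + (2 * \<kappa> * M a) *\<^sub>R h) \<bullet> (G b y + (2 * \<kappa> * M b) *\<^sub>R h)"
    unfolding h_def G_shift[of _ x y] ..
  moreover have "\<Phi> a x - \<Phi> a y = G a y \<bullet> h + \<kappa> * M a * (h \<bullet> h)"
    "\<Phi> b x - \<Phi> b y = G b y \<bullet> h + \<kappa> * M b * (h \<bullet> h)"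
    unfolding h_def using Phi_expand[of _ x y] by (simp_all add: power2_norm_eq_inner)
  ultimately show ?thesis
    by (simp add: inner_add_left inner_add_right inner_commute algebra_simps)
qed

abbreviation unit :: "nat \<Rightarrow> nat \<Rightarrow> real" where "unit j \<equiv> (\<lambda>i. if i = j then 1 else 0)"

lemma unit_simps:
  assumes "j \<in> {1..n}"
  shows "G (unit j) z = gr j z" "\<Phi> (unit j) z = q j z" "M (unit j) = 1"
  using assms by (simp_all add: G_def \<Phi>_def M_def if_distrib[of "\<lambda>t. t *\<^sub>R _"] if_distrib[of "\<lambda>t. t * _"]
      sum.delta cong: if_cong)

lemma G_gr_transport:
  assumes "j \<in> {1..n}"
  shows "G a x \<bullet> gr j x = G a y \<bullet> gr j y
     + 2 * \<kappa> * (\<Phi> a x - \<Phi> a y) + 2 * \<kappa> * M a * (q j x - q j y)"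
  using G_inner_transport[of a x "unit j" y] by (simp add: unit_simps[OF assms])

text \<open>Transversality, restated for gradients.\<close>

lemma independent_gr: 
  assumes "(\<Sum>i\<in>zer z. l i *\<^sub>R gr i z) = 0" "i \<in> zer z"
  shows "l i = 0"
proof (rule lin_independent_family_sum_eq_0)
  show "lin_independent_family (\<lambda>i. z - ctr i) (zer z)"
    using generic by (simp add: generic_position_def)
  show "finite (zer z)" by (simp add: Izero_def)
  have "(2 * \<kappa>) *\<^sub>R (\<Sum>i\<in>zer z. l i *\<^sub>R (z - ctr i)) = 0"
    using assms(1) by (simp add: gr_def scaleR_sum_right mult.commute)
  then show "(\<Sum>i\<in>zer z. l i *\<^sub>R (z - ctr i)) = 0" using kappa_pos by simp
qed (use assms in auto)

subsection \<open>Coefficient functions representing subgradients\<close>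

text \<open>The weights are also fixed on \<open>pos x\<close> and \<open>neg x\<close>, so that
  \<open>G a x\<close> alone gives a full element of the subdifferential. Outside
  \<open>{1..n}\<close> they are free, so uniqueness is only claimed for indices in
  \<open>{1..n}\<close>.\<close>

definition K :: "'a \<Rightarrow> (nat \<Rightarrow> real) set" where
  "K x = {a. (\<forall>i\<in>pos x. a i = 1) \<and> (\<forall>i\<in>neg x. a i = 0) \<and> (\<forall>i\<in>zer x. 0 \<le> a i \<and> a i \<le> 1)}"

lemma trichotomy_index: "i \<in> {1..n} \<Longrightarrow> i \<in> pos x \<or> i \<in> zer x \<or> i \<in> neg x"
  by (auto simp: Ipos_def Izero_def Ineg_def)

lemma K_bounds: "a \<in> K x \<Longrightarrow> i \<in> {1..n} \<Longrightarrow> 0 \<le> a i \<and> a i \<le> 1"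
  using trichotomy_index[of i x] by (auto simp: K_def)

text \<open>Weights in [0, 1] give quadratic minorants of F. For weights in \<open>K x\<close> the
  minorant touches F at \<open>x\<close>, which replaces the subgradient inequality and keeps the
  second-order term.\<close>

lemma obj_ge_Phi:
  assumes "\<And>i. i \<in> {1..n} \<Longrightarrow> 0 \<le> a i \<and> a i \<le> 1"
  shows "\<Phi> a z \<le> obj z"
  unfolding \<Phi>_def F_def
proof (rule sum_mono)
  fix i assume "i \<in> {1..n}"
  then have "a i * q i z \<le> a i * max 0 (q i z)" "a i * max 0 (q i z) \<le> 1 * max 0 (q i z)"
    using assms[of i] \<open>i \<in> {1..n}\<close> by (intro mult_left_mono mult_right_mono; simp)+
  then show "a i * q i z \<le> max 0 (q i z)" by linarith
qed

lemma obj_eq_Phi: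
  assumes "a \<in> K x" shows "obj x = \<Phi> a x"
  unfolding \<Phi>_def F_def
proof (intro sum.cong refl)
  fix i assume "i \<in> {1..n}"
  then show "max 0 (q i x) = a i * q i x"
    using assms by (cases "q i x" "0::real" rule: linorder_cases)
      (auto simp: K_def Ipos_def Izero_def Ineg_def)
qed

lemma M_ge_1:
  assumes "i \<in> {1..n}" "a i = 1" "\<And>i. i \<in> {1..n} \<Longrightarrow> 0 \<le> a i"
  shows "M a \<ge> 1"
  unfolding M_def using member_le_sum[of i "{1..n}" a] assms by auto

lemma M_K_ge_1: assumes "a \<in> K x" shows "M a \<ge> 1"
proof -
  obtain i where "i \<in> pos x" using pos_nonempty by blast
  then show ?thesis using assms K_bounds[OF assms] by (intro M_ge_1[of i]) (auto simp: K_def Ipos_def)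
qed

text \<open>The minorant \<open>\<Phi> a\<close> touches F at \<open>x\<close>; with vanishing
  gradient there it is a paraboloid whose leading coefficient \<open>\<kappa> * M a\<close> is at
  least \<open>\<kappa>\<close>.\<close>

lemma stationary_growth:
  assumes "a \<in> K x" "G a x = 0"
  shows "obj z \<ge> obj x + \<kappa> * (norm (z - x))\<^sup>2"
proof -
  have "\<kappa> * (norm (z - x))\<^sup>2 * 1 \<le> \<kappa> * (norm (z - x))\<^sup>2 * M a"
    using M_K_ge_1[OF assms(1)] kappa_pos by (intro mult_left_mono) auto
  moreover have "\<Phi> a z = \<Phi> a x + \<kappa> * M a * (norm (z - x))\<^sup>2"
    using Phi_expand[of a z x] assms(2) by simp
  ultimately show ?thesis
    using obj_ge_Phi[of a z] obj_eq_Phi[OF assms(1)] K_bounds[OF assms(1)] by (simp add: mult_ac)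
qed

lemma G_split:
  assumes "\<And>i. i \<in> pos z \<Longrightarrow> a i = 1" "\<And>i. i \<in> neg z \<Longrightarrow> a i = 0"
  shows "G a z = (\<Sum>i\<in>pos z. gr i z) + (\<Sum>i\<in>zer z. a i *\<^sub>R gr i z)"
proof -
  have I: "{1..n} = (pos z \<union> zer z) \<union> neg z"
    and disj: "(pos z \<union> zer z) \<inter> neg z = {}" "pos z \<inter> zer z = {}"
    and fin: "finite (pos z)" "finite (zer z)" "finite (neg z)"
    by (auto simp: Ipos_def Izero_def Ineg_def)
  have "G a z = (\<Sum>i\<in>pos z. a i *\<^sub>R gr i z) + (\<Sum>i\<in>zer z. a i *\<^sub>R gr i z) + (\<Sum>i\<in>neg z. a i *\<^sub>R gr i z)"
    unfolding G_def I using disj fin by (simp add: sum.union_disjoint)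
  then show ?thesis using assms by simp
qed

lemma clarke_comb_eq_G:
  "clarke_comb n \<eta> p z l = G (\<lambda>i. if i \<in> pos z then 1 else if i \<in> zer z then l i else 0) z"
proof -
  have "pos z \<inter> zer z = {}" "neg z \<inter> zer z = {}" "pos z \<inter> neg z = {}"
    by (auto simp: Ipos_def Izero_def Ineg_def)
  then have "G (\<lambda>i. if i \<in> pos z then 1 else if i \<in> zer z then l i else 0) z
     = (\<Sum>i\<in>pos z. gr i z) + (\<Sum>i\<in>zer z. l i *\<^sub>R gr i z)"
    by (subst G_split) (auto intro!: sum.cong)
  then show ?thesis unfolding clarke_comb_def gradient_f_set gradient_q by simp
qed

lemma subdifferential_eq: "subdifferential n \<eta> p z = {G a z | a. a \<in> K z}"
proof -
  have disj: "pos z \<inter> zer z = {}" "neg z \<inter> zer z = {}" "pos z \<inter> neg z = {}"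
    by (auto simp: Ipos_def Izero_def Ineg_def)
  show ?thesis
  proof (intro equalityI subsetI)
    fix g assume "g \<in> subdifferential n \<eta> p z"
    then obtain l where l: "g = clarke_comb n \<eta> p z l" "\<forall>i\<in>zer z. 0 \<le> l i \<and> l i \<le> 1"
      by (auto simp: subdifferential_def)
    then have "(\<lambda>i. if i \<in> pos z then 1 else if i \<in> zer z then l i else 0) \<in> K z"
      using disj by (auto simp: K_def)
    then show "g \<in> {G a z | a. a \<in> K z}" unfolding l(1) clarke_comb_eq_G by blast
  next
    fix g assume "g \<in> {G a z | a. a \<in> K z}"
    then obtain a where a: "a \<in> K z" "g = G a z" by blast
    then have "clarke_comb n \<eta> p z a = g"
      unfolding clarke_comb_eq_G a(2) by (intro G_cong) (use trichotomy_index[of _ z] in \<open>auto simp: K_def\<close>)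
    then show "g \<in> subdifferential n \<eta> p z" using a(1)
      by (auto simp: subdifferential_def K_def)
  qed
qed

lemma subdifferential_compact: "compact (subdifferential n \<eta> p z)"
proof -
  have "subdifferential n \<eta> p z = (+) (gradient (f_set n \<eta> p (pos z)) z) `
     {\<Sum>i\<in>zer z. l i *\<^sub>R gr i z | l. \<forall>i\<in>zer z. 0 \<le> l i \<and> l i \<le> 1}"
    by (auto simp: subdifferential_def clarke_comb_def gradient_q)
  moreover have "finite (zer z)" by (simp add: Izero_def)
  ultimately show ?thesis using compact_translation[OF compact_convex_combinations] by simp
qed

lemma subdifferential_convex: "convex (subdifferential n \<eta> p z)"
  unfolding convex_def
proof (intro ballI allI impI)
  fix x y u v assume *: "x \<in> subdifferential n \<eta> p z" "y \<in> subdifferential n \<eta> p z"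
    "0 \<le> (u::real)" "0 \<le> v" "u + v = 1"
  then obtain a b where ab: "a \<in> K z" "b \<in> K z" "x = G a z" "y = G b z"
    unfolding subdifferential_eq by blast
  have "u *\<^sub>R x + v *\<^sub>R y = G (\<lambda>i. u * a i + v * b i) z"
    unfolding ab G_def by (simp add: scaleR_sum_right sum.distrib algebra_simps)
  moreover have "(\<lambda>i. u * a i + v * b i) \<in> K z"
    using ab * by (auto simp: K_def intro!: convex_bound_le add_nonneg_nonneg)
  ultimately show "u *\<^sub>R x + v *\<^sub>R y \<in> subdifferential n \<eta> p z"
    unfolding subdifferential_eq by blast
qed

lemma subdifferential_nonempty: "subdifferential n \<eta> p z \<noteq> {}"
  unfolding subdifferential_def by (auto intro!: exI[of _ "\<lambda>_. 0"])

abbreviation msub where "msub \<equiv> min_subgradient n \<eta> p"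

text \<open>The element of least norm is the projection of 0 onto a nonempty compact convex set. The
  fourth claim is the variational inequality of this projection, the source of all sign conditions
  below.\<close>

lemma min_subgradient:
  shows "msub z \<in> subdifferential n \<eta> p z"
    and "\<And>h. h \<in> subdifferential n \<eta> p z \<Longrightarrow> norm (msub z) \<le> norm h"
    and "\<And>h. h \<in> subdifferential n \<eta> p z \<Longrightarrow> norm h \<le> norm (msub z) \<Longrightarrow> h = msub z"
    and "\<And>h. h \<in> subdifferential n \<eta> p z \<Longrightarrow> msub z \<bullet> (h - msub z) \<ge> 0"
proof -
  let ?S = "subdifferential n \<eta> p z"
  have cl: "closed ?S" using subdifferential_compact compact_imp_closed by blast
  obtain g where g: "g \<in> ?S" "\<And>y. y \<in> ?S \<Longrightarrow> dist 0 g \<le> dist 0 y"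
    using distance_attains_inf[OF cl subdifferential_nonempty] by metis
  have uniq: "h = g" if "h \<in> ?S" "norm h \<le> norm g" for h
    using any_closest_point_unique[OF subdifferential_convex cl that(1) g(1), of 0] g that(2)
    by (smt (verit) dist_0_norm)
  have "msub z = g"
    unfolding min_subgradient_def
  proof (rule the_equality)
    show "is_arg_min norm (\<lambda>h. h \<in> ?S) g"
      using g by (auto simp: is_arg_min_linorder dist_norm)
    fix h assume "is_arg_min norm (\<lambda>h. h \<in> ?S) h"
    then show "h = g" using uniq g by (auto simp: is_arg_min_linorder dist_norm)
  qed
  then show "msub z \<in> ?S" "\<And>h. h \<in> ?S \<Longrightarrow> norm (msub z) \<le> norm h"
    "\<And>h. h \<in> ?S \<Longrightarrow> norm h \<le> norm (msub z) \<Longrightarrow> h = msub z"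
    using g uniq by (auto simp: dist_norm)
  show "msub z \<bullet> (h - msub z) \<ge> 0" if "h \<in> ?S" for h
    using any_closest_point_dot[OF subdifferential_convex cl g(1) that, of 0] g(2) \<open>msub z = g\<close>
    by (simp add: inner_diff_left)
qed

text \<open>Since \<open>alpha\<close> vanishes off \<open>Izero z\<close>, this is the member of
  \<open>K z\<close> that represents the minimal subgradient.\<close>

definition \<beta> :: "'a \<Rightarrow> nat \<Rightarrow> real" where
  "\<beta> z i = (if i \<in> pos z then 1 else alpha n \<eta> p z i)"

text \<open>Two members of \<open>K z\<close> differ only on \<open>zer z\<close>, where the
  gradients are independent.\<close>

lemma K_G_inj:
  assumes "a \<in> K z" "b \<in> K z" "G a z = G b z" "i \<in> {1..n}"
  shows "a i = b i"
proof -
  have "(\<Sum>i\<in>zer z. (a i - b i) *\<^sub>R gr i z) = 0"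
    using assms(3) G_split[of z a] G_split[of z b] assms(1,2)
    by (simp add: K_def scaleR_diff_left sum_subtractf)
  then have "\<And>i. i \<in> zer z \<Longrightarrow> a i - b i = 0" by (rule independent_gr)
  then show ?thesis using assms trichotomy_index[OF assms(4), of z] by (auto simp: K_def)
qed

lemma alpha_props:
  shows "i \<in> zer z \<Longrightarrow> 0 \<le> alpha n \<eta> p z i \<and> alpha n \<eta> p z i \<le> 1"
    and "i \<notin> zer z \<Longrightarrow> alpha n \<eta> p z i = 0"
    and "clarke_comb n \<eta> p z (alpha n \<eta> p z) = msub z"
proof -
  let ?P = "\<lambda>l. (\<forall>i\<in>zer z. 0 \<le> l i \<and> l i \<le> 1) \<and> (\<forall>i. i \<notin> zer z \<longrightarrow> l i = 0) \<and>
                     clarke_comb n \<eta> p z l = msub z"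
  have disj: "pos z \<inter> zer z = {}" "neg z \<inter> zer z = {}" "pos z \<inter> neg z = {}"
    by (auto simp: Ipos_def Izero_def Ineg_def)
  have ex: "\<exists>!l. ?P l"
  proof -
    obtain l where l: "\<forall>i\<in>zer z. 0 \<le> l i \<and> l i \<le> 1" "clarke_comb n \<eta> p z l = msub z"
      using min_subgradient(1)[of z] by (auto simp: subdifferential_def)
    show ?thesis
    proof (rule ex1I[of _ "\<lambda>i. if i \<in> zer z then l i else 0"])
      have "clarke_comb n \<eta> p z (\<lambda>i. if i \<in> zer z then l i else 0) = clarke_comb n \<eta> p z l"
        unfolding clarke_comb_def by (intro arg_cong2[where f="(+)"] sum.cong) auto
      then show "?P (\<lambda>i. if i \<in> zer z then l i else 0)" using l by auto
    next
      fix l' assume l': "?P l'"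
      \<comment> \<open>Filling in the values on \<open>pos z\<close> and \<open>neg z\<close> puts
        both candidates into \<open>K z\<close>, so that \<open>K_G_inj\<close> gives
        uniqueness.\<close>
      let ?e = "\<lambda>l i. if i \<in> pos z then 1 else if i \<in> zer z then l i else 0 :: real"
      have "?e l' i = ?e l i" if "i \<in> {1..n}" for i
      proof (rule K_G_inj[OF _ _ _ that])
        show "?e l' \<in> K z" "?e l \<in> K z" using l' l disj by (auto simp: K_def)
        show "G (?e l') z = G (?e l) z" using l' l by (simp flip: clarke_comb_eq_G)
      qed
      note e = this
      have "l' i = l i" if "i \<in> zer z" for i
      proof -
        have "i \<in> {1..n}" "i \<notin> pos z" using that by (auto simp: Izero_def Ipos_def)
        then show ?thesis using e[of i] that by simp
      qed
      then show "l' = (\<lambda>i. if i \<in> zer z then l i else 0)" using l' by auto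
    qed
  qed
  have "?P (alpha n \<eta> p z)" unfolding alpha_def by (rule theI'[OF ex])
  then show "i \<in> zer z \<Longrightarrow> 0 \<le> alpha n \<eta> p z i \<and> alpha n \<eta> p z i \<le> 1"
    "i \<notin> zer z \<Longrightarrow> alpha n \<eta> p z i = 0"
    "clarke_comb n \<eta> p z (alpha n \<eta> p z) = msub z" by auto
qed

lemma beta_in_K: "\<beta> z \<in> K z"
  using alpha_props[where z=z] by (auto simp: K_def \<beta>_def Ipos_def Izero_def Ineg_def)

lemma G_beta: "G (\<beta> z) z = msub z"
  unfolding alpha_props(3)[symmetric] clarke_comb_eq_G
  by (intro G_cong) (auto simp: \<beta>_def alpha_props(2))

lemma beta_minimal:
  assumes "b \<in> K z"
  shows "norm (G (\<beta> z) z) \<le> norm (G b z)"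
    and "norm (G b z) \<le> norm (G (\<beta> z) z) \<Longrightarrow> i \<in> {1..n} \<Longrightarrow> b i = \<beta> z i"
    and "G (\<beta> z) z \<bullet> (G b z - G (\<beta> z) z) \<ge> 0"
proof -
  have *: "G b z \<in> subdifferential n \<eta> p z" unfolding subdifferential_eq using assms by blast
  show "norm (G (\<beta> z) z) \<le> norm (G b z)" "G (\<beta> z) z \<bullet> (G b z - G (\<beta> z) z) \<ge> 0"
    unfolding G_beta using min_subgradient[where z=z] * by auto
  assume "norm (G b z) \<le> norm (G (\<beta> z) z)" "i \<in> {1..n}"
  then have "G b z = G (\<beta> z) z" unfolding G_beta using min_subgradient[where z=z] * by auto
  then show "b i = \<beta> z i" using K_G_inj[OF assms beta_in_K] \<open>i \<in> {1..n}\<close> by blast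
qed

text \<open>The variational inequality, tested by moving the single coefficient \<open>i\<close> to
  \<open>s\<close>. With \<open>s = 1\<close> and \<open>s = 0\<close> it gives complementary
  slackness; if the coefficient is strictly between, both signs hold and the inner product is
  zero.\<close>

lemma beta_KKT:
  assumes "i \<in> zer z" "0 \<le> s" "s \<le> 1"
  shows "(s - \<beta> z i) * (G (\<beta> z) z \<bullet> gr i z) \<ge> 0"
proof -
  have i: "i \<in> {1..n}" using assms(1) by (simp add: Izero_def)
  let ?b = "\<lambda>j. \<beta> z j + (s - \<beta> z i) * unit i j"
  have "?b \<in> K z" using beta_in_K[of z] assms by (auto simp: K_def Ipos_def Izero_def Ineg_def)
  moreover have "G ?b z = G (\<beta> z) z + (s - \<beta> z i) *\<^sub>R gr i z"
    unfolding G_add using unit_simps(1)[OF i] by simp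
  ultimately show ?thesis using beta_minimal(3)[of ?b z] by simp
qed

lemma beta_KKT_cases:
  assumes "i \<in> zer z"
  shows "\<beta> z i < 1 \<Longrightarrow> G (\<beta> z) z \<bullet> gr i z \<ge> 0" "\<beta> z i > 0 \<Longrightarrow> G (\<beta> z) z \<bullet> gr i z \<le> 0"
  using beta_KKT[OF assms, of 1] beta_KKT[OF assms, of 0]
  by (simp_all add: zero_le_mult_iff mult_le_0_iff)

end

section \<open>Signs of polynomials to the right of 0\<close>

lemma poly_sign_at_right_0:
  fixes r :: "real poly"
  obtains e where "e > 0" "r = 0 \<or> (\<forall>t\<in>{0<..<e}. poly r t > 0) \<or> (\<forall>t\<in>{0<..<e}. poly r t < 0)"
proof (cases "r = 0")
  case True
  then show ?thesis using that[of 1] by simp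
next
  case False
  then have "finite {x. poly r x = 0}" by (rule poly_roots_finite)
  then obtain e where e: "e > 0" "\<And>x. poly r x = 0 \<Longrightarrow> x \<noteq> 0 \<Longrightarrow> e \<le> dist 0 x"
    using finite_set_avoid[of "{x. poly r x = 0}" 0] by auto
  have nz: "poly r x \<noteq> 0" if "0 < x" "x < e" for x using e(2)[of x] that by auto
  have "\<not> (poly r s > 0 \<and> poly r t < 0)" if "s \<in> {0<..<e}" "t \<in> {0<..<e}" for s t
  proof
    assume *: "poly r s > 0 \<and> poly r t < 0"
    then have "s \<noteq> t" by auto
    then consider "s < t" | "t < s" by linarith
    then show False
    proof cases
      case 1
      then show False using poly_IVT_neg[of s t r] * nz that by fastforce
    next
      case 2
      then show False using poly_IVT_pos[of t s r] * nz that by fastforce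
    qed
  qed
  then have "(\<forall>t\<in>{0<..<e}. poly r t > 0) \<or> (\<forall>t\<in>{0<..<e}. poly r t < 0)"
    using nz by (metis greaterThanLessThan_iff linorder_neqE_linordered_idom)
  then show ?thesis using that e(1) by blast
qed

text \<open>A predicate on functions, so that the closure rules apply directly to the unfolded
  formulas for \<open>coef\<close>, \<open>slope\<close> and \<open>energy\<close>.\<close>

definition polyfun :: "(real \<Rightarrow> real) \<Rightarrow> bool" where
  "polyfun g \<longleftrightarrow> (\<exists>r. g = poly r)"

lemma polyfun_intros:
  "polyfun (\<lambda>t. c)" "polyfun (\<lambda>t. t)"
  "polyfun g \<Longrightarrow> polyfun h \<Longrightarrow> polyfun (\<lambda>t. g t + h t)"
  "polyfun g \<Longrightarrow> polyfun h \<Longrightarrow> polyfun (\<lambda>t. g t - h t)"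
  "polyfun g \<Longrightarrow> polyfun h \<Longrightarrow> polyfun (\<lambda>t. g t * h t)"
proof -
  show "polyfun (\<lambda>t. c)" unfolding polyfun_def by (rule exI[of _ "[:c:]"]) auto
  show "polyfun (\<lambda>t. t)" unfolding polyfun_def by (rule exI[of _ "[:0, 1:]"]) auto
  assume "polyfun g" "polyfun h"
  then obtain r s where "g = poly r" "h = poly s" by (auto simp: polyfun_def)
  then have "(\<lambda>t. g t + h t) = poly (r + s)" "(\<lambda>t. g t - h t) = poly (r - s)"
    "(\<lambda>t. g t * h t) = poly (r * s)" by (simp_all add: fun_eq_iff)
  then show "polyfun (\<lambda>t. g t + h t)" "polyfun (\<lambda>t. g t - h t)" "polyfun (\<lambda>t. g t * h t)"
    unfolding polyfun_def by blast+
qed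

text \<open>The first alternative is vanishing everywhere, not only on the interval; the
  differential equation along a path relies on this.\<close>

lemma polyfun_common_sign:
  assumes "finite S" "\<And>g. g \<in> S \<Longrightarrow> polyfun g"
  shows "\<exists>e>0. \<forall>g\<in>S. (\<forall>t. g t = 0) \<or> (\<forall>t\<in>{0<..<e}. g t > 0) \<or> (\<forall>t\<in>{0<..<e}. g t < 0)"
  using assms
proof (induction S)
  case empty
  then show ?case by (auto intro: exI[of _ 1])
next
  case (insert g S)
  obtain e where e: "e > 0" "\<And>g. g \<in> S \<Longrightarrow>
      (\<forall>t. g t = 0) \<or> (\<forall>t\<in>{0<..<e}. g t > 0) \<or> (\<forall>t\<in>{0<..<e}. g t < 0)"
    using insert.IH insert.prems by auto
  obtain r where r: "g = poly r" using insert.prems by (auto simp: polyfun_def)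
  obtain d where d: "d > 0" "(\<forall>t. g t = 0) \<or> (\<forall>t\<in>{0<..<d}. g t > 0) \<or> (\<forall>t\<in>{0<..<d}. g t < 0)"
    using poly_sign_at_right_0[of r] r by (metis poly_0)
  have "(\<forall>t. h t = 0) \<or> (\<forall>t\<in>{0<..<min d e}. h t > 0) \<or> (\<forall>t\<in>{0<..<min d e}. h t < 0)"
    if "h \<in> insert g S" for h
    using that d(2) e(2)[of h] by auto
  then show ?case using d(1) e(1) by (intro exI[of _ "min d e"]) auto
qed

section \<open>Stationarity and growth at the minimizer\<close>

locale spherical_clusters_min = spherical_clusters +
  fixes xs :: 'a
  assumes xs_min: "\<forall>z. obj xs \<le> obj z"
begin

text \<open>Otherwise a short step along the negative minimal subgradient \<open>v\<close> lowers F: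
  by the variational inequality the first-order change is at most
  \<open>- t * (v \<bullet> v)\<close>, and the curvature contributes at most
  \<open>n * s\<close>.\<close>

lemma xs_stationary: "G (\<beta> xs) xs = 0"
proof (rule ccontr)
  assume v0: "G (\<beta> xs) xs \<noteq> 0"
  define v where "v = G (\<beta> xs) xs"
  \<comment> \<open>These weights select the functions vanishing at \<open>xs\<close> that increase
    along \<open>- v\<close>; they give the subgradient realising the directional derivative of F in
    that direction.\<close>
  define a where "a i = (if i \<in> pos xs then 1 else if i \<in> zer xs \<and> gr i xs \<bullet> v < 0 then 1 else 0 :: real)" for i
  have a: "a \<in> K xs" by (auto simp: K_def a_def Ipos_def Izero_def Ineg_def)
  have le: "v \<bullet> v \<le> v \<bullet> G a xs"
    using beta_minimal(3)[OF a] by (simp add: v_def inner_diff_right)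
  have n: "real n * \<kappa> > 0" using n_ge_2 kappa_pos by simp
  have lim: "((\<lambda>t. q i (xs - t *\<^sub>R v)) \<longlongrightarrow> q i xs) (at_right 0)" for i
  proof -
    have "((\<lambda>t. xs - t *\<^sub>R v) \<longlongrightarrow> xs - 0 *\<^sub>R v) (at_right 0)"
      by (intro tendsto_intros)
    then have l: "((\<lambda>t. xs - t *\<^sub>R v) \<longlongrightarrow> xs) (at_right 0)" by simp
    have "isCont (q i) xs"
      using continuous_q by (simp add: continuous_on_eq_continuous_at)
    then show ?thesis using l by (rule isCont_tendsto_compose)
  qed
  have "\<forall>\<^sub>F t in at_right 0. \<forall>i\<in>neg xs. q i (xs - t *\<^sub>R v) < 0"
    using order_tendstoD(2)[OF lim, of _ 0]
    by (intro eventually_ball_finite) (auto simp: Ineg_def)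
  moreover have "\<forall>\<^sub>F t in at_right 0. \<forall>i\<in>pos xs. q i (xs - t *\<^sub>R v) > 0"
    using order_tendstoD(1)[OF lim, of 0]
    by (intro eventually_ball_finite) (auto simp: Ipos_def)
  \<comment> \<open>This bound makes \<open>n * s\<close>, which is
    \<open>real n * \<kappa> * t\<close> times \<open>t * (v \<bullet> v)\<close>, smaller than the
    first-order gain.\<close>
  moreover have "\<forall>\<^sub>F t in at_right 0. t < 1 / (real n * \<kappa>)"
    using n by (intro eventually_at_right_less[THEN eventually_mono] order_tendstoD(2)[OF tendsto_ident_at]) auto
  ultimately have "\<forall>\<^sub>F t in at_right 0. 0 < t \<and> t < 1 / (real n * \<kappa>) \<and> (\<forall>i\<in>pos xs. q i (xs - t *\<^sub>R v) > 0)
      \<and> (\<forall>i\<in>neg xs. q i (xs - t *\<^sub>R v) < 0)"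
    using eventually_at_right_less[of 0] by eventually_elim auto
  then obtain t where t: "0 < t" "t < 1 / (real n * \<kappa>)" "\<forall>i\<in>pos xs. q i (xs - t *\<^sub>R v) > 0"
    "\<forall>i\<in>neg xs. q i (xs - t *\<^sub>R v) < 0"
    using eventually_happens'[of "at_right (0::real)"] by (metis (no_types, lifting) trivial_limit_at_right_real)
  define s where "s = \<kappa> * t\<^sup>2 * (v \<bullet> v)"
  have s: "s \<ge> 0" using kappa_pos by (simp add: s_def)
  have q: "q i (xs - t *\<^sub>R v) = q i xs - t * (gr i xs \<bullet> v) + s" for i
    using q_expand[of i "xs - t *\<^sub>R v" xs, unfolded power2_norm_eq_inner]
    by (simp add: s_def power2_eq_square mult.assoc)
  have "max 0 (q i (xs - t *\<^sub>R v)) \<le> a i * q i xs - t * ((a i *\<^sub>R gr i xs) \<bullet> v) + s"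
    if i: "i \<in> {1..n}" for i
  proof -
    consider "i \<in> pos xs" | "i \<in> zer xs" "gr i xs \<bullet> v < 0" | "i \<in> zer xs" "gr i xs \<bullet> v \<ge> 0" | "i \<in> neg xs"
      using trichotomy_index[OF i, of xs] by linarith
    then show ?thesis
    proof cases
      case 1
      then show ?thesis using t(3) q[of i] by (auto simp: a_def)
    next
      case 2
      then have "t * (gr i xs \<bullet> v) \<le> 0" using t(1) by (simp add: mult_le_0_iff)
      then show ?thesis using 2 s q[of i] by (auto simp: a_def Ipos_def Izero_def)
    next
      case 3
      then have "t * (gr i xs \<bullet> v) \<ge> 0" using t(1) by simp
      then show ?thesis using 3 s q[of i] by (auto simp: a_def Ipos_def Izero_def)
    next
      case 4
      then have "a i = 0" by (auto simp: a_def Ipos_def Izero_def Ineg_def)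
      then show ?thesis using 4 s t(4) by auto
    qed
  qed
  then have "obj (xs - t *\<^sub>R v) \<le> (\<Sum>i\<in>{1..n}. a i * q i xs - t * ((a i *\<^sub>R gr i xs) \<bullet> v) + s)"
    unfolding F_def by (intro sum_mono) auto
  also have "\<dots> = \<Phi> a xs - t * (G a xs \<bullet> v) + n * s"
    by (simp add: \<Phi>_def G_def sum.distrib sum_subtractf inner_sum_left sum_distrib_left)
  also have "\<dots> \<le> obj xs - t * (v \<bullet> v) + n * s"
    using le t(1) obj_eq_Phi[OF a] by (simp add: inner_commute)
  also have "\<dots> < obj xs"
  proof -
    have "n * s = (real n * \<kappa> * t) * (t * (v \<bullet> v))" by (simp add: s_def power2_eq_square)
    moreover have "real n * \<kappa> * t < 1" using t n by (simp add: field_simps)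
    moreover have "t * (v \<bullet> v) > 0" using t(1) v0 by (simp add: v_def)
    ultimately have "n * s < 1 * (t * (v \<bullet> v))" by (metis mult_less_cancel_right_pos)
    then show ?thesis by simp
  qed
  finally show False using xs_min by (simp add: not_le[symmetric])
qed

lemma obj_growth: "obj z \<ge> obj xs + \<kappa> * (norm (z - xs))\<^sup>2"
  by (rule stationary_growth[OF beta_in_K xs_stationary])

lemma obj_gt: "z \<noteq> xs \<Longrightarrow> obj z > obj xs"
proof -
  assume "z \<noteq> xs"
  then have "\<kappa> * (norm (z - xs))\<^sup>2 > 0" using kappa_pos by simp
  then show ?thesis using obj_growth[of z] by linarith
qed

lemma stationary_eq_xs:
  assumes "a \<in> K x" "G a x = 0" shows "x = xs"
  using stationary_growth[OF assms, of xs] obj_gt[of x] kappa_pos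
  by (smt (verit) mult_nonneg_nonneg zero_le_power2)

text \<open>A sublevel set instead of a ball, because F does not increase along the steps. By
  quadratic growth the level \<open>\<kappa> * r\<^sup>2\<close> above the minimum keeps it inside
  the ball of radius \<open>r\<close>.\<close>

lemma nearby_signs:
  obtains \<delta> where "\<delta> > 0" "\<And>x. obj x < obj xs + \<delta> \<Longrightarrow> pos xs \<subseteq> pos x \<and> neg xs \<subseteq> neg x"
proof -
  have cont: "(q i \<longlongrightarrow> q i xs) (nhds xs)" for i
    using continuous_q by (simp add: continuous_on_eq_continuous_at isCont_def tendsto_nhds_iff flip: filterlim_at_within_not_equal)
  have "\<forall>\<^sub>F x in nhds xs. \<forall>i\<in>pos xs. q i x > 0"
    using order_tendstoD(1)[OF cont, of 0] by (intro eventually_ball_finite) (auto simp: Ipos_def)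
  moreover have "\<forall>\<^sub>F x in nhds xs. \<forall>i\<in>neg xs. q i x < 0"
    using order_tendstoD(2)[OF cont, of _ 0] by (intro eventually_ball_finite) (auto simp: Ineg_def)
  ultimately have "\<forall>\<^sub>F x in nhds xs. pos xs \<subseteq> pos x \<and> neg xs \<subseteq> neg x"
    by eventually_elim (auto simp: Ipos_def Ineg_def)
  then obtain r where r: "r > 0" "\<And>x. dist x xs < r \<Longrightarrow> pos xs \<subseteq> pos x \<and> neg xs \<subseteq> neg x"
    unfolding eventually_nhds_metric by blast
  show ?thesis
  proof (rule that[of "\<kappa> * r\<^sup>2"])
    show "\<kappa> * r\<^sup>2 > 0" using r kappa_pos by simp
    fix x assume "obj x < obj xs + \<kappa> * r\<^sup>2"
    then have "\<kappa> * (norm (x - xs))\<^sup>2 < \<kappa> * r\<^sup>2" using obj_growth[of x] by linarith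
    then have "(norm (x - xs))\<^sup>2 < r\<^sup>2" using kappa_pos by simp
    then have "norm (x - xs) < r" using r(1) power2_less_imp_less by fastforce
    then show "pos xs \<subseteq> pos x \<and> neg xs \<subseteq> neg x" using r(2) by (simp add: dist_norm)
  qed
qed

subsection \<open>Strata around the minimizer\<close>

text \<open>The pairs that \<open>Ipos_star\<close> and \<open>Izero_star\<close> can form near the
  minimizer. Each index of \<open>zer xs\<close> lies in \<open>P\<close>, in \<open>Z\<close> or in
  neither, hence the base 3.\<close>

definition stratum :: "nat set \<Rightarrow> nat set \<Rightarrow> bool" where
  "stratum P Z \<longleftrightarrow> pos xs \<subseteq> P \<and> P \<subseteq> pos xs \<union> zer xs \<and> Z \<subseteq> zer xs \<and> P \<inter> Z = {}"

text \<open>Orthogonality to \<open>gr i\<close> at a point of \<open>Sph_set Z\<close>, transported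
  to \<open>xs\<close>: by \<open>G_gr_transport\<close> the move adds \<open>2 * \<kappa>\<close>
  times the difference of values, which is \<tau>, while the term with \<open>q i\<close> vanishes
  at both points.\<close>

definition affine_solution :: "nat set \<Rightarrow> nat set \<Rightarrow> (nat \<Rightarrow> real) \<Rightarrow> (nat \<Rightarrow> real) \<Rightarrow> bool" where
  "affine_solution P Z A C \<longleftrightarrow>
     (\<forall>i\<in>P. A i = 1 \<and> C i = 0) \<and> (\<forall>i. i \<notin> P \<union> Z \<longrightarrow> A i = 0 \<and> C i = 0) \<and>
     (\<forall>\<tau>. \<forall>i\<in>Z. G (\<lambda>i. A i + \<tau> * C i) xs \<bullet> gr i xs + \<tau> = 0)"

lemma gr_dual:
  assumes "Z \<subseteq> zer xs"
  obtains c where "\<And>i. i \<notin> Z \<Longrightarrow> c i = 0" "\<And>i. i \<in> Z \<Longrightarrow> G c xs \<bullet> gr i xs = b i"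
proof -
  have ind: "lin_independent_family (\<lambda>i. xs - ctr i) Z"
    using generic assms unfolding generic_position_def lin_independent_family_def
    by (meson image_mono inj_on_subset independent_mono)
  have Zn: "Z \<subseteq> {1..n}" using assms by (auto simp: Izero_def)
  then have fin: "finite Z" by (rule finite_subset) simp
  \<comment> \<open>The divisor \<open>(2 * \<kappa>)\<^sup>2\<close> accounts for replacing both
    gradients by the vectors \<open>xs - ctr i\<close>.\<close>
  obtain c where c: "\<And>i. i \<notin> Z \<Longrightarrow> c i = 0"
    "\<And>i. i \<in> Z \<Longrightarrow> (\<Sum>l\<in>Z. c l *\<^sub>R (xs - ctr l)) \<bullet> (xs - ctr i) = b i / (2 * \<kappa>)\<^sup>2"
    using lin_independent_family_dual[OF ind fin, of "\<lambda>i. b i / (2 * \<kappa>)\<^sup>2"] by metis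
  have "G c xs \<bullet> gr i xs = b i" if "i \<in> Z" for i
  proof -
    have "G c xs = (\<Sum>l\<in>Z. c l *\<^sub>R gr l xs)"
      unfolding G_def using Zn c(1) by (intro sum.mono_neutral_right) auto
    also have "\<dots> = (2 * \<kappa>) *\<^sub>R (\<Sum>l\<in>Z. c l *\<^sub>R (xs - ctr l))"
      by (simp add: gr_def scaleR_sum_right mult.commute)
    finally have "G c xs \<bullet> gr i xs = (2 * \<kappa>) * ((2 * \<kappa>) * (b i / (2 * \<kappa>)\<^sup>2))"
      using c(2)[OF that] by (simp add: gr_def)
    then show ?thesis using kappa_pos by (simp add: power2_eq_square)
  qed
  then show ?thesis using that c(1) by blast
qed

text \<open>The linear system is solved separately for the constant part of its right-hand side and
  for the part proportional to \<tau>.\<close>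

lemma affine_solution_exists:
  assumes "stratum P Z" shows "\<exists>A C. affine_solution P Z A C"
proof -
  have Z: "Z \<subseteq> zer xs" "P \<inter> Z = {}" using assms by (auto simp: stratum_def)
  define s where "s i = (if i \<in> P then 1 else 0 :: real)" for i
  obtain u where u: "\<And>i. i \<notin> Z \<Longrightarrow> u i = 0" "\<And>i. i \<in> Z \<Longrightarrow> G u xs \<bullet> gr i xs = - (G s xs \<bullet> gr i xs)"
    using gr_dual[OF Z(1), of "\<lambda>i. - (G s xs \<bullet> gr i xs)"] by metis
  obtain c where c: "\<And>i. i \<notin> Z \<Longrightarrow> c i = 0" "\<And>i. i \<in> Z \<Longrightarrow> G c xs \<bullet> gr i xs = -1"
    using gr_dual[OF Z(1), of "\<lambda>i. -1"] by metis
  \<comment> \<open>The factor 1 gives the sum the shape required by \<open>G_add\<close>.\<close>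
  have "affine_solution P Z (\<lambda>i. s i + 1 * u i) c"
    unfolding affine_solution_def G_add
  proof (intro conjI ballI allI impI)
    fix i assume "i \<in> P"
    then have "i \<notin> Z" using Z(2) by blast
    then show "s i + 1 * u i = 1" "c i = 0" using u(1) c(1) \<open>i \<in> P\<close> by (auto simp: s_def)
  next
    fix i assume "i \<notin> P \<union> Z"
    then show "s i + 1 * u i = 0" "c i = 0" using u(1) c(1) by (auto simp: s_def)
  next
    fix \<tau> i assume "i \<in> Z"
    then show "(G s xs + 1 *\<^sub>R G u xs + \<tau> *\<^sub>R G c xs) \<bullet> gr i xs + \<tau> = 0"
      using u(2) c(2) by (simp add: inner_add_left)
  qed
  then show ?thesis by blast
qed

text \<open>The coefficients of the orthogonal projection of the gradient of \<open>f_set P\<close> onto the tangent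
  space of \<open>Sph_set Z\<close>, as a function of \<open>\<tau> = 2 * \<kappa> * (obj x - obj xs)\<close> alone.\<close>

definition coefA :: "nat set \<Rightarrow> nat set \<Rightarrow> nat \<Rightarrow> real" where
  "coefA P Z = (SOME A. \<exists>C. affine_solution P Z A C)"
definition coefC :: "nat set \<Rightarrow> nat set \<Rightarrow> nat \<Rightarrow> real" where
  "coefC P Z = (SOME C. affine_solution P Z (coefA P Z) C)"
definition coef :: "nat set \<Rightarrow> nat set \<Rightarrow> real \<Rightarrow> nat \<Rightarrow> real" where
  "coef P Z \<tau> = (\<lambda>i. coefA P Z i + \<tau> * coefC P Z i)"

lemma coef_props:
  assumes "stratum P Z"
  shows "i \<in> P \<Longrightarrow> coef P Z \<tau> i = 1"
    and "i \<notin> P \<Longrightarrow> i \<notin> Z \<Longrightarrow> coef P Z \<tau> i = 0"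
    and "i \<in> Z \<Longrightarrow> G (coef P Z \<tau>) xs \<bullet> gr i xs + \<tau> = 0"
proof -
  have "\<exists>C. affine_solution P Z (coefA P Z) C"
    unfolding coefA_def using affine_solution_exists[OF assms] by (rule someI_ex)
  then have "affine_solution P Z (coefA P Z) (coefC P Z)"
    unfolding coefC_def by (rule someI_ex)
  then show "i \<in> P \<Longrightarrow> coef P Z \<tau> i = 1" "i \<notin> P \<Longrightarrow> i \<notin> Z \<Longrightarrow> coef P Z \<tau> i = 0"
     "i \<in> Z \<Longrightarrow> G (coef P Z \<tau>) xs \<bullet> gr i xs + \<tau> = 0"
    by (auto simp: affine_solution_def coef_def)
qed

text \<open>Here and in \<open>energy\<close> the added term in \<tau> is the correction for
  evaluating the gradients at \<open>xs\<close> instead of the current point.\<close>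

definition slope :: "nat set \<Rightarrow> nat set \<Rightarrow> nat \<Rightarrow> real \<Rightarrow> real" where
  "slope P Z j \<tau> = G (coef P Z \<tau>) xs \<bullet> gr j xs + \<tau>"
definition energy :: "nat set \<Rightarrow> nat set \<Rightarrow> real \<Rightarrow> real" where
  "energy P Z \<tau> = G (coef P Z \<tau>) xs \<bullet> G (coef P Z \<tau>) xs + 2 * \<tau> * M (coef P Z \<tau>)"
text \<open>Based on \<open>f_set P\<close> rather than F, so that it is smooth everywhere along a
  path; on the closure of the cell, \<open>f_set_eq_obj\<close> makes it equal to
  \<open>2 * \<kappa>\<close> times the excess of F.\<close>

definition excess :: "nat set \<Rightarrow> 'a \<Rightarrow> real" where
  "excess P z = 2 * \<kappa> * (f_set n \<eta> p P z - obj xs)"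

lemma polyfun_coef: "polyfun (\<lambda>\<tau>. coef P Z \<tau> i)"
  unfolding coef_def by (intro polyfun_intros)

lemma polyfun_slope: "polyfun (slope P Z j)"
  unfolding slope_def[abs_def] coef_def G_add inner_add_left inner_scaleR_left by (intro polyfun_intros)

lemma polyfun_energy: "polyfun (energy P Z)"
  unfolding energy_def[abs_def] coef_def G_add M_add inner_add_left inner_add_right inner_scaleR_left inner_scaleR_right
  by (intro polyfun_intros)

lemma stratum_index: "stratum P Z \<Longrightarrow> P \<subseteq> {1..n} \<and> Z \<subseteq> {1..n}"
  by (fastforce simp: stratum_def Ipos_def Izero_def)

lemma Phi_coef:
  assumes "stratum P Z" "\<And>i. i \<in> Z \<Longrightarrow> q i z = 0"
  shows "\<Phi> (coef P Z \<tau>) z = f_set n \<eta> p P z"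
proof -
  have P: "P \<subseteq> {1..n}" using stratum_index[OF assms(1)] by simp
  have "\<Phi> (coef P Z \<tau>) z = (\<Sum>i\<in>P. coef P Z \<tau> i * q i z)"
    unfolding \<Phi>_def using P coef_props(2)[OF assms(1)] assms(2) by (intro sum.mono_neutral_right) auto
  then show ?thesis unfolding f_set_def using coef_props(1)[OF assms(1)] by simp
qed

text \<open>At \<open>xs\<close> the strata differ only in weights of functions that vanish
  there.\<close>

lemma Phi_coef_xs:
  assumes "stratum P Z" shows "\<Phi> (coef P Z \<tau>) xs = obj xs"
proof -
  have "\<Phi> (coef P Z \<tau>) xs = \<Phi> (\<beta> xs) xs"
  proof (rule Phi_cong)
    fix i assume i: "i \<in> {1..n}"
    show "coef P Z \<tau> i * q i xs = \<beta> xs i * q i xs"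
    proof (cases "i \<in> zer xs")
      case True then show ?thesis by (simp add: Izero_def)
    next
      case False
      then consider "i \<in> pos xs" | "i \<in> neg xs" using trichotomy_index[OF i] by blast
      then show ?thesis
      proof cases
        case 1
        then have "i \<in> P" using assms by (auto simp: stratum_def)
        then show ?thesis using 1 coef_props(1)[OF assms] beta_in_K[of xs] by (simp add: K_def)
      next
        case 2
        then have "i \<notin> P" "i \<notin> Z" using assms by (auto simp: stratum_def Ipos_def Izero_def Ineg_def)
        then show ?thesis using 2 coef_props(2)[OF assms] beta_in_K[of xs] by (simp add: K_def)
      qed
    qed
  qed
  then show ?thesis using obj_eq_Phi[OF beta_in_K] by simp
qed

text \<open>If \<open>slope P Z j\<close> is identically zero, only the last term remains: the
  derivative of \<open>q j\<close> along the field is then proportional to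
  \<open>q j\<close>.\<close>

lemma coef_inner_gr:
  assumes "stratum P Z" "\<And>i. i \<in> Z \<Longrightarrow> q i z = 0" "j \<in> zer xs"
  shows "G (coef P Z (excess P z)) z \<bullet> gr j z
    = slope P Z j (excess P z) + 2 * \<kappa> * M (coef P Z (excess P z)) * q j z"
proof -
  have j: "j \<in> {1..n}" "q j xs = 0" using assms(3) by (auto simp: Izero_def)
  show ?thesis
    using G_gr_transport[OF j(1), of "coef P Z (excess P z)" z xs] j(2)
    by (simp add: Phi_coef[OF assms(1,2)] Phi_coef_xs[OF assms(1)] slope_def excess_def)
qed

lemma coef_orthogonal:
  assumes "stratum P Z" "\<And>i. i \<in> Z \<Longrightarrow> q i z = 0" "j \<in> Z"
  shows "G (coef P Z (excess P z)) z \<bullet> gr j z = 0"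
  using coef_inner_gr[OF assms(1,2), of j] assms coef_props(3)[OF assms(1,3)]
  by (auto simp: stratum_def slope_def)

lemma coef_energy:
  assumes "stratum P Z" "\<And>i. i \<in> Z \<Longrightarrow> q i z = 0"
  shows "(norm (G (coef P Z (excess P z)) z))\<^sup>2 = energy P Z (excess P z)"
  using G_inner_transport[of "coef P Z (excess P z)" z "coef P Z (excess P z)" xs]
  by (simp add: power2_norm_eq_inner Phi_coef[OF assms] Phi_coef_xs[OF assms(1)] energy_def excess_def
      algebra_simps)

text \<open>The difference of the two gradients is a combination of the gradients with index in
  \<open>Z\<close> and orthogonal to each of them, so it is zero; transversality at \<open>z\<close>
  then equates the coefficients.\<close>

lemma coef_unique:
  assumes "stratum P Z" "\<And>i. i \<in> Z \<Longrightarrow> q i z = 0"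
    and "\<And>i. i \<in> P \<Longrightarrow> b i = 1" "\<And>i. i \<in> {1..n} \<Longrightarrow> i \<notin> P \<Longrightarrow> i \<notin> Z \<Longrightarrow> b i = 0"
    and "\<And>i. i \<in> Z \<Longrightarrow> G b z \<bullet> gr i z = 0" "i \<in> {1..n}"
  shows "b i = coef P Z (excess P z) i"
proof -
  define a where "a = coef P Z (excess P z)"
  have Z: "Z \<subseteq> {1..n}" using stratum_index[OF assms(1)] by simp
  have ab: "b i = a i" if "i \<in> {1..n}" "i \<notin> Z" for i
    using coef_props[OF assms(1)] assms(3,4) that by (cases "i \<in> P") (auto simp: a_def)
  have "G b z - G a z = (\<Sum>i\<in>{1..n}. (b i - a i) *\<^sub>R gr i z)"
    by (simp add: G_def sum_subtractf scaleR_diff_left)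
  also have "\<dots> = (\<Sum>i\<in>Z. (b i - a i) *\<^sub>R gr i z)"
    using Z ab by (intro sum.mono_neutral_right) auto
  finally have w: "G b z - G a z = (\<Sum>i\<in>Z. (b i - a i) *\<^sub>R gr i z)" .
  have "(G b z - G a z) \<bullet> (G b z - G a z) = (\<Sum>i\<in>Z. (b i - a i) * ((G b z - G a z) \<bullet> gr i z))"
    by (subst (2) w) (simp add: inner_sum_right)
  also have "\<dots> = 0"
    using assms(5) coef_orthogonal[OF assms(1,2)] by (intro sum.neutral) (auto simp: a_def inner_diff_left)
  finally have "(\<Sum>i\<in>Z. (b i - a i) *\<^sub>R gr i z) = 0" using w by simp
  moreover have "Z \<subseteq> zer z" "finite (zer z)" using Z assms(2) by (auto simp: Izero_def)
  ultimately have "(\<Sum>i\<in>zer z. (if i \<in> Z then b i - a i else 0) *\<^sub>R gr i z) = 0"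
    by (subst sum.mono_neutral_right[of "zer z" Z]) (auto cong: sum.cong)
  then have "\<And>i. i \<in> zer z \<Longrightarrow> (if i \<in> Z then b i - a i else 0) = 0" by (rule independent_gr)
  then have "b i = a i" if "i \<in> Z" for i using that \<open>Z \<subseteq> zer z\<close> by fastforce
  then show ?thesis using ab assms(6) unfolding a_def by blast
qed

text \<open>The inequalities are weak so that the lemma also covers points on the boundary of the
  cell, where a path leaves it.\<close>

lemma f_set_eq_obj:
  assumes "stratum P Z" "\<And>i. i \<in> {1..n} \<Longrightarrow> i \<in> P \<Longrightarrow> q i z \<ge> 0"
    "\<And>i. i \<in> {1..n} \<Longrightarrow> i \<notin> P \<Longrightarrow> q i z \<le> 0"
  shows "f_set n \<eta> p P z = obj z"
proof -
  have "obj z = (\<Sum>i\<in>{1..n}. if i \<in> P then q i z else 0)"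
    unfolding F_def using assms(2,3) by (intro sum.cong) (auto simp: max_def intro: antisym)
  then show ?thesis using stratum_index[OF assms(1)] unfolding f_set_def
    by (simp add: sum.If_cases Int_absorb1)
qed

definition near :: "'a \<Rightarrow> bool" where "near x \<longleftrightarrow> pos xs \<subseteq> pos x \<and> neg xs \<subseteq> neg x"

abbreviation Pst where "Pst \<equiv> Ipos_star n \<eta> p"
abbreviation Zst where "Zst \<equiv> Izero_star n \<eta> p"
abbreviation Nst where "Nst \<equiv> Ineg_star n \<eta> p"

lemma star_eq_beta:
  shows "Pst x = {i\<in>{1..n}. \<beta> x i = 1}" "Zst x = {i\<in>{1..n}. 0 < \<beta> x i \<and> \<beta> x i < 1}"
    "Nst x = {i\<in>{1..n}. \<beta> x i = 0}"
  using alpha_props[where z=x]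
  by (force simp: Ipos_star_def Izero_star_def Ineg_star_def \<beta>_def Ipos_def Izero_def Ineg_def)+

lemma Zst_subset: "Zst x \<subseteq> zer x"
  by (auto simp: Izero_star_def)

lemma stratum_star:
  assumes "near x" shows "stratum (Pst x) (Zst x)"
proof -
  have near: "pos xs \<subseteq> pos x" "neg xs \<subseteq> neg x" using assms by (auto simp: near_def)
  have disj: "pos x \<inter> zer x = {}" "neg x \<inter> zer x = {}" "neg x \<inter> pos x = {}"
    by (auto simp: Ipos_def Izero_def Ineg_def)
  have sub: "pos x \<union> zer x \<subseteq> {1..n}" by (auto simp: Ipos_def Izero_def)
  have "pos xs \<subseteq> Pst x" using near(1) by (auto simp: Ipos_star_def)
  moreover have "Pst x \<subseteq> pos xs \<union> zer xs"
  proof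
    fix i assume "i \<in> Pst x"
    then have "i \<in> pos x \<union> zer x" by (auto simp: Ipos_star_def)
    then have "i \<notin> neg xs" "i \<in> {1..n}" using near(2) disj sub by blast+
    then show "i \<in> pos xs \<union> zer xs" using trichotomy_index by blast
  qed
  moreover have "Zst x \<subseteq> zer xs"
  proof
    fix i assume "i \<in> Zst x"
    then have "i \<in> zer x" by (auto simp: Izero_star_def)
    then have "i \<notin> neg xs" "i \<notin> pos xs" "i \<in> {1..n}" using near disj sub by blast+
    then show "i \<in> zer xs" using trichotomy_index by blast
  qed
  moreover have "Pst x \<inter> Zst x = {}" using disj(1) by (auto simp: Ipos_star_def Izero_star_def)
  ultimately show ?thesis by (simp add: stratum_def)
qed

lemma excess_star:
  assumes "near x"
  shows "excess (Pst x) x = 2 * \<kappa> * (obj x - obj xs)"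
proof -
  have "f_set n \<eta> p (Pst x) x = obj x"
    using assms by (intro f_set_eq_obj[OF stratum_star]) (auto simp: Ipos_star_def Ipos_def Izero_def)
  then show ?thesis by (simp add: excess_def)
qed

text \<open>By complementary slackness the minimal subgradient is orthogonal to the gradients with
  index in \<open>Zst x\<close>, which is the condition characterising \<open>coef\<close>.\<close>

lemma beta_eq_coef:
  assumes "near x" "i \<in> {1..n}"
  shows "\<beta> x i = coef (Pst x) (Zst x) (excess (Pst x) x) i"
proof (rule coef_unique[OF stratum_star[OF assms(1)] _ _ _ _ assms(2)])
  show "q i x = 0" if "i \<in> Zst x" for i using that by (auto simp: Izero_star_def Izero_def)
  show "\<beta> x i = 1" if "i \<in> Pst x" for i using that by (simp add: star_eq_beta)
  show "\<beta> x i = 0" if "i \<in> {1..n}" "i \<notin> Pst x" "i \<notin> Zst x" for i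
    using that K_bounds[OF beta_in_K, of i x] by (auto simp: star_eq_beta)
  show "G (\<beta> x) x \<bullet> gr i x = 0" if "i \<in> Zst x" for i
    using beta_KKT_cases[of i x] that Zst_subset[of x] by (force simp: star_eq_beta)
qed

lemma G_beta_eq_coef:
  assumes "near x"
  shows "G (\<beta> x) x = G (coef (Pst x) (Zst x) (excess (Pst x) x)) x"
  by (intro G_cong beta_eq_coef[OF assms])

text \<open>The conditions on coefficients and energies carry a fact observed at one parameter to
  every other one: coefficients from the start of a path to its later points, a drop of energy from
  the point where it occurs to the whole interval.\<close>

definition admissible :: "real \<Rightarrow> bool" where
  "admissible \<epsilon> \<longleftrightarrow> \<epsilon> > 0 \<and> (\<forall>P Z. stratum P Z \<longrightarrow>
     (\<forall>i\<in>Z. \<forall>s\<in>{0<..<\<epsilon>}. \<forall>t\<in>{0<..<\<epsilon>}. 0 < coef P Z s i \<and> coef P Z s i < 1 \<longrightarrow> 0 < coef P Z t i \<and> coef P Z t i < 1) \<and>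
     (\<forall>j\<in>zer xs. (\<forall>\<tau>. slope P Z j \<tau> = 0) \<or> (\<forall>\<tau>\<in>{0<..<\<epsilon>}. slope P Z j \<tau> \<noteq> 0)) \<and>
     (\<forall>P' Z'. stratum P' Z' \<longrightarrow> (\<forall>s\<in>{0<..<\<epsilon>}. \<forall>t\<in>{0<..<\<epsilon>}.
         energy P' Z' s < energy P Z s \<longrightarrow> energy P' Z' t < energy P Z t)))"

lemma finite_strata: "finite {(P, Z). stratum P Z}"
proof (rule finite_subset)
  show "{(P, Z). stratum P Z} \<subseteq> Pow {1..n} \<times> Pow {1..n}" using stratum_index by auto
qed auto

lemma admissible_exists: "\<exists>\<epsilon>. admissible \<epsilon>"
proof -
  \<comment> \<open>The complements \<open>1 - coef P Z t i\<close> are included so that lying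
    strictly between 0 and 1 becomes a condition on signs.\<close>
  let ?T = "{(P, Z). stratum P Z}"
  let ?S = "(\<lambda>((P, Z), i). \<lambda>t. coef P Z t i) ` (?T \<times> {1..n}) \<union>
    (\<lambda>((P, Z), i). \<lambda>t. 1 - coef P Z t i) ` (?T \<times> {1..n}) \<union>
    (\<lambda>((P, Z), j). slope P Z j) ` (?T \<times> {1..n}) \<union>
    (\<lambda>((P, Z), (P', Z')). \<lambda>t. energy P Z t - energy P' Z' t) ` (?T \<times> ?T)"
  have "finite ?S" using finite_strata by auto
  moreover have "polyfun g" if "g \<in> ?S" for g
    using that by (auto intro!: polyfun_intros polyfun_coef polyfun_slope polyfun_energy)
  ultimately have "\<exists>e>0. \<forall>g\<in>?S. (\<forall>t. g t = 0) \<or> (\<forall>t\<in>{0<..<e}. g t > 0) \<or> (\<forall>t\<in>{0<..<e}. g t < 0)"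
    by (rule polyfun_common_sign)
  then obtain e where e: "e > 0" "\<forall>g\<in>?S. (\<forall>t. g t = 0) \<or> (\<forall>t\<in>{0<..<e}. g t > 0) \<or> (\<forall>t\<in>{0<..<e}. g t < 0)"
    by (elim exE conjE)
  have sgn_eq: "g t > 0" if "g \<in> ?S" "g s > 0" "s \<in> {0<..<e}" "t \<in> {0<..<e}" for g s t
    using bspec[OF e(2) that(1)]
  proof (elim disjE)
    assume "\<forall>t. g t = 0"
    then show ?thesis using that(2) by simp
  next
    assume "\<forall>t\<in>{0<..<e}. g t < 0"
    then have "g s < 0" using that(3) by blast
    then show ?thesis using that(2) by simp
  qed (use that(4) in blast)
  have "admissible e"
    unfolding admissible_def
  proof (intro conjI allI impI ballI e(1))
    fix P Z assume st: "stratum P Z"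
    have idx: "i \<in> {1..n}" if "i \<in> Z" for i using st that stratum_index by blast
    fix i s t assume *: "i \<in> Z" "s \<in> {0<..<e}" "t \<in> {0<..<e}" "0 < coef P Z s i \<and> coef P Z s i < 1"
    have m1: "(\<lambda>t. coef P Z t i) \<in> ?S"
      by (rule UnI1, rule UnI1, rule UnI1, rule image_eqI[of _ _ "((P, Z), i)"]) (use st idx[OF *(1)] in auto)
    have m2: "(\<lambda>t. 1 - coef P Z t i) \<in> ?S"
      by (rule UnI1, rule UnI1, rule UnI2, rule image_eqI[of _ _ "((P, Z), i)"]) (use st idx[OF *(1)] in auto)
    show "0 < coef P Z t i" using sgn_eq[OF m1 _ *(2,3)] * by simp
    show "coef P Z t i < 1" using sgn_eq[OF m2 _ *(2,3)] * by simp
  next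
    fix P Z j assume st: "stratum P Z" "j \<in> zer xs"
    have "slope P Z j \<in> ?S"
      by (rule UnI1, rule UnI2, rule image_eqI[of _ _ "((P, Z), j)"]) (use st in \<open>auto simp: Izero_def\<close>)
    from bspec[OF e(2) this] show "(\<forall>\<tau>. slope P Z j \<tau> = 0) \<or> (\<forall>\<tau>\<in>{0<..<e}. slope P Z j \<tau> \<noteq> 0)"
      by (metis less_irrefl)
  next
    fix P Z P' Z' s t assume st: "stratum P Z" "stratum P' Z'" "s \<in> {0<..<e}" "t \<in> {0<..<e}"
      "energy P' Z' s < energy P Z s"
    have "(\<lambda>t. energy P Z t - energy P' Z' t) \<in> ?S"
      by (rule UnI2, rule image_eqI[of _ _ "((P, Z), (P', Z'))"]) (use st in auto)
    from sgn_eq[OF this _ st(3,4)] show "energy P' Z' t < energy P Z t" using st(5) by simp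
  qed
  then show ?thesis by blast
qed

end

section \<open>Paths along the negative projected gradient\<close>

text \<open>Gronwall's argument with an integrating factor: the square of \<open>\<phi>\<close>
  times \<open>exp (- (2 * B * t))\<close> cannot increase, and times \<open>exp (2 * B * t)\<close>
  it cannot decrease, so a zero propagates forwards and backwards.\<close>

lemma linear_ode_zero_iff:
  fixes \<phi> k :: "real \<Rightarrow> real"
  assumes "a \<le> b" "\<And>t. t \<in> {a..b} \<Longrightarrow> (\<phi> has_real_derivative - (k t * \<phi> t)) (at t)"
    and "\<And>t. t \<in> {a..b} \<Longrightarrow> \<bar>k t\<bar> \<le> B"
  shows "\<phi> a = 0 \<longleftrightarrow> \<phi> b = 0"
proof
  assume "\<phi> a = 0"
  have "(\<lambda>t. (\<phi> t)\<^sup>2 * exp (- (2 * B * t))) b \<le> (\<lambda>t. (\<phi> t)\<^sup>2 * exp (- (2 * B * t))) a"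
  proof (rule DERIV_nonpos_imp_nonincreasing[OF assms(1)])
    fix t assume "a \<le> t" "t \<le> b"
    then have t: "t \<in> {a..b}" by simp
    have "((\<lambda>t. (\<phi> t)\<^sup>2 * exp (- (2 * B * t))) has_real_derivative
        - (2 * (\<phi> t)\<^sup>2 * (k t + B) * exp (- (2 * B * t)))) (at t)"
      by (rule derivative_eq_intros assms(2)[OF t] refl)+ (simp add: algebra_simps power2_eq_square)
    moreover have "k t + B \<ge> 0" using assms(3)[OF t] by linarith
    ultimately show "\<exists>y. ((\<lambda>t. (\<phi> t)\<^sup>2 * exp (- (2 * B * t))) has_real_derivative y) (at t) \<and> y \<le> 0"
      by (intro exI conjI) auto
  qed
  then show "\<phi> b = 0" using \<open>\<phi> a = 0\<close> by (simp add: mult_le_0_iff)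
next
  assume "\<phi> b = 0"
  have "(\<lambda>t. (\<phi> t)\<^sup>2 * exp (2 * B * t)) a \<le> (\<lambda>t. (\<phi> t)\<^sup>2 * exp (2 * B * t)) b"
  proof (rule DERIV_nonneg_imp_nondecreasing[OF assms(1)])
    fix t assume "a \<le> t" "t \<le> b"
    then have t: "t \<in> {a..b}" by simp
    have "((\<lambda>t. (\<phi> t)\<^sup>2 * exp (2 * B * t)) has_real_derivative
        2 * (\<phi> t)\<^sup>2 * (B - k t) * exp (2 * B * t)) (at t)"
      by (rule derivative_eq_intros assms(2)[OF t] refl)+ (simp add: algebra_simps power2_eq_square)
    moreover have "B - k t \<ge> 0" using assms(3)[OF t] by linarith
    ultimately show "\<exists>y. ((\<lambda>t. (\<phi> t)\<^sup>2 * exp (2 * B * t)) has_real_derivative y) (at t) \<and> y \<ge> 0"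
      by (intro exI conjI) auto
  qed
  then show "\<phi> a = 0" using \<open>\<phi> b = 0\<close> by (simp add: mult_le_0_iff)
qed

context spherical_clusters_min
begin

definition vel :: "nat set \<Rightarrow> nat set \<Rightarrow> 'a \<Rightarrow> 'a" where
  "vel P Z z = G (coef P Z (excess P z)) z"

text \<open>The positive factor \<open>\<sigma>\<close> leaves the parametrisation free. It is
  required only before \<open>T\<close>: the paths of the algorithm generally arrive with nonzero
  speed at the point where \<open>vel\<close> vanishes, so \<open>\<sigma>\<close> is unbounded
  there.\<close>

definition trajectory :: "nat set \<Rightarrow> nat set \<Rightarrow> (real \<Rightarrow> 'a) \<Rightarrow> real \<Rightarrow> bool" where
  "trajectory P Z \<gamma> T \<longleftrightarrow> T > 0 \<and> (\<forall>t\<in>{0..T}. \<forall>i\<in>Z. q i (\<gamma> t) = 0) \<and> continuous_on {0..T} \<gamma> \<and>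
     (\<exists>\<sigma>. continuous_on {0..<T} \<sigma> \<and> (\<forall>t\<in>{0..<T}. \<sigma> t > 0 \<and>
        (\<gamma> has_vector_derivative - (\<sigma> t *\<^sub>R vel P Z (\<gamma> t))) (at t))) \<and> vel P Z (\<gamma> T) = 0"

lemma q_compose_derivative:
  assumes "(\<gamma> has_vector_derivative w) (at t)"
  shows "((\<lambda>t. q i (\<gamma> t)) has_real_derivative (gr i (\<gamma> t) \<bullet> w)) (at t)"
proof -
  have "(q i has_derivative (\<lambda>h. h \<bullet> gr i (\<gamma> t))) (at (\<gamma> t))"
    using q_GDERIV unfolding gderiv_def .
  then have "(q i \<circ> \<gamma> has_derivative (\<lambda>h. h \<bullet> gr i (\<gamma> t)) \<circ> (\<lambda>s. s *\<^sub>R w)) (at t)"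
    using assms unfolding has_vector_derivative_def by (rule diff_chain_at[rotated])
  moreover have "(\<lambda>h. h \<bullet> gr i (\<gamma> t)) \<circ> (\<lambda>s. s *\<^sub>R w) = (\<lambda>s. (gr i (\<gamma> t) \<bullet> w) * s)"
    by (auto simp: inner_commute)
  ultimately show ?thesis unfolding has_field_derivative_def by (simp add: o_def)
qed

lemma continuous_q_path:
  "continuous_on A \<gamma> \<Longrightarrow> continuous_on A (\<lambda>t. q i (\<gamma> t))"
  by (rule continuous_on_compose2[OF continuous_q]) auto

lemma continuous_f_set_path:
  "continuous_on A \<gamma> \<Longrightarrow> continuous_on A (\<lambda>t. f_set n \<eta> p P (\<gamma> t))"
  unfolding f_set_def by (intro continuous_on_sum continuous_q_path)

text \<open>Along the path \<open>q j\<close> satisfies a homogeneous linear equation with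
  coefficient \<open>k\<close>. The condition \<open>t < T\<close> keeps \<open>\<sigma>\<close>,
  and with it \<open>k\<close>, bounded on the compact interval from \<open>s\<close> to
  \<open>t\<close>.\<close>

lemma trajectory_zero_iff:
  assumes "stratum P Z" "trajectory P Z \<gamma> T" "j \<in> zer xs" "\<forall>\<tau>. slope P Z j \<tau> = 0"
    and "0 \<le> s" "s \<le> t" "t < T"
  shows "q j (\<gamma> s) = 0 \<longleftrightarrow> q j (\<gamma> t) = 0"
proof -
  obtain \<sigma> where tr: "\<forall>t\<in>{0..T}. \<forall>i\<in>Z. q i (\<gamma> t) = 0" "continuous_on {0..T} \<gamma>"
    "continuous_on {0..<T} \<sigma>" "\<forall>t\<in>{0..<T}. (\<gamma> has_vector_derivative - (\<sigma> t *\<^sub>R vel P Z (\<gamma> t))) (at t)"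
    using assms(2) by (auto simp: trajectory_def)
  define k where "k t = \<sigma> t * (2 * \<kappa> * M (coef P Z (excess P (\<gamma> t))))" for t
  have sub: "{s..t} \<subseteq> {0..<T}" "{s..t} \<subseteq> {0..T}" using assms(5-7) by auto
  have "continuous_on {s..t} k"
    unfolding k_def coef_def M_add excess_def
    by (intro continuous_intros continuous_f_set_path continuous_on_subset[OF tr(2) sub(2)]
        continuous_on_subset[OF tr(3) sub(1)])
  then have "bounded (k ` {s..t})" by (intro compact_imp_bounded compact_continuous_image) auto
  then obtain B where "\<forall>u\<in>{s..t}. \<bar>k u\<bar> \<le> B" by (auto simp: bounded_iff)
  then have B: "\<And>u. u \<in> {s..t} \<Longrightarrow> \<bar>k u\<bar> \<le> B" by blast
  show ?thesis
  proof (rule linear_ode_zero_iff[OF assms(6) _ B])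
    fix u assume u: "u \<in> {s..t}"
    then have u': "u \<in> {0..T}" "u \<in> {0..<T}" using sub by auto
    have "gr j (\<gamma> u) \<bullet> (- (\<sigma> u *\<^sub>R vel P Z (\<gamma> u))) = - (k u * q j (\<gamma> u))"
      using coef_inner_gr[OF assms(1) _ assms(3), of "\<gamma> u"] tr(1) u'(1) assms(4)
      by (simp add: vel_def k_def inner_commute)
    then show "((\<lambda>t. q j (\<gamma> t)) has_real_derivative - (k u * q j (\<gamma> u))) (at u)"
      using q_compose_derivative[OF bspec[OF tr(4) u'(2)], of j] by simp
  qed
qed

lemma vel_stratum_sum:
  assumes "stratum P Z"
  shows "vel P Z z = (\<Sum>i\<in>P. gr i z) + (\<Sum>i\<in>Z. coef P Z (excess P z) i *\<^sub>R gr i z)"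
proof -
  have PZ: "P \<inter> Z = {}" "P \<subseteq> {1..n}" "Z \<subseteq> {1..n}"
    using assms(1) stratum_index[OF assms(1)] by (auto simp: stratum_def)
  then have fin: "finite P" "finite Z" by (auto intro: finite_subset)
  have "vel P Z z = (\<Sum>i\<in>P \<union> Z. coef P Z (excess P z) i *\<^sub>R gr i z)"
    unfolding vel_def G_def using PZ coef_props(2)[OF assms(1)]
    by (intro sum.mono_neutral_right) auto
  then show ?thesis
    using PZ fin coef_props(1)[OF assms(1)] by (simp add: sum.union_disjoint)
qed

text \<open>The field differs from the gradient of \<open>f_set P\<close> by a combination of
  gradients orthogonal to the field, so the derivative along the path is
  \<open>- (\<sigma> u * (v \<bullet> v))\<close>.\<close>

lemma trajectory_descent:
  assumes "stratum P Z" "trajectory P Z \<gamma> T" "0 < t" "t \<le> T"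
  shows "f_set n \<eta> p P (\<gamma> t) \<le> f_set n \<eta> p P (\<gamma> 0)"
proof -
  obtain \<sigma> where tr: "\<forall>t\<in>{0..T}. \<forall>i\<in>Z. q i (\<gamma> t) = 0" "continuous_on {0..T} \<gamma>"
    "\<forall>t\<in>{0..<T}. \<sigma> t > 0 \<and> (\<gamma> has_vector_derivative - (\<sigma> t *\<^sub>R vel P Z (\<gamma> t))) (at t)"
    using assms(2) by (auto simp: trajectory_def)
  show ?thesis
  proof (rule DERIV_nonpos_imp_decreasing_open[OF less_imp_le[OF assms(3)]])
    show "continuous_on {0..t} (\<lambda>t. f_set n \<eta> p P (\<gamma> t))"
      by (rule continuous_f_set_path[OF continuous_on_subset[OF tr(2)]]) (use assms(4) in auto)
    fix u assume "0 < u" "u < t"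
    then have u: "u \<in> {0..T}" "u \<in> {0..<T}" using assms(4) by auto
    define v where "v = vel P Z (\<gamma> u)"
    note v = vel_stratum_sum[OF assms(1), of "\<gamma> u", folded v_def]
    have "(\<Sum>i\<in>Z. coef P Z (excess P (\<gamma> u)) i *\<^sub>R gr i (\<gamma> u)) \<bullet> v = 0"
      unfolding inner_sum_left
      using coef_orthogonal[OF assms(1), of "\<gamma> u"] tr(1) u(1)
      by (intro sum.neutral) (auto simp: v_def vel_def inner_commute)
    then have "(\<Sum>i\<in>P. gr i (\<gamma> u)) \<bullet> v = v \<bullet> v"
      by (subst (2) v) (simp add: inner_add_left)
    then have "(\<Sum>i\<in>P. gr i (\<gamma> u) \<bullet> (- (\<sigma> u *\<^sub>R v))) = - (\<sigma> u * (v \<bullet> v))"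
      by (simp add: inner_sum_left sum_negf flip: sum_distrib_left)
    moreover have "((\<lambda>t. f_set n \<eta> p P (\<gamma> t)) has_real_derivative
        (\<Sum>i\<in>P. gr i (\<gamma> u) \<bullet> (- (\<sigma> u *\<^sub>R v)))) (at u)"
      unfolding f_set_def v_def using tr(3) u(2) by (intro DERIV_sum q_compose_derivative) auto
    moreover have "\<sigma> u * (v \<bullet> v) \<ge> 0" using tr(3) u(2) by (simp add: less_imp_le)
    ultimately show "\<exists>y. ((\<lambda>t. f_set n \<eta> p P (\<gamma> t)) has_real_derivative y) (at u) \<and> y \<le> 0"
      by (intro exI conjI) auto
  qed
qed

lemma index_partition_star:
  "j \<in> {1..n} \<Longrightarrow> j \<in> Pst x \<or> j \<in> Zst x \<or> j \<in> Nst x"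
  "Pst x \<inter> Zst x = {}" "Pst x \<inter> Nst x = {}" "Zst x \<inter> Nst x = {}"
  "Pst x \<subseteq> {1..n}" "Zst x \<subseteq> {1..n}" "Nst x \<subseteq> {1..n}"
  using K_bounds[OF beta_in_K[of x], of j] unfolding star_eq_beta by auto

lemma cell_star_iff:
  "z \<in> cell_star n \<eta> p x \<longleftrightarrow>
     (\<forall>j\<in>Pst x. q j z > 0) \<and> (\<forall>j\<in>Zst x. q j z = 0) \<and> (\<forall>j\<in>Nst x. q j z < 0)"
proof
  assume "z \<in> cell_star n \<eta> p x"
  then have "Ipos n \<eta> p z = Pst x" "Izero n \<eta> p z = Zst x" "Ineg n \<eta> p z = Nst x"
    by (simp_all add: cell_star_def cell_of_triple_def)
  then show "(\<forall>j\<in>Pst x. q j z > 0) \<and> (\<forall>j\<in>Zst x. q j z = 0) \<and> (\<forall>j\<in>Nst x. q j z < 0)"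
    by (auto simp: Ipos_def Izero_def Ineg_def)
next
  assume R: "(\<forall>j\<in>Pst x. q j z > 0) \<and> (\<forall>j\<in>Zst x. q j z = 0) \<and> (\<forall>j\<in>Nst x. q j z < 0)"
  note part = index_partition_star[where x=x]
  have iff: "(q j z > 0 \<longleftrightarrow> j \<in> Pst x) \<and> (q j z = 0 \<longleftrightarrow> j \<in> Zst x) \<and> (q j z < 0 \<longleftrightarrow> j \<in> Nst x)"
    if "j \<in> {1..n}" for j
    using part(1)[OF that]
  proof (elim disjE)
    assume "j \<in> Pst x"
    then show ?thesis using R by (metis less_asym' less_irrefl)
  next
    assume "j \<in> Zst x"
    then show ?thesis using R by (metis less_irrefl)
  next
    assume "j \<in> Nst x"
    then show ?thesis using R by (metis less_asym' less_irrefl)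
  qed
  have "pos z = Pst x" unfolding Ipos_def using iff part(5) by blast
  moreover have "zer z = Zst x" unfolding Izero_def using iff part(6) by blast
  moreover have "neg z = Nst x" unfolding Ineg_def using iff part(7) by blast
  ultimately show "z \<in> cell_star n \<eta> p x" by (simp add: cell_star_def cell_of_triple_def)
qed

text \<open>Quantifying over the whole sublevel set makes the property pass to every point where F
  is not larger.\<close>

definition close :: "real \<Rightarrow> 'a \<Rightarrow> bool" where
  "close \<epsilon> x \<longleftrightarrow> 2 * \<kappa> * (obj x - obj xs) < \<epsilon> \<and> (\<forall>z. obj z \<le> obj x \<longrightarrow> near z)"

lemma closeD:
  assumes "close \<epsilon> x" "x \<noteq> xs"
  shows "near x" "excess (Pst x) x \<in> {0<..<\<epsilon>}"
proof -
  show "near x" using assms(1) by (auto simp: close_def)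
  then show "excess (Pst x) x \<in> {0<..<\<epsilon>}"
    using assms(1) obj_gt[OF assms(2)] kappa_pos by (simp add: close_def excess_star)
qed

lemma near_zer: "near x \<Longrightarrow> zer x \<subseteq> zer xs"
proof
  fix i assume "near x" "i \<in> zer x"
  moreover from \<open>i \<in> zer x\<close> have "i \<notin> pos x" "i \<notin> neg x" "i \<in> {1..n}"
    by (auto simp: Ipos_def Izero_def Ineg_def)
  ultimately show "i \<in> zer xs" using trichotomy_index[of i xs] by (auto simp: near_def)
qed

text \<open>At the start, complementary slackness gives the weak sign of the derivative of each
  \<open>q j\<close> that must leave 0. If no slope involved is identically zero, admissibility
  makes these signs strict and the path enters the cell. Otherwise some \<open>q j\<close> stays 0
  and the path remains outside.\<close>

lemma trajectory_start:
  assumes adm: "admissible \<epsilon>" and close: "close \<epsilon> x" "x \<noteq> xs"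
    and tr: "trajectory (Pst x) (Zst x) \<gamma> T" "\<gamma> 0 = x"
  shows "(\<exists>j\<in>zer xs. (\<forall>\<tau>. slope (Pst x) (Zst x) j \<tau> = 0) \<and> (\<forall>t. 0 < t \<and> t < T \<longrightarrow> \<gamma> t \<notin> cell_star n \<eta> p x))
    \<or> (\<forall>\<^sub>F t in at_right 0. \<gamma> t \<in> cell_star n \<eta> p x)"
proof -
  let ?P = "Pst x" and ?Z = "Zst x"
  note near = closeD(1)[OF close] and ex = closeD(2)[OF close]
  note st = stratum_star[OF near]
  obtain \<sigma> where T: "T > 0" and \<sigma>: "\<forall>t\<in>{0..T}. \<forall>i\<in>?Z. q i (\<gamma> t) = 0" "continuous_on {0..T} \<gamma>"
    "\<forall>t\<in>{0..<T}. \<sigma> t > 0 \<and> (\<gamma> has_vector_derivative - (\<sigma> t *\<^sub>R vel ?P ?Z (\<gamma> t))) (at t)"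
    using tr(1) by (auto simp: trajectory_def)
  show ?thesis
  proof (cases "\<exists>j\<in>zer x - ?Z. \<forall>\<tau>. slope ?P ?Z j \<tau> = 0")
    case True
    then obtain j where j: "j \<in> zer x" "j \<notin> ?Z" "\<forall>\<tau>. slope ?P ?Z j \<tau> = 0" by auto
    have jxs: "j \<in> zer xs" using near_zer[OF near] j by blast
    have "\<gamma> t \<notin> cell_star n \<eta> p x" if "0 < t" "t < T" for t
    proof -
      have "q j (\<gamma> 0) = 0" using j(1) tr(2) by (simp add: Izero_def)
      then have "q j (\<gamma> t) = 0" using trajectory_zero_iff[OF st tr(1) jxs j(3), of 0 t] that by simp
      moreover have "j \<in> ?P \<or> j \<in> Nst x"
        using index_partition_star(1)[of j x] j by (auto simp: Izero_def)
      ultimately show ?thesis unfolding cell_star_iff by (metis less_irrefl)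
    qed
    then show ?thesis using jxs j(3) by blast
  next
    case False
    have lim: "((\<lambda>t. q j (\<gamma> t)) \<longlongrightarrow> q j x) (at_right 0)" for j
    proof -
      have "(\<gamma> has_vector_derivative - (\<sigma> 0 *\<^sub>R vel ?P ?Z (\<gamma> 0))) (at 0)" using \<sigma>(3) T by auto
      then have "((\<lambda>t. q j (\<gamma> t)) has_real_derivative (gr j (\<gamma> 0) \<bullet> (- (\<sigma> 0 *\<^sub>R vel ?P ?Z (\<gamma> 0))))) (at 0)"
        by (rule q_compose_derivative)
      then have "isCont (\<lambda>t. q j (\<gamma> t)) 0" by (rule DERIV_isCont)
      then have "((\<lambda>t. q j (\<gamma> t)) \<longlongrightarrow> q j x) (at 0)" by (simp add: isCont_def tr(2))
      then show ?thesis by (rule tendsto_mono[OF at_le, rotated]) simp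
    qed
    have "(\<gamma> has_vector_derivative - (\<sigma> 0 *\<^sub>R vel ?P ?Z (\<gamma> 0))) (at 0)" using \<sigma>(3) T by auto
    then have der: "((\<lambda>t. q j (\<gamma> t)) has_real_derivative - (\<sigma> 0 * (G (\<beta> x) x \<bullet> gr j x))) (at 0)" for j
      using q_compose_derivative[of \<gamma> "- (\<sigma> 0 *\<^sub>R vel ?P ?Z (\<gamma> 0))" 0 j]
      by (simp add: tr(2) vel_def G_beta_eq_coef[OF near] inner_commute)
    have \<sigma>0: "\<sigma> 0 > 0" using \<sigma>(3) T by auto
    have nz: "G (\<beta> x) x \<bullet> gr j x \<noteq> 0" if j: "j \<in> zer x" "j \<notin> ?Z" for j
    proof -
      have jxs: "j \<in> zer xs" using near_zer[OF near] j by blast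
      have "G (\<beta> x) x \<bullet> gr j x = slope ?P ?Z j (excess ?P x)"
        using coef_inner_gr[OF st _ jxs, of x] Zst_subset[of x] j(1)
        by (auto simp: G_beta_eq_coef[OF near] Izero_def)
      moreover have "\<not> (\<forall>\<tau>. slope ?P ?Z j \<tau> = 0)" using False j by blast
      ultimately show ?thesis using adm st jxs ex unfolding admissible_def by metis
    qed
    have pos: "\<forall>\<^sub>F t in at_right 0. q j (\<gamma> t) > 0" if j: "j \<in> ?P" for j
    proof (cases "j \<in> zer x")
      case True
      have b: "\<beta> x j = 1" "j \<notin> ?Z" using j by (auto simp: star_eq_beta)
      then have "G (\<beta> x) x \<bullet> gr j x < 0" using beta_KKT_cases(2)[OF True] nz[OF True] by fastforce
      then have "0 < - (\<sigma> 0 * (G (\<beta> x) x \<bullet> gr j x))" using \<sigma>0 by (simp add: mult_pos_neg)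
      then obtain d where d: "d > 0" "\<forall>h>0. h < d \<longrightarrow> q j (\<gamma> 0) < q j (\<gamma> (0 + h))"
        using DERIV_pos_inc_right[OF der] by blast
      then show ?thesis unfolding eventually_at_right_field using True tr(2) by (auto simp: Izero_def)
    next
      case False
      then have "q j x > 0" using j by (auto simp: Ipos_star_def Ipos_def)
      then show ?thesis using order_tendstoD(1)[OF lim] by blast
    qed
    have neg: "\<forall>\<^sub>F t in at_right 0. q j (\<gamma> t) < 0" if j: "j \<in> Nst x" for j
    proof (cases "j \<in> zer x")
      case True
      have b: "\<beta> x j = 0" "j \<notin> ?Z" using j by (auto simp: star_eq_beta)
      then have "G (\<beta> x) x \<bullet> gr j x > 0" using beta_KKT_cases(1)[OF True] nz[OF True] by fastforce
      then have "- (\<sigma> 0 * (G (\<beta> x) x \<bullet> gr j x)) < 0" using \<sigma>0 by simp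
      then obtain d where d: "d > 0" "\<forall>h>0. h < d \<longrightarrow> q j (\<gamma> (0 + h)) < q j (\<gamma> 0)"
        using DERIV_neg_dec_right[OF der] by blast
      then show ?thesis unfolding eventually_at_right_field using True tr(2) by (auto simp: Izero_def)
    next
      case False
      then have "q j x < 0" using j by (auto simp: Ineg_star_def Ineg_def)
      then show ?thesis using order_tendstoD(2)[OF lim] by blast
    qed
    have fin: "finite ?P" "finite (Nst x)"
      using index_partition_star(5,7)[of x] by (auto intro: finite_subset)
    have "\<forall>\<^sub>F t in at_right 0. \<forall>j\<in>?P. q j (\<gamma> t) > 0"
      using pos fin by (intro eventually_ball_finite) auto
    moreover have "\<forall>\<^sub>F t in at_right 0. \<forall>j\<in>Nst x. q j (\<gamma> t) < 0"
      using neg fin by (intro eventually_ball_finite) auto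
    moreover have "\<forall>\<^sub>F t in at_right 0. \<forall>j\<in>?Z. q j (\<gamma> t) = 0"
      unfolding eventually_at_right_field using \<sigma>(1) T by (intro exI[of _ T]) auto
    ultimately have "\<forall>\<^sub>F t in at_right 0. \<gamma> t \<in> cell_star n \<eta> p x"
      by eventually_elim (simp add: cell_star_iff)
    then show ?thesis ..
  qed
qed

text \<open>On the path a cell can only be left by failure of a strict inequality, a closed
  condition. The initial point may itself lie outside the cell, so the parameters below
  \<open>d / 2\<close> are cut off before the least outside parameter is taken.\<close>

lemma trajectory_first_exit:
  assumes tr: "trajectory (Pst x) (Zst x) \<gamma> T"
    and ev: "\<forall>\<^sub>F t in at_right 0. \<gamma> t \<in> cell_star n \<eta> p x" and out: "\<gamma> T \<notin> cell_star n \<eta> p x"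
  shows "\<exists>t. 0 < t \<and> t \<le> T \<and> \<gamma> t \<notin> cell_star n \<eta> p x \<and> (\<forall>s. 0 < s \<and> s < t \<longrightarrow> \<gamma> s \<in> cell_star n \<eta> p x)"
proof -
  let ?D = "cell_star n \<eta> p x"
  have T: "T > 0" and Z: "\<forall>t\<in>{0..T}. \<forall>i\<in>Zst x. q i (\<gamma> t) = 0" and cont: "continuous_on {0..T} \<gamma>"
    using tr by (auto simp: trajectory_def)
  obtain d where d: "d > 0" "\<And>t. 0 < t \<Longrightarrow> t < d \<Longrightarrow> \<gamma> t \<in> ?D"
    using ev unfolding eventually_at_right_field by auto
  have dT: "d \<le> T" using d(2)[OF T] out by force
  define E where "E = {t \<in> {d/2..T}. \<gamma> t \<notin> ?D}"
  have cont': "continuous_on {d/2..T} (\<lambda>t. q j (\<gamma> t))" for j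
    by (intro continuous_q_path continuous_on_subset[OF cont]) (use d in auto)
  have fin: "finite (Pst x)" "finite (Nst x)"
    using index_partition_star(5,7)[of x] by (auto intro: finite_subset)
  have "E = (\<Union>j\<in>Pst x. {d/2..T} \<inter> (\<lambda>t. q j (\<gamma> t)) -` {..0}) \<union>
      (\<Union>j\<in>Nst x. {d/2..T} \<inter> (\<lambda>t. q j (\<gamma> t)) -` {0..})"
    using Z d(1) unfolding E_def cell_star_iff by (auto simp: not_less)
  moreover have "closed (\<Union>j\<in>Pst x. {d/2..T} \<inter> (\<lambda>t. q j (\<gamma> t)) -` {..0})"
    using fin by (intro closed_UN ballI continuous_closed_preimage cont') auto
  moreover have "closed (\<Union>j\<in>Nst x. {d/2..T} \<inter> (\<lambda>t. q j (\<gamma> t)) -` {0..})"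
    using fin by (intro closed_UN ballI continuous_closed_preimage cont') auto
  ultimately have "closed E" by (simp add: closed_Un)
  moreover have "bounded E" by (rule bounded_subset[of "{d/2..T}"]) (auto simp: E_def)
  ultimately have "compact E" by (simp add: compact_eq_bounded_closed)
  moreover have "T \<in> E" using out dT d(1) by (auto simp: E_def)
  ultimately obtain t where t: "t \<in> E" "\<And>s. s \<in> E \<Longrightarrow> t \<le> s"
    using compact_attains_inf[of E] by blast
  have "\<gamma> s \<in> ?D" if s: "0 < s" "s < t" for s
  proof (cases "s < d")
    case True then show ?thesis using d(2) s by blast
  next
    case False
    then have "s \<in> {d/2..T}" using s t(1) d(1) by (auto simp: E_def)
    then show ?thesis using t(2)[of s] s by (auto simp: E_def)
  qed
  then show ?thesis using t(1) d(1) by (intro exI[of _ t]) (auto simp: E_def)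
qed

text \<open>Common to the end of a path and to its exit from the cell: \<open>\<gamma> t\<close>
  need only lie in the closure of the cell. F has not increased, so \<tau> is still small, and
  admissibility carries the bounds on the coefficients from \<open>x\<close> to
  \<open>\<gamma> t\<close>; hence they represent a subgradient there.\<close>

lemma trajectory_point:
  assumes adm: "admissible \<epsilon>" and close: "close \<epsilon> x" "x \<noteq> xs"
    and tr: "trajectory (Pst x) (Zst x) \<gamma> T" "\<gamma> 0 = x"
    and exit: "0 < t" "t \<le> T"
    and yP: "\<And>j. j \<in> Pst x \<Longrightarrow> q j (\<gamma> t) \<ge> 0" and yN: "\<And>j. j \<in> Nst x \<Longrightarrow> q j (\<gamma> t) \<le> 0"
    and False: "\<gamma> t \<noteq> xs"
  shows "close \<epsilon> (\<gamma> t)" "excess (Pst (\<gamma> t)) (\<gamma> t) = excess (Pst x) (\<gamma> t)"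
    "coef (Pst x) (Zst x) (excess (Pst x) (\<gamma> t)) \<in> K (\<gamma> t)" "vel (Pst x) (Zst x) (\<gamma> t) \<noteq> 0"
proof -
  let ?P = "Pst x" and ?Z = "Zst x" and ?y = "\<gamma> t"
  note near = closeD(1)[OF close] and ex = closeD(2)[OF close]
  note st = stratum_star[OF near]
  note part = index_partition_star[where x=x]
  have yZ: "q j ?y = 0" if "j \<in> ?Z" for j
    using tr(1) exit that by (auto simp: trajectory_def)
  have fy: "f_set n \<eta> p ?P ?y = obj ?y"
  proof (rule f_set_eq_obj[OF st])
    show "q i ?y \<ge> 0" if "i \<in> ?P" for i using yP that .
    show "q i ?y \<le> 0" if "i \<in> {1..n}" "i \<notin> ?P" for i
      using part(1)[OF that(1)] that(2) yN[of i] yZ[of i] by auto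
  qed
  have "f_set n \<eta> p ?P x = obj x"
    using excess_star[OF near] kappa_pos by (simp add: excess_def)
  then have le: "obj ?y \<le> obj x"
    using trajectory_descent[OF st tr(1) exit(1,2)] fy tr(2) by simp
  have closey: "close \<epsilon> ?y"
  proof -
    have "2 * \<kappa> * (obj ?y - obj xs) \<le> 2 * \<kappa> * (obj x - obj xs)"
      using le kappa_pos by (intro mult_left_mono) auto
    then show ?thesis using close(1) le unfolding close_def by force
  qed
  note neary = closeD(1)[OF closey False]
  define \<tau> where "\<tau> = excess ?P ?y"
  have \<tau>eq: "excess (Pst ?y) ?y = \<tau>"
    unfolding excess_star[OF neary] unfolding \<tau>_def excess_def fy ..
  have \<tau>: "\<tau> \<in> {0<..<\<epsilon>}" using closeD(2)[OF closey False] unfolding \<tau>eq .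
  define a where "a = coef ?P ?Z \<tau>"
  have aZ: "0 < a i \<and> a i < 1" if "i \<in> ?Z" for i
  proof -
    have "\<beta> x i = coef ?P ?Z (excess ?P x) i" using beta_eq_coef[OF near] that part(6) by blast
    then have "0 < coef ?P ?Z (excess ?P x) i \<and> coef ?P ?Z (excess ?P x) i < 1"
      using that by (simp add: star_eq_beta)
    then show ?thesis using adm st ex \<tau> that unfolding a_def admissible_def by blast
  qed
  have aP: "a i = 1" if "i \<in> ?P" for i using coef_props(1)[OF st that] by (simp add: a_def)
  have aN: "a i = 0" if "i \<in> Nst x" for i
    using coef_props(2)[OF st, of i] that part(3,4) unfolding a_def by blast
  have aK: "a \<in> K ?y"
    unfolding K_def
  proof (intro CollectI conjI ballI)
    fix i assume i: "i \<in> pos ?y"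
    then show "a i = 1" using part(1)[of i] yN[of i] yZ[of i] aP[of i] by (auto simp: Ipos_def)
  next
    fix i assume i: "i \<in> neg ?y"
    then show "a i = 0" using part(1)[of i] yP[of i] yZ[of i] aN[of i] by (auto simp: Ineg_def)
  next
    fix i assume i: "i \<in> zer ?y"
    then have "i \<in> ?P \<or> i \<in> ?Z \<or> i \<in> Nst x" using part(1)[of i] by (auto simp: Izero_def)
    then show "0 \<le> a i" "a i \<le> 1" using aP[of i] aN[of i] aZ[of i] by auto
  qed
  show "close \<epsilon> ?y" by (fact closey)
  show "excess (Pst ?y) ?y = excess ?P ?y" using \<tau>eq unfolding \<tau>_def .
  show "coef ?P ?Z (excess ?P ?y) \<in> K ?y" using aK unfolding a_def \<tau>_def .
  show "vel ?P ?Z ?y \<noteq> 0" using stationary_eq_xs[OF aK] False unfolding vel_def a_def \<tau>_def by blast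
qed

text \<open>At the end the field vanishes, while at a point of the cell other than \<open>xs\<close>
  it is a nonzero subgradient.\<close>

lemma trajectory_end:
  assumes "admissible \<epsilon>" "close \<epsilon> x" "x \<noteq> xs"
    and "trajectory (Pst x) (Zst x) \<gamma> T" "\<gamma> 0 = x" "\<gamma> T \<in> cell_star n \<eta> p x"
  shows "\<gamma> T = xs"
proof (rule ccontr)
  assume "\<gamma> T \<noteq> xs"
  moreover have "0 < T" "vel (Pst x) (Zst x) (\<gamma> T) = 0" using assms(4) by (auto simp: trajectory_def)
  moreover have "\<And>j. j \<in> Pst x \<Longrightarrow> q j (\<gamma> T) \<ge> 0" "\<And>j. j \<in> Nst x \<Longrightarrow> q j (\<gamma> T) \<le> 0"
    using assms(6) by (auto simp: cell_star_iff intro: less_imp_le)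
  ultimately show False using trajectory_point(4)[OF assms(1-5)] by blast
qed

lemma trajectory_exit:
  assumes adm: "admissible \<epsilon>" and close: "close \<epsilon> x" "x \<noteq> xs"
    and tr: "trajectory (Pst x) (Zst x) \<gamma> T" "\<gamma> 0 = x"
    and exit: "0 < t" "t \<le> T" "\<gamma> t \<notin> cell_star n \<eta> p x" "\<forall>s. 0 < s \<and> s < t \<longrightarrow> \<gamma> s \<in> cell_star n \<eta> p x"
  shows "\<gamma> t = xs \<or> close \<epsilon> (\<gamma> t) \<and> (\<forall>\<tau>\<in>{0<..<\<epsilon>}.
    energy (Pst (\<gamma> t)) (Zst (\<gamma> t)) \<tau> < energy (Pst x) (Zst x) \<tau>)"
proof (cases "\<gamma> t = xs")
  case False
  let ?P = "Pst x" and ?Z = "Zst x" and ?y = "\<gamma> t"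
  note near = closeD(1)[OF close] and ex = closeD(2)[OF close]
  note st = stratum_star[OF near]
  note part = index_partition_star[where x=x]
  obtain \<sigma> where T: "T > 0" and \<sigma>: "\<forall>t\<in>{0..T}. \<forall>i\<in>?Z. q i (\<gamma> t) = 0" "continuous_on {0..T} \<gamma>"
    "\<forall>t\<in>{0..<T}. \<sigma> t > 0 \<and> (\<gamma> has_vector_derivative - (\<sigma> t *\<^sub>R vel ?P ?Z (\<gamma> t))) (at t)"
    "vel ?P ?Z (\<gamma> T) = 0"
    using tr(1) by (auto simp: trajectory_def)
  have lim: "((\<lambda>s. q j (\<gamma> s)) \<longlongrightarrow> q j ?y) (at_left t)" for j
  proof -
    have "continuous_on {0..t} (\<lambda>s. q j (\<gamma> s))"
      by (intro continuous_q_path continuous_on_subset[OF \<sigma>(2)]) (use exit(2) in auto)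
    from continuous_on_Icc_at_leftD[OF this exit(1)] show ?thesis .
  qed
  have inside: "\<forall>\<^sub>F s in at_left t. \<gamma> s \<in> cell_star n \<eta> p x"
    unfolding eventually_at_left_field using exit(1,4) by (intro exI[of _ 0]) auto
  have yP: "q j ?y \<ge> 0" if "j \<in> ?P" for j
  proof (rule tendsto_lowerbound[OF lim])
    show "\<forall>\<^sub>F s in at_left t. 0 \<le> q j (\<gamma> s)"
      using inside by eventually_elim (use that in \<open>auto simp: cell_star_iff intro: less_imp_le\<close>)
  qed simp
  have yN: "q j ?y \<le> 0" if "j \<in> Nst x" for j
  proof (rule tendsto_upperbound[OF lim])
    show "\<forall>\<^sub>F s in at_left t. q j (\<gamma> s) \<le> 0"
      using inside by eventually_elim (use that in \<open>auto simp: cell_star_iff intro: less_imp_le\<close>)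
  qed simp
  have yZ: "q j ?y = 0" if "j \<in> ?Z" for j using \<sigma>(1) exit(1,2) that by auto
  note point = trajectory_point[OF adm close tr exit(1,2) yP yN False, simplified]
  note closey = point(1)
  note neary = closeD(1)[OF closey False]
  define \<tau> where "\<tau> = excess ?P ?y"
  have \<tau>eq: "excess (Pst ?y) ?y = \<tau>" using point(2) unfolding \<tau>_def .
  have \<tau>: "\<tau> \<in> {0<..<\<epsilon>}" using closeD(2)[OF closey False] unfolding \<tau>eq .
  define a where "a = coef ?P ?Z \<tau>"
  have aP: "a i = 1" if "i \<in> ?P" for i using coef_props(1)[OF st that] by (simp add: a_def)
  have aN: "a i = 0" if "i \<in> Nst x" for i
    using coef_props(2)[OF st, of i] that part(3,4) unfolding a_def by blast
  have aK: "a \<in> K ?y" using point(3) unfolding a_def \<tau>_def .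
  have vel: "vel ?P ?Z ?y = G a ?y" by (simp add: vel_def a_def \<tau>_def)
  \<comment> \<open>The field vanishes at \<open>T\<close> but not at the exit, so the exit comes
    earlier and the path is differentiable there.\<close>
  have tT: "t < T" using point(4) \<sigma>(4) exit(2) by (metis order_le_less)
  obtain j where j: "j \<in> ?P \<or> j \<in> Nst x" "q j ?y = 0"
    using exit(3) yP yN yZ unfolding cell_star_iff by (metis order_le_less)
  have jn: "j \<in> {1..n}" using j(1) part by blast
  have jy: "j \<in> zer ?y" using j jn by (simp add: Izero_def)
  then have jxs: "j \<in> zer xs" using near_zer[OF neary] by blast
  have "\<not> (\<forall>\<tau>. slope ?P ?Z j \<tau> = 0)"
  proof
    assume "\<forall>\<tau>. slope ?P ?Z j \<tau> = 0"
    then have "q j (\<gamma> (t/2)) = 0"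
      using trajectory_zero_iff[OF st tr(1) jxs, of "t/2" t] j(2) exit(1) tT by simp
    moreover have "\<gamma> (t/2) \<in> cell_star n \<eta> p x" using exit(1,4) by simp
    ultimately show False using j(1) unfolding cell_star_iff by force
  qed
  then have s0: "slope ?P ?Z j \<tau> \<noteq> 0" using adm st jxs \<tau> unfolding admissible_def by metis
  have sl: "G a ?y \<bullet> gr j ?y = slope ?P ?Z j \<tau>"
    using coef_inner_gr[OF st yZ jxs] j(2) by (simp add: a_def \<tau>_def)
  have \<sigma>t: "\<sigma> t > 0" using \<sigma>(3) exit(1) tT by auto
  have "(\<gamma> has_vector_derivative - (\<sigma> t *\<^sub>R vel ?P ?Z (\<gamma> t))) (at t)" using \<sigma>(3) exit(1) tT by auto
  from q_compose_derivative[OF this, of j]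
  have der: "((\<lambda>s. q j (\<gamma> s)) has_real_derivative - (\<sigma> t * slope ?P ?Z j \<tau>)) (at t)"
    unfolding vel sl[symmetric] by (simp add: inner_commute)
  \<comment> \<open>If the old coefficients were minimal at the exit, complementary slackness would
    move \<open>q j\<close> at time \<open>t\<close> back towards the sign prescribed by the cell;
    as it is 0 at \<open>t\<close>, it would have had the opposite sign just before, where the path
    is inside.\<close>
  have not_beta: "\<exists>i\<in>{1..n}. a i \<noteq> \<beta> ?y i"
  proof (rule ccontr)
    assume "\<not> ?thesis"
    then have eq: "a i = \<beta> ?y i" if "i \<in> {1..n}" for i using that by blast
    then have G: "G (\<beta> ?y) ?y \<bullet> gr j ?y = slope ?P ?Z j \<tau>"
      unfolding sl[symmetric] by (metis G_cong)
    from j(1) show False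
    proof
      assume jP: "j \<in> ?P"
      then have "slope ?P ?Z j \<tau> < 0"
        using beta_KKT_cases(2)[OF jy] eq[OF jn] aP[OF jP] s0 unfolding G by simp
      then have "- (\<sigma> t * slope ?P ?Z j \<tau>) > 0" using \<sigma>t by (simp add: mult_pos_neg)
      then obtain d where d: "d > 0" "\<And>h. h > 0 \<Longrightarrow> h < d \<Longrightarrow> q j (\<gamma> (t - h)) < 0"
        using DERIV_pos_inc_left[OF der] j(2) by auto
      \<comment> \<open>Besides \<open>h < d\<close>, the parameter \<open>t - h\<close> has to
        remain positive.\<close>
      define h where "h = min d t / 2"
      have h: "0 < h" "h < d" "h < t" using d(1) exit(1) by (auto simp: h_def)
      have "\<gamma> (t - h) \<in> cell_star n \<eta> p x" using exit(4) h by simp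
      then show False using d(2)[OF h(1,2)] jP unfolding cell_star_iff by force
    next
      assume jN: "j \<in> Nst x"
      then have "slope ?P ?Z j \<tau> > 0"
        using beta_KKT_cases(1)[OF jy] eq[OF jn] aN[OF jN] s0 unfolding G by simp
      then have "- (\<sigma> t * slope ?P ?Z j \<tau>) < 0" using \<sigma>t by simp
      then obtain d where d: "d > 0" "\<And>h. h > 0 \<Longrightarrow> h < d \<Longrightarrow> q j (\<gamma> (t - h)) > 0"
        using DERIV_neg_dec_left[OF der] j(2) by auto
      define h where "h = min d t / 2"
      have h: "0 < h" "h < d" "h < t" using d(1) exit(1) by (auto simp: h_def)
      have "\<gamma> (t - h) \<in> cell_star n \<eta> p x" using exit(4) h by simp
      then show False using d(2)[OF h(1,2)] jN unfolding cell_star_iff by force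
    qed
  qed
  then have "norm (G (\<beta> ?y) ?y) < norm (G a ?y)"
    using beta_minimal(2)[OF aK] by (meson not_less)
  then have "(norm (G (\<beta> ?y) ?y))\<^sup>2 < (norm (G a ?y))\<^sup>2" by (simp add: power_strict_mono)
  moreover have "(norm (G a ?y))\<^sup>2 = energy ?P ?Z \<tau>"
    using coef_energy[OF st yZ] unfolding a_def \<tau>_def .
  moreover have "(norm (G (\<beta> ?y) ?y))\<^sup>2 = energy (Pst ?y) (Zst ?y) \<tau>"
    using coef_energy[OF stratum_star[OF neary], of ?y] Zst_subset[of ?y]
    unfolding G_beta_eq_coef[OF neary] \<tau>eq by (auto simp: Izero_def)
  ultimately have "energy (Pst ?y) (Zst ?y) \<tau> < energy ?P ?Z \<tau>" by simp
  then have "\<forall>t\<in>{0<..<\<epsilon>}. energy (Pst ?y) (Zst ?y) t < energy ?P ?Z t"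
    using adm st stratum_star[OF neary] \<tau> unfolding admissible_def by blast
  then show ?thesis using closey by blast
qed simp

end

section \<open>Spheres inside affine subspaces\<close>

lemma sphere_with_reflect:
  assumes "sphere_with S c r" "s \<in> S"
  shows "2 *\<^sub>R c - s \<in> S" "norm (s - c) = r" "r > 0"
proof -
  obtain A where A: "affine A" "c \<in> A" "0 < r" "S = A \<inter> sphere c r"
    using assms(1) by (auto simp: sphere_with_def)
  have "2 *\<^sub>R c + (-1) *\<^sub>R s \<in> A"
    using A(1)[unfolded affine_def, rule_format, of c s 2 "-1"] A(2,4) assms(2) by simp
  moreover have "dist c (2 *\<^sub>R c - s) = dist c s"
    by (simp add: dist_norm scaleR_2 norm_minus_commute)
  ultimately show "2 *\<^sub>R c - s \<in> S" using A assms(2) by simp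
  show "norm (s - c) = r" using A assms(2) by (simp add: dist_norm norm_minus_commute)
  show "r > 0" by (fact A)
qed

text \<open>Composing the point reflections in two centres gives a translation, and a bounded set is not
  invariant under a nonzero translation.\<close>

lemma sphere_with_unique:
  assumes "sphere_with S c r" "sphere_with S c' r'" "s \<in> S"
  shows "c' = c" "r' = r"
proof -
  define d where "d = 2 *\<^sub>R (c' - c)"
  have "s + real k *\<^sub>R d \<in> S" for k
  proof (induction k)
    case (Suc k)
    have "2 *\<^sub>R c' - (2 *\<^sub>R c - (s + real k *\<^sub>R d)) \<in> S"
      using Suc sphere_with_reflect(1)[OF assms(1)] sphere_with_reflect(1)[OF assms(2)] by blast
    then show ?case by (simp add: d_def algebra_simps)
  qed (use assms in auto)
  then have b: "norm (s + real k *\<^sub>R d - c) = r" for k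
    using sphere_with_reflect(2)[OF assms(1)] by blast
  have "real k * norm d \<le> 2 * r" for k
  proof -
    have "norm (real k *\<^sub>R d) \<le> norm (s + real k *\<^sub>R d - c) + norm (s - c)"
      using norm_triangle_ineq4[of "s + real k *\<^sub>R d - c" "s - c"] by (simp add: algebra_simps)
    then show ?thesis using b[of k] b[of 0] by simp
  qed
  then have "norm d \<le> 0"
    by (metis reals_Archimedean3 linorder_not_le norm_ge_zero order_less_le)
  then show c: "c' = c" by (simp add: d_def)
  show "r' = r" using sphere_with_reflect(2)[OF assms(1,3)] sphere_with_reflect(2)[OF assms(2,3)] c by simp
qed

text \<open>Central projection to the sphere of radius \<open>r\<close> removes the radial component
  of the velocity and rescales the tangential one.\<close>

lemma has_vector_derivative_normalize:
  fixes g :: "real \<Rightarrow> 'a::euclidean_space"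
  assumes "(g has_vector_derivative g') (at t)" "g t \<noteq> 0"
  shows "((\<lambda>s. (r / norm (g s)) *\<^sub>R g s) has_vector_derivative
    (r / norm (g t)) *\<^sub>R (g' - ((g t \<bullet> g') / (norm (g t))\<^sup>2) *\<^sub>R g t)) (at t)"
proof -
  have "(norm has_derivative (\<lambda>h. h \<bullet> sgn (g t))) (at (g t))"
    using has_derivative_norm[OF assms(2)] by simp
  then have "(norm \<circ> g has_derivative (\<lambda>h. h \<bullet> sgn (g t)) \<circ> (\<lambda>s. s *\<^sub>R g')) (at t)"
    using assms(1) unfolding has_vector_derivative_def by (rule diff_chain_at[rotated])
  moreover have "(\<lambda>h. h \<bullet> sgn (g t)) \<circ> (\<lambda>s. s *\<^sub>R g') = (*) ((g t \<bullet> g') / norm (g t))"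
    by (auto simp: fun_eq_iff sgn_div_norm inner_commute divide_inverse)
  ultimately have "(norm \<circ> g has_derivative (*) ((g t \<bullet> g') / norm (g t))) (at t)"
    by (simp only:)
  then have n: "((\<lambda>s. norm (g s)) has_real_derivative ((g t \<bullet> g') / norm (g t))) (at t)"
    unfolding has_field_derivative_def o_def .
  have "((\<lambda>s. r / norm (g s)) has_real_derivative - (r * ((g t \<bullet> g') / norm (g t)) / (norm (g t))\<^sup>2)) (at t)"
    using assms(2) by (auto intro!: derivative_eq_intros n simp: power2_eq_square)
  from has_vector_derivative_scaleR[OF this assms(1)]
  have "((\<lambda>s. (r / norm (g s)) *\<^sub>R g s) has_vector_derivative (r / norm (g t)) *\<^sub>R g' +
      (- (r * ((g t \<bullet> g') / norm (g t)) / (norm (g t))\<^sup>2)) *\<^sub>R g t) (at t)" .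
  then show ?thesis by (simp add: scaleR_diff_right power2_eq_square mult.commute)
qed

context spherical_clusters_min
begin

subsection \<open>Full-dimensional strata\<close>

lemma sum_gr_eq: "finite P \<Longrightarrow> P \<noteq> {} \<Longrightarrow>
    (\<Sum>i\<in>P. gr i z) = (2 * \<kappa> * card P) *\<^sub>R (z - center_set n \<eta> p P)"
  by (simp add: gr_def center_set_def sum_subtractf scaleR_diff_right sum_constant_scaleR flip: scaleR_sum_right)

lemma vel_full: "stratum P {} \<Longrightarrow> vel P {} z = (\<Sum>i\<in>P. gr i z)"
  by (simp add: vel_stratum_sum)

lemma stratum_nonempty: "stratum P Z \<Longrightarrow> P \<noteq> {} \<and> finite P"
  using pos_nonempty[of xs] stratum_index[of P Z] finite_subset[of P "{1..n}"]
  by (auto simp: stratum_def)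

text \<open>With \<open>Z\<close> empty the coefficients do not depend on \<tau>, so the slope grows
  at rate 1. Hence a path in a full-dimensional stratum always enters its cell.\<close>

lemma slope_full_nonzero:
  assumes "stratum P {}" shows "\<not> (\<forall>\<tau>. slope P {} j \<tau> = 0)"
proof
  assume *: "\<forall>\<tau>. slope P {} j \<tau> = 0"
  have "coef P {} 1 = coef P {} 0"
    using coef_props(1,2)[OF assms] by (metis emptyE ext)
  then have "slope P {} j 1 = slope P {} j 0 + 1" by (simp add: slope_def)
  then show False using * by simp
qed

lemma half_line_trajectory:
  assumes "stratum P {}"
  defines "T \<equiv> 1 / (2 * \<kappa> * card P)"
  shows "trajectory P {} (half_line n \<eta> p x P) T" "half_line n \<eta> p x P 0 = x"
    "half_line n \<eta> p x P T = center_set n \<eta> p P"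
proof -
  define m where "m = 2 * \<kappa> * card P"
  have P: "finite P" "P \<noteq> {}" using stratum_nonempty[OF assms(1)] by auto
  have m: "m > 0" using P kappa_pos by (simp add: m_def card_gt_0_iff)
  have T: "T = 1 / m" by (simp add: T_def m_def)
  let ?c = "center_set n \<eta> p P"
  have \<gamma>: "half_line n \<eta> p x P = (\<lambda>t. x - (t * m) *\<^sub>R (x - ?c))"
    by (simp add: half_line_def gradient_f_set sum_gr_eq[OF P] m_def mult.commute fun_eq_iff)
  have vel: "vel P {} z = m *\<^sub>R (z - ?c)" for z
    by (simp add: vel_full[OF assms(1)] sum_gr_eq[OF P] m_def)
  show "half_line n \<eta> p x P 0 = x" "half_line n \<eta> p x P T = center_set n \<eta> p P"
    using m by (simp_all add: \<gamma> T)
  have lt: "1 - t * m > 0" if "t \<in> {0..<T}" for t using that m by (simp add: T field_simps)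
  show "trajectory P {} (half_line n \<eta> p x P) T"
    unfolding trajectory_def
  proof (intro conjI)
    show "0 < T" using m by (simp add: T)
    show "continuous_on {0..T} (half_line n \<eta> p x P)" unfolding \<gamma> by (intro continuous_intros)
    show "vel P {} (half_line n \<eta> p x P T) = 0" using m by (simp add: vel \<gamma> T)
    show "\<exists>\<sigma>. continuous_on {0..<T} \<sigma> \<and> (\<forall>t\<in>{0..<T}. 0 < \<sigma> t \<and> (half_line n \<eta> p x P has_vector_derivative
        - (\<sigma> t *\<^sub>R vel P {} (half_line n \<eta> p x P t))) (at t))"
    \<comment> \<open>The half-line keeps its initial velocity, whereas the gradient shrinks by the
      factor \<open>1 - t * m\<close> on the way to the center.\<close>
    proof (intro exI[of _ "\<lambda>t. 1 / (1 - t * m)"] conjI ballI)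
      show "continuous_on {0..<T} (\<lambda>t. 1 / (1 - t * m))"
        using lt by (intro continuous_intros) (metis less_irrefl)
      fix t assume t: "t \<in> {0..<T}"
      show "0 < 1 / (1 - t * m)" using lt[OF t] by simp
      have "(1 / (1 - t * m)) *\<^sub>R vel P {} (half_line n \<eta> p x P t)
          = (1 / (1 - t * m)) *\<^sub>R m *\<^sub>R ((1 - t * m) *\<^sub>R (x - ?c))"
        by (simp add: vel \<gamma> algebra_simps)
      also have "\<dots> = m *\<^sub>R (x - ?c)" using lt[OF t] by simp
      finally have e: "(1 / (1 - t * m)) *\<^sub>R vel P {} (half_line n \<eta> p x P t) = m *\<^sub>R (x - ?c)" .
      show "(half_line n \<eta> p x P has_vector_derivative
        - ((1 / (1 - t * m)) *\<^sub>R vel P {} (half_line n \<eta> p x P t))) (at t)"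
        unfolding e unfolding \<gamma> by (auto intro!: derivative_eq_intros)
    qed
  qed simp
qed

definition progress :: "real \<Rightarrow> 'a \<Rightarrow> 'a \<Rightarrow> bool" where
  "progress \<epsilon> x y \<longleftrightarrow> y = xs \<or> close \<epsilon> y \<and> (\<forall>\<tau>\<in>{0<..<\<epsilon>}.
    energy (Pst y) (Zst y) \<tau> < energy (Pst x) (Zst x) \<tau>)"

lemma full_stratum_step:
  assumes adm: "admissible \<epsilon>" and close: "close \<epsilon> x" "x \<noteq> xs" and Z: "Zst x = {}"
  defines "c \<equiv> center_set n \<eta> p (Pst x)" and "\<gamma> \<equiv> half_line n \<eta> p x (Pst x)"
  shows "c \<in> cell_star n \<eta> p x \<Longrightarrow> c = xs"
    and "c \<notin> cell_star n \<eta> p x \<Longrightarrow> \<exists>y. first_exit \<gamma> {0<..} (cell_star n \<eta> p x) y"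
    and "c \<notin> cell_star n \<eta> p x \<Longrightarrow> first_exit \<gamma> {0<..} (cell_star n \<eta> p x) y \<Longrightarrow> progress \<epsilon> x y"
proof -
  note st = stratum_star[OF closeD(1)[OF close], unfolded Z]
  define T where "T = 1 / (2 * \<kappa> * card (Pst x))"
  note tr = half_line_trajectory[OF st, of x, folded T_def \<gamma>_def c_def]
  have tr1: "trajectory (Pst x) (Zst x) \<gamma> T" using tr(1) Z by simp
  show "c \<in> cell_star n \<eta> p x \<Longrightarrow> c = xs"
    using trajectory_end[OF adm close tr1 tr(2)] tr(3) by simp
  assume c: "c \<notin> cell_star n \<eta> p x"
  have "\<forall>\<^sub>F t in at_right 0. \<gamma> t \<in> cell_star n \<eta> p x"
    using trajectory_start[OF adm close tr1 tr(2)] slope_full_nonzero[OF st] Z by auto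
  from trajectory_first_exit[OF tr1 this] c tr(3)
  show "\<exists>y. first_exit \<gamma> {0<..} (cell_star n \<eta> p x) y"
    unfolding first_exit_def by auto
  assume "first_exit \<gamma> {0<..} (cell_star n \<eta> p x) y"
  then obtain t where t: "0 < t" "y = \<gamma> t" "\<gamma> t \<notin> cell_star n \<eta> p x"
     "\<forall>s. 0 < s \<and> s < t \<longrightarrow> \<gamma> s \<in> cell_star n \<eta> p x" by (auto simp: first_exit_def)
  have "0 < T" using tr(1) by (simp add: trajectory_def)
  \<comment> \<open>The half-line is unbounded, but at \<open>T\<close> it is at the center, which
    lies outside the cell.\<close>
  then have "t \<le> T" using t(4) c tr(3) by force
  then show "progress \<epsilon> x y"
    using trajectory_exit[OF adm close tr1 tr(2) t(1) _ t(3,4)] t(2) unfolding progress_def by simp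
qed

subsection \<open>Strata inside spheres\<close>

text \<open>For a negative \<open>radius_sq\<close> both the equation of the sphere and
  \<open>q i z = 0\<close> are unsatisfiable.\<close>

lemma mem_Sph_set: "Z \<subseteq> {1..n} \<Longrightarrow> z \<in> Sph_set n \<eta> p Z \<longleftrightarrow> (\<forall>i\<in>Z. q i z = 0)"
proof -
  have "z \<in> Sph n \<eta> p i \<longleftrightarrow> q i z = 0" for i
  proof -
    have "norm (z - ctr i) = sqrt (radius_sq n \<eta> p i) \<longleftrightarrow> (norm (z - ctr i))\<^sup>2 = radius_sq n \<eta> p i"
      by (metis norm_ge_zero real_sqrt_ge_0_iff real_sqrt_pow2 real_sqrt_unique)
    then show ?thesis using kappa_pos by (simp add: Sph_def q_eq)
  qed
  then show ?thesis by (simp add: Sph_set_def)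
qed

text \<open>\<open>W\<close> is the direction space of the affine hull of the centers and
  \<open>c\<close> the foot of the perpendicular from \<open>x\<close> to this hull. Subtracting two
  sphere equations gives orthogonality to the differences of centers. If \<open>x\<close> were equal
  to \<open>c\<close>, it would be an affine combination of the centers, contrary to
  transversality.\<close>

lemma sphere_structure:
  assumes "Z \<subseteq> zer x" "Z \<noteq> {}"
  obtains W c where "subspace W" "\<And>w. w \<in> W \<Longrightarrow> (x - c) \<bullet> w = 0" "x \<noteq> c"
    "\<And>i. i \<in> Z \<Longrightarrow> c - ctr i \<in> W"
    "\<forall>u. (\<forall>i\<in>Z. \<forall>l\<in>Z. u \<bullet> (ctr i - ctr l) = 0) \<longrightarrow> (\<forall>w\<in>W. u \<bullet> w = 0)"
    "Sph_set n \<eta> p Z = {z. (\<forall>w\<in>W. (z - c) \<bullet> w = 0) \<and> norm (z - c) = norm (x - c)}"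
proof -
  have Zn: "Z \<subseteq> {1..n}" and zx: "\<And>i. i \<in> Z \<Longrightarrow> q i x = 0" using assms(1) by (auto simp: Izero_def)
  then have finZ: "finite Z" using finite_subset by blast
  obtain i0 where i0: "i0 \<in> Z" using assms(2) by blast
  define D where "D = (\<lambda>i. ctr i - ctr i0) ` Z"
  define W where "W = span D"
  obtain s X where sX: "s \<in> W" "\<And>w. w \<in> W \<Longrightarrow> orthogonal X w" "x - ctr i0 = s + X"
    using orthogonal_subspace_decomp_exists[of D "x - ctr i0"] unfolding W_def by metis
  define c where "c = x - X"
  have W: "subspace W" by (simp add: W_def)
  have X: "x - c = X" by (simp add: c_def)
  have cW: "c - ctr i \<in> W" if "i \<in> Z" for i
  proof -
    have "c - ctr i = s - (ctr i - ctr i0)" using sX(3) by (simp add: c_def algebra_simps)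
    moreover have "ctr i - ctr i0 \<in> W" using that by (auto simp: W_def D_def intro: span_base)
    ultimately show ?thesis using W sX(1) subspace_diff by metis
  qed
  have perp: "u \<bullet> w = 0" if "\<And>i l. i \<in> Z \<Longrightarrow> l \<in> Z \<Longrightarrow> u \<bullet> (ctr i - ctr l) = 0" "w \<in> W" for u w
  proof -
    have "orthogonal u w"
      by (rule orthogonal_to_span[of w D]) (use that i0 in \<open>auto simp: W_def D_def orthogonal_def\<close>)
    then show ?thesis by (simp add: orthogonal_def)
  qed
  have "X \<noteq> 0"
  proof
    assume "X = 0"
    then have "x - ctr i0 \<in> W" using sX by simp
    \<comment> \<open>The span is written over indices rather than vectors, to match the indexed
      family of gradients.\<close>
    moreover have "W \<subseteq> {\<Sum>i\<in>Z. k i *\<^sub>R (ctr i - ctr i0) | k. True}"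
      unfolding W_def
    proof (rule span_minimal)
      show "D \<subseteq> {\<Sum>i\<in>Z. k i *\<^sub>R (ctr i - ctr i0) | k. True}"
      proof
        fix v assume "v \<in> D"
        then obtain l where l: "l \<in> Z" "v = ctr l - ctr i0" by (auto simp: D_def)
        then have "v = (\<Sum>i\<in>Z. (if i = l then 1 else 0) *\<^sub>R (ctr i - ctr i0))"
          using finZ by (simp add: if_distrib[of "\<lambda>t. t *\<^sub>R _"] sum.delta cong: if_cong)
        then show "v \<in> {\<Sum>i\<in>Z. k i *\<^sub>R (ctr i - ctr i0) | k. True}"
          by (intro CollectI exI[of _ "\<lambda>i. if i = l then 1 else 0"] conjI TrueI)
      qed
      show "subspace {\<Sum>i\<in>Z. k i *\<^sub>R (ctr i - ctr i0) | k. True}"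
        unfolding subspace_def
      proof (intro conjI ballI allI)
        show "0 \<in> {\<Sum>i\<in>Z. k i *\<^sub>R (ctr i - ctr i0) | k. True}"
          by (auto intro!: exI[of _ "\<lambda>_. 0"])
      next
        fix u v assume "u \<in> {\<Sum>i\<in>Z. k i *\<^sub>R (ctr i - ctr i0) | k. True}"
          "v \<in> {\<Sum>i\<in>Z. k i *\<^sub>R (ctr i - ctr i0) | k. True}"
        then obtain k l where "u = (\<Sum>i\<in>Z. k i *\<^sub>R (ctr i - ctr i0))" "v = (\<Sum>i\<in>Z. l i *\<^sub>R (ctr i - ctr i0))"
          by blast
        then have "u + v = (\<Sum>i\<in>Z. (k i + l i) *\<^sub>R (ctr i - ctr i0))"
          by (simp add: scaleR_add_left sum.distrib)
        then show "u + v \<in> {\<Sum>i\<in>Z. k i *\<^sub>R (ctr i - ctr i0) | k. True}"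
          by (intro CollectI exI[of _ "\<lambda>i. k i + l i"] conjI TrueI)
      next
        fix a u assume "u \<in> {\<Sum>i\<in>Z. k i *\<^sub>R (ctr i - ctr i0) | k. True}"
        then obtain k where "u = (\<Sum>i\<in>Z. k i *\<^sub>R (ctr i - ctr i0))" by blast
        then have "a *\<^sub>R u = (\<Sum>i\<in>Z. (a * k i) *\<^sub>R (ctr i - ctr i0))"
          by (simp add: scaleR_sum_right)
        then show "a *\<^sub>R u \<in> {\<Sum>i\<in>Z. k i *\<^sub>R (ctr i - ctr i0) | k. True}"
          by (intro CollectI exI[of _ "\<lambda>i. a * k i"] conjI TrueI)
      qed
    qed
    ultimately obtain k where k: "x - ctr i0 = (\<Sum>i\<in>Z. k i *\<^sub>R (ctr i - ctr i0))" by blast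
    define S where "S = (\<Sum>i\<in>Z. k i)"
    \<comment> \<open>a linear relation between the vectors \<open>x - ctr i\<close> whose coefficients have sum 1\<close>
    define l where "l i = k i + (if i = i0 then 1 - S else 0)" for i
    have "(\<Sum>i\<in>Z. l i *\<^sub>R (x - ctr i)) = (\<Sum>i\<in>Z. k i *\<^sub>R (x - ctr i)) + (1 - S) *\<^sub>R (x - ctr i0)"
      using finZ i0 by (simp add: l_def scaleR_add_left sum.distrib if_distrib[of "\<lambda>t. t *\<^sub>R _"] sum.delta cong: if_cong)
    also have "(\<Sum>i\<in>Z. k i *\<^sub>R (x - ctr i)) = S *\<^sub>R (x - ctr i0) - (\<Sum>i\<in>Z. k i *\<^sub>R (ctr i - ctr i0))"
      by (simp add: S_def scaleR_sum_left scaleR_diff_right sum_subtractf)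
    finally have "(\<Sum>i\<in>Z. l i *\<^sub>R (x - ctr i)) = 0"
      unfolding k[symmetric] by (simp add: algebra_simps)
    moreover have "(\<Sum>i\<in>Z. l i *\<^sub>R gr i x) = (2 * \<kappa>) *\<^sub>R (\<Sum>i\<in>Z. l i *\<^sub>R (x - ctr i))"
      by (simp add: gr_def scaleR_sum_right mult.commute)
    ultimately have "(\<Sum>i\<in>Z. l i *\<^sub>R gr i x) = 0" by simp
    moreover have "finite (zer x)" by (simp add: Izero_def)
    ultimately have "(\<Sum>i\<in>zer x. (if i \<in> Z then l i else 0) *\<^sub>R gr i x) = 0"
      by (subst sum.mono_neutral_right[OF _ assms(1)]) (auto cong: sum.cong)
    then have "\<And>i. i \<in> zer x \<Longrightarrow> (if i \<in> Z then l i else 0) = 0" by (rule independent_gr)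
    then have "l i = 0" if "i \<in> Z" for i using that assms(1) by fastforce
    then have "(\<Sum>i\<in>Z. l i) = 0" by simp
    moreover have "(\<Sum>i\<in>Z. l i) = 1" using finZ i0 by (simp add: l_def sum.distrib S_def)
    ultimately show False by simp
  qed
  have XW: "X \<bullet> w = 0" if "w \<in> W" for w using sX(2)[OF that] by (simp add: orthogonal_def)
  have exp: "q i z = \<kappa> * ((norm (z - c))\<^sup>2 + 2 * ((z - c) \<bullet> (c - ctr i)) - (norm X)\<^sup>2)" if "i \<in> Z" for i z
  proof -
    have "q i z = q i z - q i x" using zx[OF that] by simp
    also have "\<dots> = \<kappa> * ((norm ((z - c) + (c - ctr i)))\<^sup>2 - (norm (X + (c - ctr i)))\<^sup>2)"
      unfolding q_eq by (simp add: c_def algebra_simps)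
    also have "\<dots> = \<kappa> * ((norm (z - c))\<^sup>2 + 2 * ((z - c) \<bullet> (c - ctr i)) - (norm X)\<^sup>2)"
      using XW[OF cW[OF that]]
      unfolding power2_norm_eq_inner inner_add_left inner_add_right by (simp add: inner_commute)
    finally show ?thesis .
  qed
  have "Sph_set n \<eta> p Z = {z. (\<forall>w\<in>W. (z - c) \<bullet> w = 0) \<and> norm (z - c) = norm (x - c)}"
  proof (intro set_eqI iffI)
    fix z assume "z \<in> Sph_set n \<eta> p Z"
    then have z: "(norm (z - c))\<^sup>2 + 2 * ((z - c) \<bullet> (c - ctr i)) = (norm X)\<^sup>2" if "i \<in> Z" for i
      using mem_Sph_set[OF Zn] exp[OF that, of z] kappa_pos that by auto
    have p: "(z - c) \<bullet> w = 0" if "w \<in> W" for w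
    proof (rule perp[OF _ that])
      fix i l assume il: "i \<in> Z" "l \<in> Z"
      have "(z - c) \<bullet> (c - ctr i) = (z - c) \<bullet> (c - ctr l)" using z[OF il(1)] z[OF il(2)] by linarith
      then show "(z - c) \<bullet> (ctr i - ctr l) = 0" by (simp add: inner_diff_right)
    qed
    then have "(norm (z - c))\<^sup>2 = (norm X)\<^sup>2" using z[OF i0] cW[OF i0] by simp
    then show "z \<in> {z. (\<forall>w\<in>W. (z - c) \<bullet> w = 0) \<and> norm (z - c) = norm (x - c)}"
      using p X by simp
  next
    fix z assume "z \<in> {z. (\<forall>w\<in>W. (z - c) \<bullet> w = 0) \<and> norm (z - c) = norm (x - c)}"
    then show "z \<in> Sph_set n \<eta> p Z" using mem_Sph_set[OF Zn] exp cW X by simp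
  qed
  moreover have "x \<noteq> c" using \<open>X \<noteq> 0\<close> X by auto
  moreover have "\<forall>u. (\<forall>i\<in>Z. \<forall>l\<in>Z. u \<bullet> (ctr i - ctr l) = 0) \<longrightarrow> (\<forall>w\<in>W. u \<bullet> w = 0)"
    using perp by blast
  ultimately show ?thesis using that[of W c] W XW X cW by simp
qed

lemma f_set_expand:
  assumes "finite P"
  shows "f_set n \<eta> p P z = f_set n \<eta> p P c + (\<Sum>i\<in>P. gr i c) \<bullet> (z - c) + \<kappa> * card P * (norm (z - c))\<^sup>2"
proof -
  have "f_set n \<eta> p P z = (\<Sum>i\<in>P. q i c + gr i c \<bullet> (z - c) + \<kappa> * (norm (z - c))\<^sup>2)"
    unfolding f_set_def by (intro sum.cong refl q_expand)
  then show ?thesis by (simp add: f_set_def sum.distrib inner_sum_left)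
qed

text \<open>The vector \<open>b\<close> is the component orthogonal to \<open>W\<close> of the
  gradient at \<open>c\<close>. The field differs from \<open>b\<close> by a multiple of
  \<open>z - c\<close> and a vector of \<open>W\<close>; being orthogonal to \<open>W\<close> and to
  \<open>z - c\<close>, it is the tangential part of \<open>b\<close> at \<open>z\<close>.\<close>

lemma vel_on_sphere:
  assumes st: "stratum P Z" "Z \<noteq> {}" and W: "subspace W" "\<And>i. i \<in> Z \<Longrightarrow> c - ctr i \<in> W"
    and perp: "\<forall>u. (\<forall>i\<in>Z. \<forall>l\<in>Z. u \<bullet> (ctr i - ctr l) = 0) \<longrightarrow> (\<forall>w\<in>W. u \<bullet> w = 0)"
    and S: "Sph_set n \<eta> p Z = {z. (\<forall>w\<in>W. (z - c) \<bullet> w = 0) \<and> norm (z - c) = r}" and r: "r > 0"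
    and b: "(\<Sum>i\<in>P. gr i c) = b + b'" "b' \<in> W" "\<And>w. w \<in> W \<Longrightarrow> b \<bullet> w = 0"
    and z: "z \<in> Sph_set n \<eta> p Z"
  shows "vel P Z z = b - ((b \<bullet> (z - c)) / r\<^sup>2) *\<^sub>R (z - c)"
proof -
  define e where "e = z - c"
  define v where "v = vel P Z z"
  define a where "a = coef P Z (excess P z)"
  define \<mu> where "\<mu> = 2 * \<kappa> * card P + 2 * \<kappa> * (\<Sum>i\<in>Z. a i)"
  have Zn: "Z \<subseteq> {1..n}" using stratum_index[OF st(1)] by simp
  have q0: "q i z = 0" if "i \<in> Z" for i using z mem_Sph_set[OF Zn] that by simp
  have eW: "e \<bullet> w = 0" if "w \<in> W" for w using z that by (simp add: S e_def)
  have er: "e \<bullet> e = r\<^sup>2" using z by (simp add: S e_def flip: power2_norm_eq_inner)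
  have v0: "v \<bullet> gr i z = 0" if "i \<in> Z" for i
    using coef_orthogonal[OF st(1) q0 that] by (simp add: v_def vel_def)
  have gri: "gr i z = (2 * \<kappa>) *\<^sub>R e + (2 * \<kappa>) *\<^sub>R (c - ctr i)" for i
    by (simp add: gr_def e_def algebra_simps)
  have vW: "v \<bullet> w = 0" if "w \<in> W" for w
  proof (rule perp[rule_format, OF _ that])
    fix i l assume "i \<in> Z" "l \<in> Z"
    then have "v \<bullet> (gr l z - gr i z) = 0" using v0 by (simp add: inner_diff_right)
    moreover have "gr l z - gr i z = (2 * \<kappa>) *\<^sub>R (ctr i - ctr l)" by (simp add: gr_def algebra_simps)
    ultimately show "v \<bullet> (ctr i - ctr l) = 0" using kappa_pos by simp
  qed
  obtain i0 where i0: "i0 \<in> Z" using st(2) by blast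
  have ve: "v \<bullet> e = 0"
    using v0[OF i0] vW[OF W(2)[OF i0]] kappa_pos unfolding gri by (simp add: inner_add_right)
  have "(\<Sum>i\<in>P. gr i z) = (\<Sum>i\<in>P. gr i c + (2 * \<kappa>) *\<^sub>R e)"
    by (intro sum.cong refl) (simp add: gr_def e_def algebra_simps)
  also have "\<dots> = b + b' + (2 * \<kappa> * card P) *\<^sub>R e"
    by (simp add: sum.distrib b(1) sum_constant_scaleR mult.commute)
  finally have gP: "(\<Sum>i\<in>P. gr i z) = b + b' + (2 * \<kappa> * card P) *\<^sub>R e" .
  have "(\<Sum>i\<in>Z. a i *\<^sub>R gr i z) = (\<Sum>i\<in>Z. (2 * \<kappa> * a i) *\<^sub>R e + (2 * \<kappa> * a i) *\<^sub>R (c - ctr i))"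
    by (intro sum.cong refl) (simp add: gri scaleR_add_right mult.commute)
  also have "\<dots> = (2 * \<kappa> * (\<Sum>i\<in>Z. a i)) *\<^sub>R e + (\<Sum>i\<in>Z. (2 * \<kappa> * a i) *\<^sub>R (c - ctr i))"
    by (simp add: sum.distrib scaleR_sum_left sum_distrib_left)
  finally have aZ: "(\<Sum>i\<in>Z. a i *\<^sub>R gr i z) =
    (2 * \<kappa> * (\<Sum>i\<in>Z. a i)) *\<^sub>R e + (\<Sum>i\<in>Z. (2 * \<kappa> * a i) *\<^sub>R (c - ctr i))" .
  define w where "w = b' + (\<Sum>i\<in>Z. (2 * \<kappa> * a i) *\<^sub>R (c - ctr i))"
  have v: "v = b + \<mu> *\<^sub>R e + w"
    unfolding v_def vel_stratum_sum[OF st(1)] gP a_def[symmetric] aZ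
    by (simp add: \<mu>_def w_def scaleR_add_left)
  have w: "w \<in> W"
    unfolding w_def using W b(2) by (intro subspace_add subspace_sum subspace_mul) auto
  have "w \<bullet> w = (v - b - \<mu> *\<^sub>R e) \<bullet> w" using v by simp
  also have "\<dots> = 0" using vW[OF w] b(3)[OF w] eW[OF w] by (simp add: inner_diff_left)
  finally have "w = 0" by simp
  then have v': "v = b + \<mu> *\<^sub>R e" using v by simp
  then have "\<mu> = - (b \<bullet> e) / r\<^sup>2" using ve er r by (simp add: inner_add_left field_simps)
  then show ?thesis using v' unfolding v_def e_def by simp
qed

definition chord_arc :: "'a \<Rightarrow> real \<Rightarrow> 'a \<Rightarrow> 'a \<Rightarrow> real \<Rightarrow> 'a" where
  "chord_arc c r x y = (\<lambda>t. c + (r / norm ((1 - t) *\<^sub>R x + t *\<^sub>R y - c)) *\<^sub>R ((1 - t) *\<^sub>R x + t *\<^sub>R y - c))"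

text \<open>On the sphere the quadratic term of \<open>f_set P\<close> is constant, so the function
  is affine with gradient \<open>b\<close> and has its unique minimum at \<open>y\<close> in
  direction \<open>- b\<close>. The point antipodal to \<open>y\<close> is the maximum, where the
  field vanishes, so \<open>x\<close> is not that point.\<close>

lemma sphere_stratum:
  assumes st: "stratum P Z" and Z: "Z \<noteq> {}" "Z \<subseteq> zer x" and v0: "vel P Z x \<noteq> 0"
  obtains c r y where "sphere_with (Sph_set n \<eta> p Z) c r" "y - c \<noteq> - (x - c)"
    "\<And>z. is_arg_min (f_set n \<eta> p P) (\<lambda>z. z \<in> Sph_set n \<eta> p Z) z \<longleftrightarrow> z = y"
    "trajectory P Z (chord_arc c r x y) 1" "chord_arc c r x y 0 = x" "chord_arc c r x y 1 = y"
proof -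
  have Zn: "Z \<subseteq> {1..n}" and P: "finite P" using stratum_index[OF st] stratum_nonempty[OF st] by auto
  obtain W c where W: "subspace W" and XW: "\<And>w. w \<in> W \<Longrightarrow> (x - c) \<bullet> w = 0" and xc: "x \<noteq> c"
    and cW: "\<And>i. i \<in> Z \<Longrightarrow> c - ctr i \<in> W"
    and perp: "\<forall>u. (\<forall>i\<in>Z. \<forall>l\<in>Z. u \<bullet> (ctr i - ctr l) = 0) \<longrightarrow> (\<forall>w\<in>W. u \<bullet> w = 0)"
    and S: "Sph_set n \<eta> p Z = {z. (\<forall>w\<in>W. (z - c) \<bullet> w = 0) \<and> norm (z - c) = norm (x - c)}"
    by (rule sphere_structure[OF Z(2,1)], rule that)
  define r where "r = norm (x - c)"
  have r: "r > 0" using xc by (simp add: r_def)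
  let ?S = "Sph_set n \<eta> p Z"
  note S' = S[folded r_def]
  obtain b' b where "b' \<in> span W" "\<And>w. w \<in> span W \<Longrightarrow> orthogonal b w" "(\<Sum>i\<in>P. gr i c) = b' + b"
    using orthogonal_subspace_decomp_exists[of W "\<Sum>i\<in>P. gr i c"] by metis
  then have b: "(\<Sum>i\<in>P. gr i c) = b + b'" "b' \<in> W" "\<And>w. w \<in> W \<Longrightarrow> b \<bullet> w = 0"
    using span_eq_iff[THEN iffD2, OF W] by (simp_all add: orthogonal_def add.commute)
  have vel: "vel P Z z = b - ((b \<bullet> (z - c)) / r\<^sup>2) *\<^sub>R (z - c)" if "z \<in> ?S" for z
    by (rule vel_on_sphere[OF st Z(1) W cW perp S' r b that])
  have xS: "x \<in> ?S" using XW by (simp add: S' r_def)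
  have b0: "b \<noteq> 0" using v0 vel[OF xS] by auto
  \<comment> \<open>Chosen so that \<open>b = - m *\<^sub>R Y\<close> with \<open>Y\<close> of
    length \<open>r\<close>.\<close>
  define m where "m = norm b / r"
  have m: "m > 0" using b0 r by (simp add: m_def)
  define Y where "Y = - (1 / m) *\<^sub>R b"
  define X where "X = x - c"
  define y where "y = c + Y"
  have bY: "b = - m *\<^sub>R Y" using m by (simp add: Y_def)
  have nY: "norm Y = r" using m r b0 by (simp add: Y_def m_def)
  have nX: "norm X = r" by (simp add: X_def r_def)
  have YW: "Y \<bullet> w = 0" if "w \<in> W" for w using b(3)[OF that] by (simp add: Y_def)
  have yS: "y \<in> ?S" using YW nY by (simp add: S' y_def)
  have YY: "Y \<bullet> Y = r\<^sup>2" using nY by (simp flip: power2_norm_eq_inner)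
  have vel': "vel P Z (c + e) = - m *\<^sub>R (Y - ((Y \<bullet> e) / r\<^sup>2) *\<^sub>R e)" if "c + e \<in> ?S" for e
    using vel[OF that] by (simp add: bY algebra_simps)
  have XY: "Y \<noteq> - X"
  proof
    assume "Y = - X"
    have "X \<bullet> X = r\<^sup>2" using nX by (simp flip: power2_norm_eq_inner)
    then have "Y - ((Y \<bullet> X) / r\<^sup>2) *\<^sub>R X = 0" using \<open>Y = - X\<close> r by simp
    moreover have "c + X \<in> ?S" using xS by (simp add: X_def)
    ultimately have "vel P Z (c + X) = 0" using vel'[of X] by simp
    then show False using v0 by (simp add: X_def)
  qed
  have sw: "sphere_with ?S c r"
    unfolding sphere_with_def
  proof (intro exI conjI)
    show "affine {z. \<forall>w\<in>W. (z - c) \<bullet> w = 0}"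
      unfolding affine_def
    proof (intro ballI allI impI CollectI)
      fix s t u v w assume *: "s \<in> {z. \<forall>w\<in>W. (z - c) \<bullet> w = 0}" "t \<in> {z. \<forall>w\<in>W. (z - c) \<bullet> w = 0}"
        "u + v = (1::real)" "w \<in> W"
      have "u *\<^sub>R (s - c) + v *\<^sub>R (t - c) = u *\<^sub>R s + v *\<^sub>R t - (u + v) *\<^sub>R c"
        by (simp add: algebra_simps)
      then have "u *\<^sub>R s + v *\<^sub>R t - c = u *\<^sub>R (s - c) + v *\<^sub>R (t - c)"
        unfolding *(3) by simp
      then show "(u *\<^sub>R s + v *\<^sub>R t - c) \<bullet> w = 0" using * by (simp add: inner_add_left)
    qed
    show "?S = {z. \<forall>w\<in>W. (z - c) \<bullet> w = 0} \<inter> sphere c r"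
      by (auto simp: S' dist_norm norm_minus_commute)
  qed (use r in auto)
  have fS: "f_set n \<eta> p P z = f_set n \<eta> p P c + \<kappa> * card P * r\<^sup>2 - m * (Y \<bullet> (z - c))" if "z \<in> ?S" for z
  proof -
    have "b' \<bullet> (z - c) = 0" using that b(2) by (auto simp: S' inner_commute)
    then show ?thesis
      using f_set_expand[OF P, of z c] that unfolding b(1) bY by (simp add: S' inner_add_left inner_diff_left)
  qed
  have CS: "Y \<bullet> (z - c) \<le> r\<^sup>2" if "z \<in> ?S" for z
    using norm_cauchy_schwarz[of Y "z - c"] nY that by (simp add: S' power2_eq_square)
  have argmin: "is_arg_min (f_set n \<eta> p P) (\<lambda>z. z \<in> ?S) z \<longleftrightarrow> z = y" for z
  proof
    assume "is_arg_min (f_set n \<eta> p P) (\<lambda>z. z \<in> ?S) z"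
    then have z: "z \<in> ?S" "f_set n \<eta> p P z \<le> f_set n \<eta> p P y"
      using yS by (auto simp: is_arg_min_linorder)
    have "m * (Y \<bullet> (z - c)) \<ge> m * r\<^sup>2" using z(2) unfolding fS[OF z(1)] fS[OF yS] by (simp add: y_def YY)
    then have "Y \<bullet> (z - c) = norm Y * norm (z - c)"
      using CS[OF z(1)] m z(1) nY by (simp add: S' power2_eq_square)
    then have "norm Y *\<^sub>R (z - c) = norm (z - c) *\<^sub>R Y" by (simp add: norm_cauchy_schwarz_eq)
    then have "z - c = Y" using nY r z(1) by (simp add: S')
    then show "z = y" by (simp add: y_def algebra_simps)
  next
    assume "z = y"
    have "f_set n \<eta> p P y \<le> f_set n \<eta> p P w" if "w \<in> ?S" for w
      unfolding fS[OF yS] fS[OF that] using CS[OF that] m by (simp add: y_def YY)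
    then show "is_arg_min (f_set n \<eta> p P) (\<lambda>z. z \<in> ?S) z"
      using yS \<open>z = y\<close> by (auto simp: is_arg_min_linorder)
  qed
  define g where "g t = (1 - t) *\<^sub>R X + t *\<^sub>R Y" for t :: real
  have arc: "chord_arc c r x y = (\<lambda>t. c + (r / norm (g t)) *\<^sub>R g t)"
  proof -
    have "(1 - t) *\<^sub>R x + t *\<^sub>R y - c = g t" for t by (simp add: g_def X_def y_def algebra_simps)
    then show ?thesis by (simp add: chord_arc_def)
  qed
  have g0: "g t \<noteq> 0" for t
  proof
    assume "g t = 0"
    then have e: "(1 - t) *\<^sub>R X = - (t *\<^sub>R Y)" by (simp add: g_def eq_neg_iff_add_eq_0)
    then have "\<bar>1 - t\<bar> * r = \<bar>t\<bar> * r" using nX nY by (metis norm_minus_cancel norm_scaleR)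
    then have "t = 1 / 2" using r by auto
    then have "(1 / 2) *\<^sub>R X = (1 / 2) *\<^sub>R (- Y)" using e unfolding \<open>t = 1 / 2\<close> by simp
    then have "X = - Y" by (simp only: scaleR_cancel_left) simp
    then show False using XY by simp
  qed
  have gW: "g t \<bullet> w = 0" if "w \<in> W" for t w
    using that XW[OF that] YW[OF that] by (simp add: g_def X_def inner_add_left)
  have arcS: "chord_arc c r x y t \<in> ?S" for t
    using gW g0[of t] r by (simp add: arc S')
  have gd: "(g has_vector_derivative (Y - X)) (at t)" for t
    unfolding g_def by (auto intro!: derivative_eq_intros)
  \<comment> \<open>Write \<open>Y\<close> as \<open>g t + (1 - t) *\<^sub>R (Y - X)\<close>: the
    first summand is radial, so the tangential part of \<open>Y\<close> is \<open>1 - t\<close>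
    times that of the chord direction, which is also the direction of the arc.\<close>
  have velarc: "vel P Z (chord_arc c r x y t)
    = - (m * (1 - t)) *\<^sub>R ((Y - X) - ((g t \<bullet> (Y - X)) / (norm (g t))\<^sup>2) *\<^sub>R g t)" for t
  proof -
    have N: "norm (g t) \<noteq> 0" using g0 by simp
    have gg: "g t \<bullet> g t = (norm (g t))\<^sup>2" by (simp add: power2_norm_eq_inner)
    have Yg: "Y = g t + (1 - t) *\<^sub>R (Y - X)" by (simp add: g_def algebra_simps)
    have "vel P Z (chord_arc c r x y t) = - m *\<^sub>R (Y - ((Y \<bullet> g t) / (norm (g t))\<^sup>2) *\<^sub>R g t)"
      using vel'[of "(r / norm (g t)) *\<^sub>R g t"] arcS[of t] r N
      by (simp add: arc power2_eq_square)
    also have "Y \<bullet> g t = (norm (g t))\<^sup>2 + (1 - t) * (g t \<bullet> (Y - X))"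
      by (subst Yg) (simp only: inner_add_left gg inner_scaleR_left inner_commute[of "Y - X"])
    also have "Y - (((norm (g t))\<^sup>2 + (1 - t) * (g t \<bullet> (Y - X))) / (norm (g t))\<^sup>2) *\<^sub>R g t
      = (1 - t) *\<^sub>R ((Y - X) - ((g t \<bullet> (Y - X)) / (norm (g t))\<^sup>2) *\<^sub>R g t)"
      by (subst Yg) (use N in \<open>simp add: add_divide_distrib scaleR_add_left scaleR_diff_right\<close>)
    finally show ?thesis by simp
  qed
  have "trajectory P Z (chord_arc c r x y) 1"
    unfolding trajectory_def
  proof (intro conjI)
    show "\<forall>t\<in>{0..1}. \<forall>i\<in>Z. q i (chord_arc c r x y t) = 0" using arcS mem_Sph_set[OF Zn] by blast
    have gc: "continuous_on A g" for A unfolding g_def by (intro continuous_intros)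
    show "continuous_on {0..1} (chord_arc c r x y)"
      unfolding arc using g0 by (intro continuous_intros gc) auto
    show "vel P Z (chord_arc c r x y 1) = 0" by (simp add: velarc)
    show "\<exists>\<sigma>. continuous_on {0..<1} \<sigma> \<and> (\<forall>t\<in>{0..<1}. 0 < \<sigma> t \<and> (chord_arc c r x y has_vector_derivative
        - (\<sigma> t *\<^sub>R vel P Z (chord_arc c r x y t))) (at t))"
    proof (intro exI[of _ "\<lambda>t. (r / norm (g t)) / (m * (1 - t))"] conjI ballI)
      show "continuous_on {0..<1} (\<lambda>t. (r / norm (g t)) / (m * (1 - t)))"
        using g0 m by (intro continuous_intros gc) auto
      fix t :: real assume t: "t \<in> {0..<1}"
      show "0 < (r / norm (g t)) / (m * (1 - t))" using t m r g0[of t] by simp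
      have "(chord_arc c r x y has_vector_derivative
          0 + (r / norm (g t)) *\<^sub>R ((Y - X) - ((g t \<bullet> (Y - X)) / (norm (g t))\<^sup>2) *\<^sub>R g t)) (at t)"
        unfolding arc
        by (intro has_vector_derivative_add has_vector_derivative_const
            has_vector_derivative_normalize gd g0)
      moreover have "- (((r / norm (g t)) / (m * (1 - t))) *\<^sub>R vel P Z (chord_arc c r x y t))
        = (r / norm (g t)) *\<^sub>R ((Y - X) - ((g t \<bullet> (Y - X)) / (norm (g t))\<^sup>2) *\<^sub>R g t)"
        unfolding velarc using t m by simp
      ultimately show "(chord_arc c r x y has_vector_derivative
        - (((r / norm (g t)) / (m * (1 - t))) *\<^sub>R vel P Z (chord_arc c r x y t))) (at t)" by simp
    qed
  qed simp
  moreover have "chord_arc c r x y 0 = x" using nX r by (simp add: arc g_def X_def)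
  moreover have "chord_arc c r x y 1 = y" unfolding arc using nY r by (simp add: g_def y_def)
  moreover have "y - c \<noteq> - (x - c)" using XY by (simp add: y_def X_def)
  ultimately show ?thesis using that sw argmin by blast
qed

text \<open>The target is unique and not antipodal, and the sphere determines its center and radius,
  so here the relation describing the algorithm has one target and one geodesic.\<close>

lemma sphere_step:
  assumes adm: "admissible \<epsilon>" and close: "close \<epsilon> x" "x \<noteq> xs" and Z: "Zst x \<noteq> {}"
  shows "\<exists>y \<gamma>. (\<forall>z. sphere_target n \<eta> p x z \<longleftrightarrow> z = y) \<and>
    (\<forall>g. sphere_geodesic (Sph_set n \<eta> p (Zst x)) x y g \<longleftrightarrow> g = \<gamma>) \<and>
    (y \<in> cell_star n \<eta> p x \<longrightarrow> y = xs) \<and>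
    (y \<notin> cell_star n \<eta> p x \<longrightarrow> (\<forall>\<^sub>F t in at_right 0. \<gamma> t \<notin> cell_star n \<eta> p x) \<or>
        (\<exists>z. first_exit \<gamma> {0<..1} (cell_star n \<eta> p x) z)) \<and>
    (\<forall>z. first_exit \<gamma> {0<..1} (cell_star n \<eta> p x) z \<longrightarrow> progress \<epsilon> x z)"
proof -
  let ?D = "cell_star n \<eta> p x" and ?S = "Sph_set n \<eta> p (Zst x)"
  note near = closeD(1)[OF close]
  note st = stratum_star[OF near]
  have "vel (Pst x) (Zst x) x \<noteq> 0"
    using stationary_eq_xs[OF beta_in_K, of x] close(2) G_beta_eq_coef[OF near] by (auto simp: vel_def)
  from sphere_stratum[OF st Z Zst_subset this]
  obtain c r y where sw: "sphere_with ?S c r" and anti: "y - c \<noteq> - (x - c)"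
    and argmin: "\<And>z. is_arg_min (f_set n \<eta> p (Pst x)) (\<lambda>z. z \<in> ?S) z \<longleftrightarrow> z = y"
    and tr: "trajectory (Pst x) (Zst x) (chord_arc c r x y) 1"
    and ends: "chord_arc c r x y 0 = x" "chord_arc c r x y 1 = y" by blast
  have Zn: "Zst x \<subseteq> {1..n}" using index_partition_star(6) .
  have xS: "x \<in> ?S" using mem_Sph_set[OF Zn] Zst_subset[of x] by (auto simp: Izero_def)
  have target: "sphere_target n \<eta> p x z \<longleftrightarrow> z = y" for z
    using argmin by (simp add: sphere_target_def)
  have geo: "sphere_geodesic ?S x y g \<longleftrightarrow> g = chord_arc c r x y" for g
  proof
    assume "sphere_geodesic ?S x y g"
    then obtain c' r' where g: "sphere_with ?S c' r'" "if y - c' = - (x - c')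
         then \<exists>w\<in>?S. (w - c') \<bullet> (x - c') = 0 \<and>
                g = (\<lambda>t. c' + cos (pi * t) *\<^sub>R (x - c') + sin (pi * t) *\<^sub>R (w - c'))
         else g = (\<lambda>t. c' + (r' / norm ((1 - t) *\<^sub>R x + t *\<^sub>R y - c')) *\<^sub>R
                          ((1 - t) *\<^sub>R x + t *\<^sub>R y - c'))"
      unfolding sphere_geodesic_def by blast
    have "c' = c" "r' = r" using sphere_with_unique[OF sw g(1) xS] by auto
    then show "g = chord_arc c r x y" using g(2) anti unfolding chord_arc_def by (simp only: if_False)
  next
    assume "g = chord_arc c r x y"
    then show "sphere_geodesic ?S x y g"
      unfolding sphere_geodesic_def using sw anti by (intro exI[of _ c] exI[of _ r]) (simp add: chord_arc_def)
  qed
  have inside: "y \<in> ?D \<Longrightarrow> y = xs" using trajectory_end[OF adm close tr ends(1)] ends(2) by simp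
  have start: "(\<forall>\<^sub>F t in at_right 0. chord_arc c r x y t \<notin> ?D) \<or>
        (\<exists>z. first_exit (chord_arc c r x y) {0<..1} ?D z)" if "y \<notin> ?D"
    using trajectory_start[OF adm close tr ends(1)]
  proof (elim disjE bexE conjE)
    assume "\<forall>t. 0 < t \<and> t < 1 \<longrightarrow> chord_arc c r x y t \<notin> ?D"
    then have "\<forall>\<^sub>F t in at_right 0. chord_arc c r x y t \<notin> ?D"
      unfolding eventually_at_right_field by (intro exI[of _ 1]) auto
    then show ?thesis ..
  next
    assume ev: "\<forall>\<^sub>F t in at_right 0. chord_arc c r x y t \<in> ?D"
    from trajectory_first_exit[OF tr ev, unfolded ends(2), OF that]
    obtain t where t: "0 < t \<and> t \<le> 1 \<and> chord_arc c r x y t \<notin> ?D \<and>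
      (\<forall>s. 0 < s \<and> s < t \<longrightarrow> chord_arc c r x y s \<in> ?D)"
      by (rule exE)
    then have "first_exit (chord_arc c r x y) {0<..1} ?D (chord_arc c r x y t)"
      unfolding first_exit_def by (intro bexI[of _ t]) simp_all
    then show ?thesis by (intro disjI2 exI)
  qed
  have exit: "progress \<epsilon> x z" if "first_exit (chord_arc c r x y) {0<..1} ?D z" for z
  proof -
    from that[unfolded first_exit_def] obtain t where "t \<in> {0<..1}" and *: "0 < t \<and> z = chord_arc c r x y t \<and>
        chord_arc c r x y t \<notin> ?D \<and> (\<forall>s. 0 < s \<and> s < t \<longrightarrow> chord_arc c r x y s \<in> ?D)"
      by (rule bexE)
    then have t: "0 < t" "t \<le> 1" "z = chord_arc c r x y t" "chord_arc c r x y t \<notin> ?D"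
      "\<forall>s. 0 < s \<and> s < t \<longrightarrow> chord_arc c r x y s \<in> ?D"
      by simp_all
    show ?thesis
      using trajectory_exit[OF adm close tr ends(1) t(1,2,4,5)] unfolding progress_def t(3) .
  qed
  show ?thesis
    by (intro exI[of _ y] exI[of _ "chord_arc c r x y"] conjI allI impI target geo inside start exit)
qed

subsection \<open>Counting steps\<close>

text \<open>With this, case 1 of the algorithm becomes an instance of the argument for case
  2b.\<close>

lemma zer_empty_star:
  assumes "zer x = {}"
  shows "Pst x = pos x" "Zst x = {}" "cell_star n \<eta> p x = cell n \<eta> p x"
  using assms by (auto simp: Ipos_star_def Izero_star_def Ineg_star_def cell_star_def cell_def)

lemma step_progress:
  assumes adm: "admissible \<epsilon>" and close: "close \<epsilon> x" "x \<noteq> xs"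
  shows "undefined_step n \<eta> p x \<or> (\<exists>y b. step n \<eta> p x y b)"
    and "step n \<eta> p x y True \<Longrightarrow> y = xs"
    and "step n \<eta> p x y False \<Longrightarrow> progress \<epsilon> x y"
proof -
  let ?D = "cell_star n \<eta> p x"
  have m0: "msub x \<noteq> 0" using stationary_eq_xs[OF beta_in_K] G_beta close(2) by metis
  note full = full_stratum_step[OF adm close]
  note empty = zer_empty_star[of x]
  have Zz: "Zst x \<noteq> {} \<Longrightarrow> zer x \<noteq> {}" using Zst_subset[of x] by auto
  show "undefined_step n \<eta> p x \<or> (\<exists>y b. step n \<eta> p x y b)"
  proof (cases "Zst x = {}")
    case True
    show ?thesis
    proof (cases "zer x = {}")
      case z: True
      show ?thesis
        using full(2)[OF True] step.full_center[OF z] step.full_exit[OF z] unfolding empty[OF z] by blast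
    next
      case z: False
      show ?thesis
        using full(2)[OF True] step.star_center[OF z m0 True] step.star_exit[OF z m0 True] by blast
    qed
  next
    case False
    note z = Zz[OF False]
    from sphere_step[OF adm close False] obtain y \<gamma> where y:
      "\<forall>z. sphere_target n \<eta> p x z \<longleftrightarrow> z = y"
      "\<forall>g. sphere_geodesic (Sph_set n \<eta> p (Zst x)) x y g \<longleftrightarrow> g = \<gamma>"
      "y \<notin> ?D \<longrightarrow> (\<forall>\<^sub>F t in at_right 0. \<gamma> t \<notin> ?D) \<or> (\<exists>z. first_exit \<gamma> {0<..1} ?D z)"
      by (elim exE conjE)
    have t: "sphere_target n \<eta> p x y" and g: "sphere_geodesic (Sph_set n \<eta> p (Zst x)) x y \<gamma>"
      using y(1,2) by auto
    consider "y \<in> ?D" | "y \<notin> ?D" "\<forall>\<^sub>F t in at_right 0. \<gamma> t \<notin> ?D"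
      | w where "y \<notin> ?D" "first_exit \<gamma> {0<..1} ?D w" using y(3) by blast
    then show ?thesis
    proof cases
      case 1
      then show ?thesis using step.sphere_min[OF z m0 False t] by blast
    next
      case 2
      then show ?thesis unfolding undefined_step_def using z m0 False t g by blast
    next
      case 3
      then show ?thesis using step.sphere_exit[OF z m0 False t _ g] by blast
    qed
  qed
  show "y = xs" if "step n \<eta> p x y True"
    using that
  proof cases
    case full_center
    note z = \<open>zer x = {}\<close> and c = \<open>center_set n \<eta> p (pos x) \<in> cell n \<eta> p x\<close>
    show ?thesis
      unfolding \<open>y = center_set n \<eta> p (pos x)\<close>
      by (rule full(1)[OF empty(2)[OF z], unfolded empty(1,3)[OF z], OF c])
  next
    case star_center
    show ?thesis
      unfolding \<open>y = center_set n \<eta> p (Pst x)\<close>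
      by (rule full(1)[OF \<open>Zst x = {}\<close> \<open>center_set n \<eta> p (Pst x) \<in> ?D\<close>])
  qed simp_all
  show "progress \<epsilon> x y" if "step n \<eta> p x y False"
    using that
  proof cases
    case full_exit
    note z = \<open>zer x = {}\<close>
    show ?thesis by (rule full(3)[OF empty(2)[OF z], unfolded empty(1,3)[OF z]]) (fact full_exit)+
  next
    case star_exit
    show ?thesis by (rule full(3)) (fact star_exit)+
  next
    case sphere_min
    from sphere_step[OF adm close sphere_min(3)] obtain y' where
      "\<forall>z. sphere_target n \<eta> p x z \<longleftrightarrow> z = y'" "y' \<in> ?D \<longrightarrow> y' = xs" by (elim exE conjE)
    \<comment> \<open>The algorithm does not stop at this step, but the point it reaches is already
      the minimizer.\<close>
    then have "y = xs" using sphere_min by simp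
    then show ?thesis by (simp add: progress_def)
  next
    case (sphere_exit w g)
    from sphere_step[OF adm close sphere_exit(3)] obtain y' \<gamma> where
      "\<forall>z. sphere_target n \<eta> p x z \<longleftrightarrow> z = y'"
      "\<forall>g. sphere_geodesic (Sph_set n \<eta> p (Zst x)) x y' g \<longleftrightarrow> g = \<gamma>"
      "\<forall>z. first_exit \<gamma> {0<..1} ?D z \<longrightarrow> progress \<epsilon> x z" by (elim exE conjE)
    then show ?thesis using sphere_exit by simp
  qed simp_all
qed

text \<open>A stratum is encoded as a ternary word on \<open>zer xs\<close>; elsewhere membership in
  \<open>P\<close> and \<open>Z\<close> is forced, so the code is injective.\<close>

lemma card_strata_le: "card {(P, Z). stratum P Z} \<le> 3 ^ card (zer xs)"
proof -
  define code where "code = (\<lambda>(P, Z). \<lambda>i\<in>zer xs. if i \<in> P then 0 else if i \<in> Z then 1 else (2::nat))"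
  have fin: "finite (zer xs)" by (simp add: Izero_def)
  have "inj_on code {(P, Z). stratum P Z}"
  proof (rule inj_onI, clarify)
    fix P Z P' Z' assume st: "stratum P Z" "stratum P' Z'" and eq: "code (P, Z) = code (P', Z')"
    have e: "(if i \<in> P then 0 else if i \<in> Z then 1 else (2::nat)) = (if i \<in> P' then 0 else if i \<in> Z' then 1 else 2)"
      if "i \<in> zer xs" for i
      using fun_cong[OF eq, of i] that by (simp add: code_def)
    have iff: "(i \<in> P \<longleftrightarrow> i \<in> P') \<and> (i \<in> Z \<longleftrightarrow> i \<in> Z')" if "i \<in> zer xs" for i
      using e[OF that] st that unfolding stratum_def by (auto split: if_splits)
    have "P = P'" using st iff unfolding stratum_def by blast
    moreover have "Z = Z'" using st iff unfolding stratum_def by blast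
    ultimately show "P = P' \<and> Z = Z'" by simp
  qed
  moreover have "code ` {(P, Z). stratum P Z} \<subseteq> (zer xs \<rightarrow>\<^sub>E {0, 1, 2})"
    by (auto simp: code_def split: if_splits)
  moreover have "finite (zer xs \<rightarrow>\<^sub>E {0, 1, 2::nat})" using fin by (intro finite_PiE) auto
  ultimately have "card {(P, Z). stratum P Z} \<le> card (zer xs \<rightarrow>\<^sub>E {0, 1, 2::nat})"
    by (rule card_inj_on_le)
  also have "\<dots> = 3 ^ card (zer xs)" using fin by (simp add: card_PiE numeral_3_eq_3)
  finally show ?thesis .
qed

text \<open>Induction on the rank of the current stratum by energy. Any point of the interval would
  serve for comparing energies; \<open>\<epsilon> / 2\<close> is one. The rank counts the current
  stratum too, so rank 0 leaves only \<open>x = xs\<close>, and the bound needs no extra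
  step.\<close>

lemma reaches_within_energy_rank:
  assumes adm: "admissible \<epsilon>" and "close \<epsilon> x"
    and "card {D. case_prod stratum D \<and> case_prod energy D (\<epsilon> / 2) \<le> energy (Pst x) (Zst x) (\<epsilon> / 2)} \<le> k"
  shows "reaches_within n \<eta> p xs k x"
  using assms(2,3)
proof (induction k arbitrary: x)
  case (0 x)
  show ?case
  proof (cases "x = xs")
    case False
    have "stratum (Pst x) (Zst x)" using stratum_star closeD(1) 0 False by blast
    then have "(Pst x, Zst x) \<in> {D. case_prod stratum D \<and> case_prod energy D (\<epsilon> / 2) \<le> energy (Pst x) (Zst x) (\<epsilon> / 2)}"
      by simp
    moreover have "finite {D. case_prod stratum D \<and> case_prod energy D (\<epsilon> / 2) \<le> energy (Pst x) (Zst x) (\<epsilon> / 2)}"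
      by (rule finite_subset[OF _ finite_strata]) auto
    ultimately show ?thesis using 0(2) by (metis (no_types, lifting) card_gt_0_iff empty_iff not_le)
  qed simp
next
  case (Suc k x)
  show ?case
  proof (cases "x = xs")
    case False
    note near = closeD(1)[OF Suc.prems(1) False]
    note sp = step_progress[OF adm Suc.prems(1) False]
    have "reaches_within n \<eta> p xs k y" if "step n \<eta> p x y False" for y
    proof (cases "y = xs")
      case True
      then show ?thesis by (cases k) auto
    next
      case y: False
      have \<epsilon>: "\<epsilon> / 2 \<in> {0<..<\<epsilon>}" using adm by (simp add: admissible_def)
      have cy: "close \<epsilon> y" and lt: "energy (Pst y) (Zst y) (\<epsilon> / 2) < energy (Pst x) (Zst x) (\<epsilon> / 2)"
        using sp(3)[OF that] y \<epsilon> unfolding progress_def by blast+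
      let ?R = "\<lambda>x. {D. case_prod stratum D \<and> case_prod energy D (\<epsilon> / 2) \<le> energy (Pst x) (Zst x) (\<epsilon> / 2)}"
      have "?R y \<subset> ?R x"
      proof
        show "?R y \<subseteq> ?R x" using lt by auto
        have "(Pst x, Zst x) \<in> ?R x" using stratum_star[OF near] by simp
        moreover have "(Pst x, Zst x) \<notin> ?R y" using lt by simp
        ultimately show "?R y \<noteq> ?R x" by blast
      qed
      moreover have "finite (?R x)" by (rule finite_subset[OF _ finite_strata]) auto
      ultimately have "card (?R y) < card (?R x)" by (rule psubset_card_mono[rotated])
      then show ?thesis using Suc.IH[OF cy] Suc.prems(2) by simp
    qed
    then show ?thesis using sp(1,2) by simp
  qed simp
qed

lemma reaches_within_neighbourhood:
  "\<exists>U. open U \<and> xs \<in> U \<and> (\<forall>x\<in>U. reaches_within n \<eta> p xs (3 ^ card (zer xs)) x)"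
proof -
  obtain \<epsilon> where adm: "admissible \<epsilon>" using admissible_exists by blast
  obtain \<delta> where \<delta>: "\<delta> > 0" "\<And>x. obj x < obj xs + \<delta> \<Longrightarrow> pos xs \<subseteq> pos x \<and> neg xs \<subseteq> neg x"
    using nearby_signs by blast
  \<comment> \<open>The bound \<open>\<delta>\<close> fixes the signs that are nonzero at
    \<open>xs\<close>, and \<open>\<epsilon> / (2 * \<kappa>)\<close> makes \<tau> smaller than
    \<open>\<epsilon>\<close>.\<close>
  define U where "U = {x. obj x < obj xs + min \<delta> (\<epsilon> / (2 * \<kappa>))}"
  have \<epsilon>: "\<epsilon> > 0" using adm by (simp add: admissible_def)
  have "continuous_on UNIV obj"
    unfolding F_def[abs_def] by (intro continuous_intros continuous_q)
  then have "open U" unfolding U_def by (intro open_Collect_less continuous_intros)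
  moreover have "xs \<in> U" using \<delta>(1) \<epsilon> kappa_pos by (simp add: U_def)
  moreover have "reaches_within n \<eta> p xs (3 ^ card (zer xs)) x" if "x \<in> U" for x
  proof (rule reaches_within_energy_rank[OF adm])
    have "obj x - obj xs < \<epsilon> / (2 * \<kappa>)" using that by (simp add: U_def)
    then have "2 * \<kappa> * (obj x - obj xs) < \<epsilon>" using kappa_pos by (simp add: field_simps)
    moreover have "near z" if "obj z \<le> obj x" for z
      using \<delta>(2)[of z] that \<open>x \<in> U\<close> by (simp add: U_def near_def)
    ultimately show "close \<epsilon> x" by (simp add: close_def)
    have "card {D. case_prod stratum D \<and> case_prod energy D (\<epsilon> / 2) \<le> energy (Pst x) (Zst x) (\<epsilon> / 2)}
        \<le> card {(P, Z). stratum P Z}"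
      by (rule card_mono[OF finite_strata]) auto
    then show "card {D. case_prod stratum D \<and> case_prod energy D (\<epsilon> / 2) \<le> energy (Pst x) (Zst x) (\<epsilon> / 2)}
        \<le> 3 ^ card (zer xs)" using card_strata_le by linarith
  qed
  ultimately show ?thesis by blast
qed

end

theorem mainTheorem2:
  fixes n :: nat and \<eta> :: real and p :: "nat \<Rightarrow> 'a::euclidean_space" and xs :: 'a
  assumes "\<exists>i\<in>{1..n}. \<exists>j\<in>{1..n}. p i \<noteq> p j"
    and "0 < \<eta>" and "\<eta> < 1 - 1 / real n"
    and "generic_position n \<eta> p"
    and "\<forall>z. F n \<eta> p xs \<le> F n \<eta> p z"
  shows "\<exists>U. open U \<and> xs \<in> U \<and>
           (\<forall>x\<in>U. reaches_within n \<eta> p xs (3 ^ card (Izero n \<eta> p xs)) x)"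
proof -
  interpret spherical_clusters_min n \<eta> p xs
    by unfold_locales (fact assms)+
  show ?thesis by (rule reaches_within_neighbourhood)
qed

end
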